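(* Let $X$ be a metric graph and $r>0$. Then $\operatorname{Rips}(X,r)\simeq X$ if and only if $r\le\ell(X)/3$.
   Context: A metric graph is a finite graph equipped with a geodesic metric; $\ell(X)$ is the length of the shortest non-contractible loop in $X$ ($\infty$ for trees). $\operatorname{Rips}(X,r)$ is the simplicial complex (weak topology) with vertex set $X$ whose simplices are the finite subsets of diameter $<r$. *)

theory Defs
  imports "HOL-Analysis.Analysis"
begin

text \<open>A step (e,s,t) moves along edge e (parametrised by gamma e on [0, L e]) from
parameter s to parameter t; its cost is |s - t|.  A chain from x to y is a list of
consecutive such steps.\<close>

definition graph_chain ::
  "nat set \<Rightarrow> (nat \<Rightarrow> real) \<Rightarrow> (nat \<Rightarrow> real \<Rightarrow> 'a) \<Rightarrow> 'a \<Rightarrow> 'a \<Rightarrow> (nat \<times> real \<times> real) list \<Rightarrow> bool"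
  where "graph_chain E L \<gamma> x y cs \<longleftrightarrow>
     (\<forall>(e,s,t)\<in>set cs. e \<in> E \<and> s \<in> {0..L e} \<and> t \<in> {0..L e}) \<and>
     (if cs = [] then x = y
      else \<gamma> (fst (hd cs)) (fst (snd (hd cs))) = x \<and>
           \<gamma> (fst (last cs)) (snd (snd (last cs))) = y \<and>
           (\<forall>i. Suc i < length cs \<longrightarrow> \<gamma> (fst (cs!i)) (snd (snd (cs!i)))
                                = \<gamma> (fst (cs!(Suc i))) (fst (snd (cs!(Suc i))))))"

definition graph_chain_costs ::
  "nat set \<Rightarrow> (nat \<Rightarrow> real) \<Rightarrow> (nat \<Rightarrow> real \<Rightarrow> 'a) \<Rightarrow> 'a \<Rightarrow> 'a \<Rightarrow> real set"
  where "graph_chain_costs E L \<gamma> x y =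
     {sum_list (map (\<lambda>(e,s,t). \<bar>s - t\<bar>) cs) | cs. graph_chain E L \<gamma> x y cs}"

text \<open>(X,d) is a metric graph: X is the union of a finite vertex set V and finitely many
edges gamma e : [0, L e] \<rightarrow> X (L e > 0) with endpoints in V, injective on the open
interval, open edges pairwise disjoint and disjoint from V (loops and multiple
edges allowed), and d is the induced geodesic (path) metric; connected.\<close>

definition metric_graph :: "'a set \<Rightarrow> ('a \<Rightarrow> 'a \<Rightarrow> real) \<Rightarrow> bool" where
  "metric_graph X d \<longleftrightarrow> Metric_space X d \<and>
    (\<exists>V (E::nat set) L \<gamma>. finite V \<and> finite E \<and> V \<subseteq> X \<and>
       (\<forall>e\<in>E. 0 < L e) \<and>
       X = V \<union> (\<Union>e\<in>E. \<gamma> e ` {0..L e}) \<and>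
       (\<forall>e\<in>E. \<gamma> e 0 \<in> V \<and> \<gamma> e (L e) \<in> V \<and> inj_on (\<gamma> e) {0<..<L e} \<and>
               \<gamma> e ` {0<..<L e} \<inter> V = {}) \<and>
       (\<forall>e\<in>E. \<forall>e'\<in>E. e \<noteq> e' \<longrightarrow> \<gamma> e ` {0<..<L e} \<inter> \<gamma> e' ` {0<..<L e'} = {}) \<and>
       (\<forall>x\<in>X. \<forall>y\<in>X. graph_chain_costs E L \<gamma> x y \<noteq> {} \<and>
                      d x y = Inf (graph_chain_costs E L \<gamma> x y)))"

definition path_length :: "('a \<Rightarrow> 'a \<Rightarrow> real) \<Rightarrow> (real \<Rightarrow> 'a) \<Rightarrow> ereal" where
  "path_length d g = (SUP (n, t) \<in> {(n::nat, t::nat \<Rightarrow> real). t 0 = 0 \<and> t n = 1 \<and>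
        (\<forall>i<n. t i \<le> t (Suc i))}. ereal (\<Sum>i<n. d (g (t i)) (g (t (Suc i)))))"

definition noncontractible_loop :: "'a set \<Rightarrow> ('a \<Rightarrow> 'a \<Rightarrow> real) \<Rightarrow> (real \<Rightarrow> 'a) \<Rightarrow> bool" where
  "noncontractible_loop X d g \<longleftrightarrow>
     continuous_map (top_of_set {0..1}) (Metric_space.mtopology X d) g \<and> g 0 = g 1 \<and>
     \<not> (\<exists>a. homotopic_with (\<lambda>h. h 0 = h 1) (top_of_set {0..1}) (Metric_space.mtopology X d)
              g (\<lambda>_. a))"

text \<open>ell(X); equals \<infinity> when there is no non-contractible loop (trees).\<close>
definition shortest_loop :: "'a set \<Rightarrow> ('a \<Rightarrow> 'a \<Rightarrow> real) \<Rightarrow> ereal" where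
  "shortest_loop X d = (INF g \<in> {g. noncontractible_loop X d g}. path_length d g)"

definition rips_simplex :: "'a set \<Rightarrow> ('a \<Rightarrow> 'a \<Rightarrow> real) \<Rightarrow> real \<Rightarrow> 'a set \<Rightarrow> bool" where
  "rips_simplex X d r \<sigma> \<longleftrightarrow> finite \<sigma> \<and> \<sigma> \<noteq> {} \<and> \<sigma> \<subseteq> X \<and> (\<forall>x\<in>\<sigma>. \<forall>y\<in>\<sigma>. d x y < r)"

text \<open>Geometric realisation: barycentric coordinate functions supported on a simplex.\<close>
definition rips_carrier :: "'a set \<Rightarrow> ('a \<Rightarrow> 'a \<Rightarrow> real) \<Rightarrow> real \<Rightarrow> ('a \<Rightarrow> real) set" where
  "rips_carrier X d r = {f. (\<forall>x. 0 \<le> f x) \<and> rips_simplex X d r {x. f x \<noteq> 0} \<and>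
                          (\<Sum>x\<in>{x. f x \<noteq> 0}. f x) = 1}"

definition closed_simplex :: "'a set \<Rightarrow> ('a \<Rightarrow> real) set" where
  "closed_simplex \<sigma> = {f. (\<forall>x. 0 \<le> f x) \<and> {x. f x \<noteq> 0} \<subseteq> \<sigma> \<and> (\<Sum>x\<in>\<sigma>. f x) = 1}"

definition rips_open :: "'a set \<Rightarrow> ('a \<Rightarrow> 'a \<Rightarrow> real) \<Rightarrow> real \<Rightarrow> ('a \<Rightarrow> real) set \<Rightarrow> bool" where
  "rips_open X d r U \<longleftrightarrow> U \<subseteq> rips_carrier X d r \<and>
     (\<forall>\<sigma>. rips_simplex X d r \<sigma> \<longrightarrow>
        openin (subtopology (powertop_real UNIV) (closed_simplex \<sigma>)) (U \<inter> closed_simplex \<sigma>))"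

lemma istopology_rips_open: "istopology (rips_open X d r)"
  unfolding istopology_def
proof (intro conjI allI impI)
  fix S T assume "rips_open X d r S" "rips_open X d r T"
  then show "rips_open X d r (S \<inter> T)"
  proof -
    have e: "(S \<inter> T) \<inter> closed_simplex \<sigma> = (S \<inter> closed_simplex \<sigma>) \<inter> (T \<inter> closed_simplex \<sigma>)" for \<sigma>
      by blast
    show ?thesis using \<open>rips_open X d r S\<close> \<open>rips_open X d r T\<close>
      unfolding rips_open_def e by (auto intro: openin_Int)
  qed
next
  fix K assume K: "\<forall>S\<in>K. rips_open X d r S"
  show "rips_open X d r (\<Union>K)"
    unfolding rips_open_def
  proof (intro conjI allI impI)
    show "\<Union>K \<subseteq> rips_carrier X d r" using K by (auto simp: rips_open_def)
    fix \<sigma> assume "rips_simplex X d r \<sigma>"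
    then have "\<forall>S\<in>K. openin (subtopology (powertop_real UNIV) (closed_simplex \<sigma>)) (S \<inter> closed_simplex \<sigma>)"
      using K by (auto simp: rips_open_def)
    then have "openin (subtopology (powertop_real UNIV) (closed_simplex \<sigma>)) (\<Union>S\<in>K. S \<inter> closed_simplex \<sigma>)"
      by (intro openin_Union) auto
    moreover have "(\<Union>S\<in>K. S \<inter> closed_simplex \<sigma>) = \<Union>K \<inter> closed_simplex \<sigma>" by auto
    ultimately show "openin (subtopology (powertop_real UNIV) (closed_simplex \<sigma>)) (\<Union>K \<inter> closed_simplex \<sigma>)"
      by simp
  qed
qed

definition rips_topology :: "'a set \<Rightarrow> ('a \<Rightarrow> 'a \<Rightarrow> real) \<Rightarrow> real \<Rightarrow> ('a \<Rightarrow> real) topology" where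
  "rips_topology X d r = topology (rips_open X d r)"

end

theory Submission
  imports Defs "HOL-Complex_Analysis.Winding_Numbers"
begin

text \<open>Both sides are equivalent to the condition that geodesic triangles with sides shorter than
\<open>r\<close> are tripods. If they are, a simplex is spanned by points of a tree, and the centre of the
smallest ball containing them, taken with respect to distances enlarged according to the barycentric
coordinates, is unique and depends continuously on the coordinates; this gives a homotopy inverse to
the map from \<open>X\<close> to the complex given by a partition of unity. Moreover a loop shorter than
\<open>3 * r\<close> splits into three arcs shorter than \<open>r\<close> and contracts along geodesics. If some
triangle is not a tripod, it crosses an interior point of an edge \<open>e\<close> exactly once, so collapsing
the complement of \<open>e\<close> maps it to the circle with degree one or minus one. Hence it is not
contractible in \<open>X\<close>, although it is in the complex. Since every loop of the complex comes from
\<open>X\<close>, the first cohomology of the complex with mod 2 coefficients is then smaller than that of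
\<open>X\<close>, which is finite.\<close>

section \<open>Geodesic spaces and tripods\<close>

text \<open>In the second half the given homotopy equivalence is arbitrary and need not be related
  to the natural map \<open>\<psi>\<close> from X to the complex, so it does not suffice that
  \<open>\<psi>\<close> kills a loop. Counting repairs this: pullback along \<open>\<psi>\<close>
  embeds the classes of the complex into those of X and misses one, whereas any equivalence makes
  the former at least as numerous as the latter. Such a count needs finite sets, hence coefficients
  mod 2; in an infinite group a proper subgroup may be isomorphic to the whole.

  In the first half the obstacle is continuity. Geodesics and centres are given by equations rather
  than formulas. The tripod condition makes the solutions unique, so their graphs are closed, and X
  is compact. The centre must also not depend on the simplex in which a point of the complex is
  viewed, which is why the distances are enlarged in proportion to the coordinates divided by the
  largest of them.\<close>

lemma continuous_map_of_closed_graph: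
  assumes "compact_space Y" "f \<in> topspace X \<rightarrow> topspace Y"
    and "closedin (prod_topology X Y) {(x, y). x \<in> topspace X \<and> y = f x}"
  shows "continuous_map X Y f"
  unfolding continuous_map_closedin
proof (intro conjI allI impI ballI)
  show "f \<in> topspace X \<rightarrow> topspace Y" by (rule assms(2))
  fix C assume C: "closedin Y C"
  let ?G = "{(x, y). x \<in> topspace X \<and> y = f x}"
  have "closedin (prod_topology X Y) (?G \<inter> (topspace X \<times> C))"
    by (intro closedin_Int assms) (simp add: closedin_prod_Times_iff C)
  then have "closedin X (fst ` (?G \<inter> (topspace X \<times> C)))"
    using closed_map_fst[OF assms(1), of X] by (auto simp: closed_map_def)
  moreover have "fst ` (?G \<inter> (topspace X \<times> C)) = {x \<in> topspace X. f x \<in> C}"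
    by force
  ultimately show "closedin X {x \<in> topspace X. f x \<in> C}" by simp
qed

context Metric_space
begin

lemma continuous_map_d [continuous_intros]:
  assumes "continuous_map T mtopology f" "continuous_map T mtopology g"
  shows "continuous_map T euclideanreal (\<lambda>x. d (f x) (g x))"
  using continuous_map_mdist[of T Self f g] assms
  by (simp add: Self_def)

lemma continuous_map_Lipschitz_real:
  assumes "\<And>s. s \<in> S \<Longrightarrow> f s \<in> M" "\<And>s t. s \<in> S \<Longrightarrow> t \<in> S \<Longrightarrow> d (f s) (f t) \<le> K * \<bar>s - t\<bar>"
  shows "continuous_map (top_of_set S) mtopology f"
proof -
  have K: "0 \<le> d x y" for x y by simp
  show ?thesis
    unfolding continuous_map_to_metric
  proof (intro ballI allI impI)
    fix x \<epsilon> :: real assume x: "x \<in> topspace (top_of_set S)" and e: "\<epsilon> > 0"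
    let ?U = "S \<inter> ball x (\<epsilon> / (\<bar>K\<bar> + 1))"
    have "f y \<in> mball (f x) \<epsilon>" if y: "y \<in> ?U" for y
    proof -
      have "d (f x) (f y) \<le> K * \<bar>x - y\<bar>" using assms(2) x y by auto
      also have "\<dots> \<le> (\<bar>K\<bar> + 1) * \<bar>x - y\<bar>" by (intro mult_right_mono) auto
      also have "\<dots> < \<epsilon>" using y by (simp add: dist_real_def field_simps)
      finally show ?thesis using assms(1) x y by auto
    qed
    moreover have "x \<in> ?U" using x e by (auto intro!: divide_pos_pos)
    moreover have "openin (top_of_set S) ?U" by auto
    ultimately show "\<exists>U. openin (top_of_set S) U \<and> x \<in> U \<and> (\<forall>y\<in>U. f y \<in> mball (f x) \<epsilon>)" by blast
  qed
qed

definition geodesic_path :: "'a \<Rightarrow> 'a \<Rightarrow> (real \<Rightarrow> 'a) \<Rightarrow> bool" where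
  "geodesic_path x y p \<longleftrightarrow> p 0 = x \<and> p 1 = y \<and> p ` {0..1} \<subseteq> M \<and>
     (\<forall>s\<in>{0..1}. \<forall>t\<in>{0..1}. d (p s) (p t) = \<bar>s - t\<bar> * d x y)"

lemma geodesic_path_pathin: "geodesic_path x y p \<Longrightarrow> pathin mtopology p"
  unfolding pathin_def geodesic_path_def
  by (rule continuous_map_Lipschitz_real[where K="d x y"]) (auto simp: mult.commute)

lemma geodesic_path_dist:
  assumes "geodesic_path x y p" "t \<in> {0..1}"
  shows "d x (p t) = t * d x y" "d (p t) y = (1 - t) * d x y" "d x (p t) + d (p t) y = d x y" "p t \<in> M"
proof -
  have iso: "d (p s) (p u) = \<bar>s - u\<bar> * d x y" if "s \<in> {0..1}" "u \<in> {0..1}" for s u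
    using assms that unfolding geodesic_path_def by blast
  have p: "p 0 = x" "p 1 = y" using assms unfolding geodesic_path_def by blast+
  show "d x (p t) = t * d x y" using iso[of 0 t] assms(2) p by simp
  moreover show "d (p t) y = (1 - t) * d x y" using iso[of t 1] assms(2) p by simp
  ultimately show "d x (p t) + d (p t) y = d x y" by (simp add: algebra_simps)
  show "p t \<in> M" using assms unfolding geodesic_path_def by auto
qed

text \<open>In a geodesic space this says that a geodesic triangle with sides shorter than \<open>r\<close> is a
tripod: each point of one side lies on one of the other two.\<close>
definition tripod :: "real \<Rightarrow> bool" where
  "tripod r \<longleftrightarrow> (\<forall>x\<in>M. \<forall>y\<in>M. \<forall>z\<in>M. \<forall>m\<in>M. d x y < r \<longrightarrow> d y z < r \<longrightarrow> d z x < r \<longrightarrow>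
     d x m + d m y = d x y \<longrightarrow> d z x = d z m + d m x \<or> d z y = d z m + d m y)"

lemma tripodD:
  assumes "tripod r" "x \<in> M" "y \<in> M" "z \<in> M" "m \<in> M" "d x y < r" "d z x < r" "d z y < r"
    "d x m + d m y = d x y"
  obtains "d z x = d z m + d m x" | "d z y = d z m + d m y"
proof -
  have "d y z < r" using assms(8) by (metis commute)
  then show ?thesis using assms that unfolding tripod_def by blast
qed

text \<open>\<open>m\<close> lies between \<open>z\<close> and one of the ends, so it is no farther
  from \<open>z\<close> than that end. The triangle inequality alone would only give
  \<open>3 * r / 2\<close>. This convexity of balls keeps the contraction of short loops in the
  range where geodesics are unique.\<close>

lemma tripod_dist_less:
  assumes "tripod r" "x \<in> M" "y \<in> M" "z \<in> M" "m \<in> M" "d x y < r" "d z x < r" "d z y < r"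
    "d x m + d m y = d x y"
  shows "d z m < r"
  by (rule tripodD[OF assms]) (use assms nonneg[of m x] nonneg[of m y] in linarith)+

text \<open>Apply the tripod condition to \<open>x\<close>, \<open>y\<close>, \<open>m'\<close> and
  the point \<open>m\<close>: since \<open>m\<close> and \<open>m'\<close> are equally far from both
  ends, either alternative leaves \<open>d m' m = 0\<close>.\<close>

lemma tripod_unique:
  assumes "tripod r" "x \<in> M" "y \<in> M" "m \<in> M" "m' \<in> M" "d x y < r"
    "d x m + d m y = d x y" "d x m' + d m' y = d x y" "d x m = d x m'"
  shows "m = m'"
proof -
  have my: "d m y = d m' y" using assms by linarith
  have "d m' x < r" "d m' y < r"
    using assms commute[of m' x] nonneg[of m' y] nonneg[of x m'] by linarith+
  then have "d m' m = 0"
    by (rule tripodD[OF assms(1-3,5,4,6) _ _ assms(7)])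
      (use assms my commute[of m' x] commute[of m x] in linarith)+
  then show ?thesis using zero[OF assms(5,4)] by simp
qed

end

section \<open>Existence of geodesics in compact spaces\<close>

locale compact_geodesic = Metric_space X d for X :: "'a set" and d +
  assumes compact: "compact_space mtopology"
    and between: "\<lbrakk>x \<in> X; y \<in> X; 0 \<le> t; t \<le> d x y\<rbrakk> \<Longrightarrow> \<exists>m\<in>X. d x m = t \<and> d m y = d x y - t"
begin

lemma finite_net:
  assumes "0 < e" obtains N where "finite N" "N \<subseteq> X" "\<And>x. x \<in> X \<Longrightarrow> \<exists>a\<in>N. d x a < e"
proof -
  have "mtotally_bounded X" using compact compactin_imp_mtotally_bounded by (auto simp: compact_space_def)
  then obtain K where "finite K" "K \<subseteq> X" "X \<subseteq> (\<Union>x\<in>K. mball x e)"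
    using assms unfolding mtotally_bounded_def by meson
  with that[of K] show ?thesis by (auto simp: commute subset_iff)
qed

text \<open>The locale only provides single points at prescribed distances, as in Menger's theorem.
  A new parameter is inserted between its neighbours \<open>a\<close> and \<open>b\<close>. Finite
  sets of parameters are enough because compactness does the rest in
  \<open>isometry_exists\<close>.\<close>

lemma isometry_on_finite:
  assumes x: "x \<in> X" "y \<in> X" and F: "finite F" "F \<subseteq> {0..d x y}"
  shows "\<exists>p. p 0 = x \<and> p (d x y) = y \<and> range p \<subseteq> X \<and>
     (\<forall>s\<in>insert 0 (insert (d x y) F). \<forall>t\<in>insert 0 (insert (d x y) F). d (p s) (p t) = \<bar>s - t\<bar>)"
  using F
proof (induction F)
  case empty
  show ?case
    by (rule exI[of _ "\<lambda>s. if s = 0 then x else y"]) (use x commute[of x y] nonneg[of x y] in auto)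
next
  case (insert u F)
  let ?D = "d x y"
  let ?F = "insert 0 (insert ?D F)"
  from insert obtain p where p: "p 0 = x" "p ?D = y" "range p \<subseteq> X"
    and iso: "\<forall>s\<in>?F. \<forall>t\<in>?F. d (p s) (p t) = \<bar>s - t\<bar>" by auto
  show ?case
  proof (cases "u \<in> ?F")
    case True
    then have "insert 0 (insert ?D (insert u F)) = ?F" by auto
    then show ?thesis using p iso by metis
  next
    case False
    have u: "0 < u" "u < ?D" using False insert.prems by (auto simp: less_le)
    define a where "a = Max {t\<in>?F. t \<le> u}"
    define b where "b = Min {t\<in>?F. t \<ge> u}"
    have fin: "finite {t\<in>?F. t \<le> u}" "finite {t\<in>?F. t \<ge> u}" using insert by auto
    have a: "a \<in> ?F" "a \<le> u"
      using Max_in[OF fin(1)] u unfolding a_def[symmetric] by (blast intro: less_imp_le)+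
    have b: "b \<in> ?F" "u \<le> b"
      using Min_in[OF fin(2)] u unfolding b_def[symmetric] by (blast intro: less_imp_le)+
    have ab: "t \<le> a \<or> b \<le> t" if "t \<in> ?F" for t
    proof (cases "t \<le> u")
      case True then show ?thesis using Max_ge[OF fin(1), of t] that unfolding a_def[symmetric] by auto
    next
      case F: False then show ?thesis using Min_le[OF fin(2), of t] that unfolding b_def[symmetric] by auto
    qed
    have pX: "p t \<in> X" for t using p by auto
    have "d (p a) (p b) = \<bar>a - b\<bar>" using iso a(1) b(1) by blast
    then have dab: "d (p a) (p b) = b - a" using a b by simp
    obtain m where m: "m \<in> X" "d (p a) m = u - a" "d m (p b) = b - u"
      using between[OF pX pX, of "u - a" a b] a b dab by auto
    \<comment> \<open>For \<open>t\<close> to the left of the gap the upper bound goes through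
      \<open>p a\<close> and the lower bound through \<open>p b\<close>; to the right the roles are
      exchanged.\<close>
    have dm: "d (p t) m = \<bar>t - u\<bar>" if t: "t \<in> ?F" for t
    proof (cases "t \<le> a")
      case True
      have "d (p t) (p a) = \<bar>t - a\<bar>" "d (p t) (p b) = \<bar>t - b\<bar>" using iso a(1) b(1) t by blast+
      then show ?thesis using triangle[OF pX m(1) pX, of t b] triangle[OF pX pX m(1), of t a] m True a b by auto
    next
      case F: False
      have bt: "b \<le> t" using ab t F by auto
      have "d (p t) (p b) = \<bar>t - b\<bar>" "d (p t) (p a) = \<bar>t - a\<bar>" using iso a(1) b(1) t by blast+
      then show ?thesis using triangle[OF pX m(1) pX, of t a] triangle[OF pX pX m(1), of t b]
        m bt a b commute[of m] by auto
    qed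
    have um: "d m (p t) = \<bar>u - t\<bar>" if "t \<in> ?F" for t using dm[OF that] commute[of m] by auto
    show ?thesis
    proof (intro exI[of _ "p(u := m)"] conjI ballI)
      show "(p(u := m)) 0 = x" "(p(u := m)) ?D = y" using u p by auto
      show "range (p(u := m)) \<subseteq> X" using p m by auto
      fix s t assume "s \<in> insert 0 (insert ?D (insert u F))" "t \<in> insert 0 (insert ?D (insert u F))"
      then have "s = u \<or> s \<noteq> u \<and> s \<in> ?F" "t = u \<or> t \<noteq> u \<and> t \<in> ?F" by auto
      then show "d ((p(u := m)) s) ((p(u := m)) t) = \<bar>s - t\<bar>"
        using dm um iso m by auto
    qed
  qed
qed

text \<open>The maps that are isometric at a given pair of parameters form closed subsets, with the finite
intersection property, of the compact product of copies of \<open>X\<close> indexed by the parameters.\<close>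
lemma isometry_exists:
  assumes x: "x \<in> X" "y \<in> X"
  shows "\<exists>p. p 0 = x \<and> p (d x y) = y \<and> (\<forall>s\<in>{0..d x y}. p s \<in> X) \<and>
     (\<forall>s\<in>{0..d x y}. \<forall>t\<in>{0..d x y}. d (p s) (p t) = \<bar>s - t\<bar>)"
proof -
  let ?D = "d x y"
  let ?I = "{0..?D}"
  let ?T = "product_topology (\<lambda>_. mtopology) ?I"
  define C where "C = (\<lambda>(s,t). {p \<in> topspace ?T. p 0 = x \<and> p ?D = y \<and> d (p s) (p t) = \<bar>s - t\<bar>})"
  have cs: "compact_space ?T" using compact by (simp add: compact_space_product_topology)
  have D0: "0 \<in> ?I" "?D \<in> ?I" by auto
  have pr: "continuous_map ?T mtopology (\<lambda>p. p s)" if "s \<in> ?I" for s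
    by (rule continuous_map_product_projection[OF that])
  have cl1: "closedin ?T {p \<in> topspace ?T. p s = z}" if "s \<in> ?I" "z \<in> X" for s z
  proof -
    have "closedin mtopology {z}" using Hausdorff_space_mtopology that(2)
      by (simp add: closedin_Hausdorff_singleton)
    from closedin_continuous_map_preimage[OF pr[OF that(1)] this] show ?thesis by simp
  qed
  have clC: "closedin ?T (C st)" if I: "st \<in> ?I \<times> ?I" for st
  proof -
    obtain s t where st: "st = (s,t)" "s \<in> ?I" "t \<in> ?I" using I by blast
    have "continuous_map ?T euclideanreal (\<lambda>p. d (p s) (p t))"
      by (intro continuous_map_d pr st)
    from closedin_continuous_map_preimage[OF this, of "{\<bar>s - t\<bar>}"]
    have "closedin ?T {p \<in> topspace ?T. d (p s) (p t) = \<bar>s - t\<bar>}" by simp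
    moreover have "C st = {p \<in> topspace ?T. p 0 = x} \<inter> {p \<in> topspace ?T. p ?D = y} \<inter>
       {p \<in> topspace ?T. d (p s) (p t) = \<bar>s - t\<bar>}" unfolding C_def st by auto
    ultimately show ?thesis using cl1[OF D0(1) x(1)] cl1[OF D0(2) x(2)] by auto
  qed
  have fip: "\<Inter>\<F> \<noteq> {}" if F: "finite \<F>" "\<F> \<subseteq> C ` (?I \<times> ?I)" for \<F>
  proof -
    obtain P where P: "finite P" "P \<subseteq> ?I \<times> ?I" "\<F> = C ` P"
      using finite_subset_image[OF F] by blast
    let ?F = "fst ` P \<union> snd ` P"
    have "finite ?F" "?F \<subseteq> ?I" using P by auto
    from isometry_on_finite[OF x this] obtain p where p: "p 0 = x" "p ?D = y" "range p \<subseteq> X"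
      "\<forall>s\<in>insert 0 (insert ?D ?F). \<forall>t\<in>insert 0 (insert ?D ?F). d (p s) (p t) = \<bar>s - t\<bar>" by auto
    have "restrict p ?I \<in> C st" if st: "st \<in> P" for st
    proof -
      obtain s t where e: "st = (s,t)" by force
      then have "s \<in> ?F" "t \<in> ?F" using st by force+
      moreover have "s \<in> ?I" "t \<in> ?I" using st P e by auto
      ultimately show ?thesis using p e D0 unfolding C_def by (auto simp: topspace_product_topology)
    qed
    then have "restrict p ?I \<in> \<Inter>\<F>" using P by blast
    then show ?thesis by blast
  qed
  have "\<Inter>(C ` (?I \<times> ?I)) \<noteq> {}"
    using cs[unfolded compact_space_fip] clC fip by auto
  then obtain p where p: "p \<in> C (s,t)" if "s \<in> ?I" "t \<in> ?I" for s t by blast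
  show ?thesis
  proof (intro exI[of _ p] conjI ballI)
    show "p 0 = x" "p ?D = y" using p[OF D0] unfolding C_def by auto
    show "p s \<in> X" if "s \<in> ?I" for s using p[OF that that] that unfolding C_def
      by (auto simp: topspace_product_topology)
    show "d (p s) (p t) = \<bar>s - t\<bar>" if "s \<in> ?I" "t \<in> ?I" for s t using p[OF that] unfolding C_def by auto
  qed
qed

text \<open>Geodesics from \<open>x\<close> to \<open>m\<close> and from \<open>m\<close> to
  \<open>y\<close> are concatenated. The result does not increase distances, and its length is only
  \<open>d x y\<close>, so it is isometric. The assumption \<open>m \<noteq> x\<close> makes
  \<open>d x y\<close> positive for the rescaling; \<open>m = y\<close> is allowed and yields plain
  existence.\<close>

lemma geodesic_path_through:
  assumes "x \<in> X" "y \<in> X" "m \<in> X" "d x m + d m y = d x y" "m \<noteq> x"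
  shows "\<exists>p. geodesic_path x y p \<and> p (d x m / d x y) = m"
proof -
  let ?D = "d x y" and ?a = "d x m"
  have a: "0 < ?a" using assms mdist_pos_less[of x m] by auto
  have a2: "?a \<le> ?D" using assms(4) nonneg[of m y] by linarith
  note a = a a2
  from isometry_exists[OF assms(1,3)] obtain p where p: "p 0 = x" "p ?a = m" "\<forall>s\<in>{0..?a}. p s \<in> X"
     "\<forall>s\<in>{0..?a}. \<forall>t\<in>{0..?a}. d (p s) (p t) = \<bar>s - t\<bar>" by auto
  from isometry_exists[OF assms(3,2)] obtain q where q: "q 0 = m" "q (d m y) = y" "\<forall>s\<in>{0..d m y}. q s \<in> X"
     "\<forall>s\<in>{0..d m y}. \<forall>t\<in>{0..d m y}. d (q s) (q t) = \<bar>s - t\<bar>" by auto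
  define g where "g = (\<lambda>s. if s \<le> ?a then p s else q (s - ?a))"
  have gX: "g s \<in> X" if "s \<in> {0..?D}" for s using that assms p q unfolding g_def by auto
  have g0: "g 0 = x" using p a by (simp add: g_def)
  have gD: "g ?D = y"
  proof (cases "?D \<le> ?a")
    case True then have "d m y = 0" "?D = ?a" using a assms by auto
    then show ?thesis using assms p by (simp add: g_def)
  next
    case False
    moreover have "?D - ?a = d m y" using assms(4) by simp
    ultimately show ?thesis using q by (simp add: g_def)
  qed
  have le: "d (g s) (g t) \<le> t - s" if "0 \<le> s" "s \<le> t" "t \<le> ?D" for s t
  proof (cases "s \<le> ?a \<and> ?a < t")
    case True
    have "d (g s) m = ?a - s"
    proof -
      have "d (p s) (p ?a) = \<bar>s - ?a\<bar>" using p(4) True that a by auto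
      then show ?thesis using True p(2) by (simp add: g_def)
    qed
    moreover have "d m (g t) = t - ?a"
    proof -
      have "d (q 0) (q (t - ?a)) = \<bar>0 - (t - ?a)\<bar>" using q(4) True that assms(4) by auto
      then show ?thesis using True q(1) by (simp add: g_def)
    qed
    ultimately show ?thesis using triangle[of "g s" m "g t"] gX[of s] gX[of t] that assms by auto
  next
    case False
    then show ?thesis using p(4) q(4) that assms(4) by (auto simp: g_def)
  qed
  \<comment> \<open>The distances over \<open>[0, s]\<close>, \<open>[s, t]\<close> and
    \<open>[t, ?D]\<close> are bounded by the lengths of these intervals and add up to at least
    \<open>?D\<close>, so the bound in the middle cannot be strict.\<close>
  have eq: "d (g s) (g t) = t - s" if "0 \<le> s" "s \<le> t" "t \<le> ?D" for s t
  proof -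
    have gs: "g s \<in> X" "g t \<in> X" using gX that by auto
    have "d x y \<le> d x (g s) + d (g s) (g t) + d (g t) y"
      using triangle[OF assms(1) gs(1) assms(2)] triangle[OF gs assms(2)] by linarith
    moreover have "d x (g s) \<le> s" "d (g t) y \<le> ?D - t"
      using le[of 0 s] le[of t ?D] that g0 gD by auto
    ultimately show ?thesis using le[OF that] by linarith
  qed
  have ab: "d (g s) (g t) = \<bar>s - t\<bar>" if "s \<in> {0..?D}" "t \<in> {0..?D}" for s t
    using eq[of s t] eq[of t s] that commute[of "g s" "g t"] by (cases "s \<le> t") simp_all
  have s: "s * d x y \<in> {0..d x y}" if "s \<in> {0..1}" for s
    using that mult_right_mono[of s 1 "d x y"] by auto
  have "geodesic_path x y (\<lambda>s. g (s * d x y))"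
    unfolding geodesic_path_def
  proof (intro conjI ballI)
    fix u v :: real assume "u \<in> {0..1}" "v \<in> {0..1}"
    then have "d (g (u * d x y)) (g (v * d x y)) = \<bar>u * d x y - v * d x y\<bar>" using ab s by blast
    also have "\<dots> = \<bar>u - v\<bar> * d x y" by (simp add: left_diff_distrib[symmetric] abs_mult)
    finally show "d (g (u * d x y)) (g (v * d x y)) = \<bar>u - v\<bar> * d x y" .
  qed (use g0 gD gX s in auto)
  moreover have "g (d x m / d x y * d x y) = m" using a p by (simp add: g_def)
  ultimately show ?thesis by blast
qed

lemma geodesic_path_exists:
  assumes "x \<in> X" "y \<in> X"
  shows "\<exists>p. geodesic_path x y p"
proof (cases "x = y")
  case True
  then have "geodesic_path x y (\<lambda>_. x)" using assms by (auto simp: geodesic_path_def)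
  then show ?thesis by blast
next
  case False
  then show ?thesis using geodesic_path_through[of x y y] assms by auto
qed

end

section \<open>Rips complexes\<close>

abbreviation supp :: "('a \<Rightarrow> real) \<Rightarrow> 'a set" where "supp f \<equiv> {x. f x \<noteq> 0}"

lemma rips_simplex_subset:
  "rips_simplex X d r \<sigma> \<Longrightarrow> \<tau> \<subseteq> \<sigma> \<Longrightarrow> \<tau> \<noteq> {} \<Longrightarrow> rips_simplex X d r \<tau>"
  unfolding rips_simplex_def by (auto intro: finite_subset)

lemma closed_simplex_mono:
  assumes "\<sigma> \<subseteq> \<tau>" "finite \<tau>" shows "closed_simplex \<sigma> \<subseteq> closed_simplex \<tau>"
proof
  fix f assume f: "f \<in> closed_simplex \<sigma>"
  then have "sum f \<tau> = sum f \<sigma>"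
    using assms unfolding closed_simplex_def by (intro sum.mono_neutral_right) auto
  then show "f \<in> closed_simplex \<tau>" using f assms unfolding closed_simplex_def by auto
qed

lemma closed_simplex_subset_rips_carrier:
  assumes "rips_simplex X d r \<sigma>" shows "closed_simplex \<sigma> \<subseteq> rips_carrier X d r"
proof
  fix f assume f: "f \<in> closed_simplex \<sigma>"
  have fin: "finite \<sigma>" using assms by (auto simp: rips_simplex_def)
  have s: "sum f (supp f) = sum f \<sigma>"
    using f fin unfolding closed_simplex_def by (intro sum.mono_neutral_left) auto
  then have "supp f \<noteq> {}" using f unfolding closed_simplex_def by force
  then have "rips_simplex X d r (supp f)"
    using rips_simplex_subset[OF assms] f unfolding closed_simplex_def by auto
  then show "f \<in> rips_carrier X d r" using f s unfolding rips_carrier_def closed_simplex_def by auto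
qed

lemma rips_carrier_supp:
  assumes "f \<in> rips_carrier X d r"
  shows "rips_simplex X d r (supp f)" "f \<in> closed_simplex (supp f)"
  using assms unfolding rips_carrier_def closed_simplex_def by auto

lemma rips_carrier_in_closed_simplex:
  assumes "f \<in> rips_carrier X d r" "supp f \<subseteq> \<sigma>" "finite \<sigma>"
  shows "f \<in> closed_simplex \<sigma>"
  using closed_simplex_mono[OF assms(2,3)] rips_carrier_supp[OF assms(1)] by auto

lemma openin_rips_topology: "openin (rips_topology X d r) U \<longleftrightarrow> rips_open X d r U"
  unfolding rips_topology_def by (subst topology_inverse'[OF istopology_rips_open]) (rule refl)

lemma openin_rips_topology_iff:
  "openin (rips_topology X d r) U \<longleftrightarrow> U \<subseteq> rips_carrier X d r \<and>
     (\<forall>\<sigma>. rips_simplex X d r \<sigma> \<longrightarrow> openin (top_of_set (closed_simplex \<sigma>)) (U \<inter> closed_simplex \<sigma>))"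
  unfolding openin_rips_topology rips_open_def by (simp add: euclidean_product_topology)

lemma topspace_rips_topology [simp]: "topspace (rips_topology X d r) = rips_carrier X d r"
proof
  show "topspace (rips_topology X d r) \<subseteq> rips_carrier X d r"
    using openin_topspace[of "rips_topology X d r"] unfolding openin_rips_topology_iff by blast
  have "rips_carrier X d r \<inter> closed_simplex \<sigma> = closed_simplex \<sigma>" if "rips_simplex X d r \<sigma>" for \<sigma>
    using closed_simplex_subset_rips_carrier[OF that] by auto
  then have "openin (rips_topology X d r) (rips_carrier X d r)"
    unfolding openin_rips_topology_iff by auto
  then show "rips_carrier X d r \<subseteq> topspace (rips_topology X d r)" by (rule openin_subset)
qed

lemma closedin_rips_topology_iff:
  "closedin (rips_topology X d r) C \<longleftrightarrow> C \<subseteq> rips_carrier X d r \<and>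
     (\<forall>\<sigma>. rips_simplex X d r \<sigma> \<longrightarrow> closedin (top_of_set (closed_simplex \<sigma>)) (C \<inter> closed_simplex \<sigma>))"
proof -
  have "(rips_carrier X d r - C) \<inter> closed_simplex \<sigma> = closed_simplex \<sigma> - (C \<inter> closed_simplex \<sigma>)"
    if "rips_simplex X d r \<sigma>" for \<sigma> using closed_simplex_subset_rips_carrier[OF that] by auto
  then show ?thesis
    unfolding closedin_def openin_rips_topology_iff by auto
qed

section \<open>Continuous maps into and out of the weak topology\<close>

lemma continuous_on_coordinate: "continuous_on S (\<lambda>f::'a \<Rightarrow> real. f x)"
  by (rule continuous_on_product_then_coordinatewise) (rule continuous_on_id)

lemma closed_closed_simplex:
  fixes \<sigma> :: "'a set" shows "closed (closed_simplex \<sigma>)"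
proof -
  have "closed {f::'a \<Rightarrow> real. 0 \<le> f x}" for x
    by (intro closed_Collect_le continuous_on_const continuous_on_coordinate)
  moreover have "closed {f::'a \<Rightarrow> real. f x = 0}" for x
    by (intro closed_Collect_eq continuous_on_const continuous_on_coordinate)
  moreover have "closed {f::'a \<Rightarrow> real. sum f \<sigma> = 1}"
    by (intro closed_Collect_eq continuous_on_const continuous_on_sum continuous_on_coordinate)
  ultimately have "closed ((\<Inter>x. {f::'a \<Rightarrow> real. 0 \<le> f x}) \<inter> (\<Inter>x\<in>-\<sigma>. {f. f x = 0}) \<inter> {f. sum f \<sigma> = 1})"
    by (intro closed_Int closed_INT) auto
  moreover have "(\<Inter>x. {f. 0 \<le> f x}) \<inter> (\<Inter>x\<in>-\<sigma>. {f. f x = 0}) \<inter> {f. sum f \<sigma> = 1} = closed_simplex \<sigma>"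
    unfolding closed_simplex_def by auto
  ultimately show ?thesis by simp
qed

text \<open>Only finitely many simplices are met, and a closed set of the complex cuts each of them
  in a set closed for the product topology. Hence continuity of the coordinates is enough. Without a
  common finite support it would not be in general, since the weak topology is finer.\<close>

lemma continuous_map_into_rips:
  assumes A: "finite A"
    and F: "\<And>t. t \<in> topspace T \<Longrightarrow> F t \<in> rips_carrier X d r" "\<And>t. t \<in> topspace T \<Longrightarrow> supp (F t) \<subseteq> A"
    and cont: "\<And>a. a \<in> A \<Longrightarrow> continuous_map T euclideanreal (\<lambda>t. F t a)"
  shows "continuous_map T (rips_topology X d r) F"
  unfolding continuous_map_closedin
proof (intro conjI allI impI)
  show "F \<in> topspace T \<rightarrow> topspace (rips_topology X d r)" using F by auto
  have "continuous_map T euclideanreal (\<lambda>t. F t a)" for a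
  proof (cases "a \<in> A")
    case False
    have "continuous_map T euclideanreal (\<lambda>t. 0)" by simp
    then show ?thesis by (rule continuous_map_eq) (use F False in auto)
  qed (rule cont)
  then have c: "continuous_map T euclidean F"
    by (simp add: continuous_map_componentwise_UNIV flip: euclidean_product_topology)
  fix C assume C: "closedin (rips_topology X d r) C"
  let ?S = "{\<sigma>. \<sigma> \<subseteq> A \<and> rips_simplex X d r \<sigma>}"
  have "\<exists>\<sigma>\<in>?S. F t \<in> closed_simplex \<sigma>" if "t \<in> topspace T" for t
    using F(2)[OF that] rips_carrier_supp[OF F(1)[OF that]] by auto
  then have "{t \<in> topspace T. F t \<in> C} = (\<Union>\<sigma>\<in>?S. {t \<in> topspace T. F t \<in> C \<inter> closed_simplex \<sigma>})"
    by blast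
  moreover have "closedin T {t \<in> topspace T. F t \<in> C \<inter> closed_simplex \<sigma>}" if "\<sigma> \<in> ?S" for \<sigma>
  proof -
    have "closedin (top_of_set (closed_simplex \<sigma>)) (C \<inter> closed_simplex \<sigma>)"
      using C that unfolding closedin_rips_topology_iff by auto
    then have "closed (C \<inter> closed_simplex \<sigma>)"
      using closed_closed_simplex closedin_closed_trans by blast
    then show ?thesis using closedin_continuous_map_preimage[OF c, of "C \<inter> closed_simplex \<sigma>"] by simp
  qed
  ultimately show "closedin T {t \<in> topspace T. F t \<in> C}"
    using A by (auto intro!: closedin_Union)
qed

lemma continuous_map_from_rips:
  assumes "\<And>\<sigma>. rips_simplex X d r \<sigma> \<Longrightarrow> continuous_map (top_of_set (closed_simplex \<sigma>)) Y h"
  shows "continuous_map (rips_topology X d r) Y h"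
  unfolding continuous_map
proof (intro conjI allI impI)
  show "h ` topspace (rips_topology X d r) \<subseteq> topspace Y"
  proof clarsimp
    fix f assume f: "f \<in> rips_carrier X d r"
    from assms[OF rips_carrier_supp(1)[OF f]] rips_carrier_supp(2)[OF f] show "h f \<in> topspace Y"
      by (auto simp: continuous_map_def)
  qed
  fix U assume U: "openin Y U"
  have "{f \<in> rips_carrier X d r. h f \<in> U} \<inter> closed_simplex \<sigma> = {f \<in> closed_simplex \<sigma>. h f \<in> U}"
    if "rips_simplex X d r \<sigma>" for \<sigma> using closed_simplex_subset_rips_carrier[OF that] by auto
  moreover have "openin (top_of_set (closed_simplex \<sigma>)) {f \<in> closed_simplex \<sigma>. h f \<in> U}"
    if "rips_simplex X d r \<sigma>" for \<sigma>
    using openin_continuous_map_preimage[OF assms[OF that] U] by simp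
  ultimately show "openin (rips_topology X d r) {x \<in> topspace (rips_topology X d r). h x \<in> U}"
    unfolding openin_rips_topology_iff by auto
qed

lemma continuous_map_rips_coordinate: "continuous_map (rips_topology X d r) euclideanreal (\<lambda>f. f v)"
  by (rule continuous_map_from_rips) (simp add: continuous_on_coordinate)

text \<open>Compactness of the interval makes the product carry the weak topology of the products of
the interval with the simplices.\<close>
lemma continuous_map_from_prod_rips:
  assumes "\<And>\<sigma>. rips_simplex X d r \<sigma> \<Longrightarrow>
      continuous_map (prod_topology (top_of_set {0..1::real}) (top_of_set (closed_simplex \<sigma>))) Y H"
  shows "continuous_map (prod_topology (top_of_set {0..1}) (rips_topology X d r)) Y H"
  unfolding continuous_map
proof (intro conjI allI impI)
  let ?I = "top_of_set {0..1::real}" and ?R = "rips_topology X d r"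
  have HY: "H (t,f) \<in> topspace Y" if "t \<in> {0..1}" "f \<in> rips_carrier X d r" for t f
    using assms[OF rips_carrier_supp(1)[OF that(2)]] rips_carrier_supp(2)[OF that(2)] that(1)
    by (auto simp: continuous_map_def)
  then show "H ` topspace (prod_topology ?I ?R) \<subseteq> topspace Y" by auto
  fix U assume U: "openin Y U"
  define W where "W = {p \<in> topspace (prod_topology ?I ?R). H p \<in> U}"
  have "\<exists>A B. openin ?I A \<and> openin ?R B \<and> t \<in> A \<and> f \<in> B \<and> A \<times> B \<subseteq> W" if tf: "(t,f) \<in> W" for t f
  proof -
    have t: "t \<in> {0..1}" and f: "f \<in> rips_carrier X d r" and HU: "H (t,f) \<in> U" using tf by (auto simp: W_def)
    have "continuous_map ?I Y (H \<circ> (\<lambda>s. (s,f)))"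
      by (rule continuous_map_compose[OF _ assms[OF rips_carrier_supp(1)[OF f]]])
        (intro continuous_map_pairedI; use rips_carrier_supp(2)[OF f] in simp)
    from openin_continuous_map_preimage[OF this U] have "openin ?I {s \<in> {0..1}. H (s,f) \<in> U}" by simp
    then obtain \<delta> where \<delta>: "\<delta> > 0" "\<And>s. s \<in> {0..1} \<Longrightarrow> dist s t < \<delta> \<Longrightarrow> H (s,f) \<in> U"
      using t HU unfolding openin_euclidean_subtopology_iff by force
    define J where "J = {0..1} \<inter> cball t (\<delta>/2)"
    have "compact J" unfolding J_def by (intro compact_Int_closed) auto
    then have J: "compactin ?I J" by (simp add: compactin_subtopology J_def)
    have HJ: "H (s,f) \<in> U" if "s \<in> J" for s using \<delta> that unfolding J_def by (auto simp: dist_commute)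
    define V where "V = {g \<in> rips_carrier X d r. \<forall>s\<in>J. H (s,g) \<in> U}"
    have "openin ?R V"
      unfolding openin_rips_topology_iff
    proof (intro conjI allI impI)
      show "V \<subseteq> rips_carrier X d r" by (auto simp: V_def)
      fix \<sigma> assume \<sigma>: "rips_simplex X d r \<sigma>"
      let ?S = "top_of_set (closed_simplex \<sigma>)"
      let ?W = "{p \<in> topspace (prod_topology ?I ?S). H p \<in> U}"
      have o: "openin (prod_topology ?I ?S) ?W"
        using openin_continuous_map_preimage[OF assms[OF \<sigma>] U] .
      show "openin ?S (V \<inter> closed_simplex \<sigma>)"
      proof (subst openin_subopen, intro ballI)
        fix g assume g: "g \<in> V \<inter> closed_simplex \<sigma>"
        have "J \<times> {g} \<subseteq> ?W" using g by (auto simp: V_def J_def)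
        from tube_lemma_left[OF o J _ this] g obtain A B where AB: "openin ?S B" "J \<subseteq> A" "g \<in> B" "A \<times> B \<subseteq> ?W"
          by auto
        have "B \<subseteq> V \<inter> closed_simplex \<sigma>"
          using AB openin_subset[OF AB(1)] closed_simplex_subset_rips_carrier[OF \<sigma>]
          unfolding V_def by force
        then show "\<exists>T. openin ?S T \<and> g \<in> T \<and> T \<subseteq> V \<inter> closed_simplex \<sigma>" using AB by blast
      qed
    qed
    moreover have "openin ?I ({0..1} \<inter> ball t (\<delta>/2))" by auto
    moreover have "({0..1} \<inter> ball t (\<delta>/2)) \<times> V \<subseteq> W" unfolding W_def V_def J_def by auto
    ultimately show ?thesis using t \<delta> f HJ unfolding V_def
      by (intro exI[of _ "{0..1} \<inter> ball t (\<delta>/2)"] exI[of _ V]) (auto simp: V_def)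
  qed
  then show "openin (prod_topology ?I ?R) {p \<in> topspace (prod_topology ?I ?R). H p \<in> U}"
    unfolding W_def[symmetric] openin_prod_topology_alt by blast
qed

section \<open>Straight-line homotopies in the complex\<close>

definition segment_point :: "real \<Rightarrow> ('a \<Rightarrow> real) \<Rightarrow> ('a \<Rightarrow> real) \<Rightarrow> 'a \<Rightarrow> real" where
  "segment_point s f g = (\<lambda>x. (1 - s) * f x + s * g x)"

lemma segment_point_simps [simp]: "segment_point 0 f g = f" "segment_point 1 f g = g"
  by (auto simp: segment_point_def)

lemma supp_segment_point: "supp (segment_point s f g) \<subseteq> supp f \<union> supp g"
  by (auto simp: segment_point_def)

lemma segment_point_closed_simplex:
  assumes "f \<in> closed_simplex \<sigma>" "g \<in> closed_simplex \<sigma>" "s \<in> {0..1}"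
  shows "segment_point s f g \<in> closed_simplex \<sigma>"
proof -
  have "sum (segment_point s f g) \<sigma> = 1"
    using assms unfolding closed_simplex_def segment_point_def
    by (simp add: sum.distrib flip: sum_distrib_left)
  then show ?thesis
    using assms supp_segment_point[of s f g] unfolding closed_simplex_def by (auto simp: segment_point_def)
qed

lemma segment_point_carrier:
  assumes "f \<in> rips_carrier X d r" "g \<in> rips_carrier X d r" "rips_simplex X d r (supp f \<union> supp g)" "s \<in> {0..1}"
  shows "segment_point s f g \<in> rips_carrier X d r"
proof -
  have "finite (supp f \<union> supp g)" using assms(3) by (simp add: rips_simplex_def)
  then have "f \<in> closed_simplex (supp f \<union> supp g)" "g \<in> closed_simplex (supp f \<union> supp g)"
    using rips_carrier_in_closed_simplex[OF assms(1)] rips_carrier_in_closed_simplex[OF assms(2)] by auto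
  from segment_point_closed_simplex[OF this assms(4)] show ?thesis
    using closed_simplex_subset_rips_carrier[OF assms(3)] by auto
qed

lemma continuous_map_segment_point:
  assumes "continuous_map T euclideanreal (\<lambda>t. u t a)" "continuous_map T euclideanreal (\<lambda>t. v t a)"
  shows "continuous_map (prod_topology (top_of_set {0..1::real}) T) euclideanreal
     (\<lambda>(s,t). segment_point s (u t) (v t) a)"
proof -
  have 1: "continuous_map (prod_topology (top_of_set {0..1::real}) T) euclideanreal fst"
    by (metis continuous_map_fst continuous_map_into_fulltopology)
  have 2: "continuous_map (prod_topology (top_of_set {0..1::real}) T) euclideanreal (\<lambda>p. w (snd p))"
    if "continuous_map T euclideanreal w" for w
    using continuous_map_compose[OF continuous_map_snd that] by (simp add: o_def)
  have "continuous_map (prod_topology (top_of_set {0..1::real}) T) euclideanreal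
     (\<lambda>p. (1 - fst p) * u (snd p) a + fst p * v (snd p) a)"
    by (intro continuous_map_add continuous_map_real_mult continuous_map_diff 1 2 assms) simp
  then show ?thesis by (simp add: segment_point_def case_prod_unfold)
qed

lemma continuous_map_segment_point_into_rips:
  assumes A: "finite A"
    and uv: "\<And>t. t \<in> topspace T \<Longrightarrow> u t \<in> rips_carrier X d r" "\<And>t. t \<in> topspace T \<Longrightarrow> v t \<in> rips_carrier X d r"
      "\<And>t. t \<in> topspace T \<Longrightarrow> supp (u t) \<union> supp (v t) \<subseteq> A"
      "\<And>t. t \<in> topspace T \<Longrightarrow> rips_simplex X d r (supp (u t) \<union> supp (v t))"
    and cont: "\<And>a. a \<in> A \<Longrightarrow> continuous_map T euclideanreal (\<lambda>t. u t a)"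
      "\<And>a. a \<in> A \<Longrightarrow> continuous_map T euclideanreal (\<lambda>t. v t a)"
  shows "continuous_map (prod_topology (top_of_set {0..1}) T) (rips_topology X d r)
     (\<lambda>(s,t). segment_point s (u t) (v t))"
proof (rule continuous_map_into_rips[OF A])
  fix p assume "p \<in> topspace (prod_topology (top_of_set {0..1::real}) T)"
  then obtain s t where p: "p = (s,t)" "s \<in> {0..1}" "t \<in> topspace T" by auto
  show "(\<lambda>(s,t). segment_point s (u t) (v t)) p \<in> rips_carrier X d r"
    using segment_point_carrier[OF uv(1,2,4)] p by auto
  show "supp ((\<lambda>(s,t). segment_point s (u t) (v t)) p) \<subseteq> A"
    using supp_segment_point[of s "u t" "v t"] uv(3)[OF p(3)] p by auto
next
  fix a assume "a \<in> A"
  from continuous_map_segment_point[of T u a v, OF cont[OF this]]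
  show "continuous_map (prod_topology (top_of_set {0..1}) T) euclideanreal
     (\<lambda>p. (\<lambda>(s,t). segment_point s (u t) (v t)) p a)" by (simp add: case_prod_unfold)
qed

text \<open>Contiguity: maps whose values always share a simplex are joined by straight lines. The
  predicate \<open>P\<close> serves for loops, whose end values must stay equal during the
  homotopy.\<close>

lemma homotopic_with_segment:
  assumes A: "finite A"
    and uv: "\<And>t. t \<in> topspace T \<Longrightarrow> u t \<in> rips_carrier X d r" "\<And>t. t \<in> topspace T \<Longrightarrow> v t \<in> rips_carrier X d r"
      "\<And>t. t \<in> topspace T \<Longrightarrow> supp (u t) \<union> supp (v t) \<subseteq> A"
      "\<And>t. t \<in> topspace T \<Longrightarrow> rips_simplex X d r (supp (u t) \<union> supp (v t))"
    and cont: "\<And>a. a \<in> A \<Longrightarrow> continuous_map T euclideanreal (\<lambda>t. u t a)"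
      "\<And>a. a \<in> A \<Longrightarrow> continuous_map T euclideanreal (\<lambda>t. v t a)"
    and P: "\<And>s. s \<in> {0..1} \<Longrightarrow> P (\<lambda>t. segment_point s (u t) (v t))"
  shows "homotopic_with P T (rips_topology X d r) u v"
  unfolding homotopic_with_def
  by (rule exI[of _ "\<lambda>(s,t). segment_point s (u t) (v t)"])
    (use continuous_map_segment_point_into_rips[OF A uv cont] P in auto)

text \<open>For maps defined on the whole complex no finite set need contain all supports. One is
  asked for on each simplex separately, and \<open>continuous_map_from_prod_rips\<close> combines
  the pieces.\<close>

lemma homotopic_with_segment_rips:
  assumes uv: "\<And>f. f \<in> rips_carrier X d r \<Longrightarrow> u f \<in> rips_carrier X d r"
      "\<And>f. f \<in> rips_carrier X d r \<Longrightarrow> v f \<in> rips_carrier X d r"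
      "\<And>f. f \<in> rips_carrier X d r \<Longrightarrow> rips_simplex X d r (supp (u f) \<union> supp (v f))"
    and fin: "\<And>\<sigma>. rips_simplex X d r \<sigma> \<Longrightarrow> \<exists>A. finite A \<and> (\<forall>f\<in>closed_simplex \<sigma>. supp (u f) \<union> supp (v f) \<subseteq> A)"
    and cont: "\<And>\<sigma> a. rips_simplex X d r \<sigma> \<Longrightarrow> continuous_on (closed_simplex \<sigma>) (\<lambda>f. u f a)"
      "\<And>\<sigma> a. rips_simplex X d r \<sigma> \<Longrightarrow> continuous_on (closed_simplex \<sigma>) (\<lambda>f. v f a)"
  shows "homotopic_with (\<lambda>_. True) (rips_topology X d r) (rips_topology X d r) u v"
  unfolding homotopic_with_def
proof (intro exI[of _ "\<lambda>(s,t). segment_point s (u t) (v t)"] conjI)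
  show "continuous_map (prod_topology (top_of_set {0..1}) (rips_topology X d r)) (rips_topology X d r)
     (\<lambda>(s,t). segment_point s (u t) (v t))"
  proof (rule continuous_map_from_prod_rips)
    fix \<sigma> assume \<sigma>: "rips_simplex X d r \<sigma>"
    from fin[OF this] obtain A where A: "finite A" "\<forall>f\<in>closed_simplex \<sigma>. supp (u f) \<union> supp (v f) \<subseteq> A" by auto
    have sub: "f \<in> rips_carrier X d r" if "f \<in> closed_simplex \<sigma>" for f
      using closed_simplex_subset_rips_carrier[OF \<sigma>] that by auto
    show "continuous_map (prod_topology (top_of_set {0..1}) (top_of_set (closed_simplex \<sigma>))) (rips_topology X d r)
     (\<lambda>(s,t). segment_point s (u t) (v t))"
      by (rule continuous_map_segment_point_into_rips[OF A(1)]) (use A(2) uv sub cont[OF \<sigma>] in auto)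
  qed
qed auto

lemma Hausdorff_space_powertop_real: "Hausdorff_space (powertop_real I)"
  by (simp add: Hausdorff_space_product_topology)

text \<open>A set with one point for each support that occurs meets every simplex in a finite set,
  so all its subsets are closed. Were it infinite, it would have a limit point in \<open>K\<close>,
  which a closed discrete set cannot have. The lemma makes a loop in the complex accessible to
  \<open>homotopic_with_segment\<close>.\<close>

lemma compactin_rips_finite_supp:
  assumes K: "compactin (rips_topology X d r) K"
  shows "finite (\<Union>f\<in>K. supp f)"
proof -
  have KR: "K \<subseteq> rips_carrier X d r" using compactin_subset_topspace[OF K] by simp
  have "finite (supp ` K)"
  proof (rule ccontr)
    assume inf: "infinite (supp ` K)"
    obtain S where S: "S \<subseteq> K" "inj_on supp S" "supp ` S = supp ` K"
      using subset_image_inj[of "supp ` K" supp K] by auto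
    have infS: "infinite S" using inf S by (metis finite_imageI)
    have cl: "closedin (rips_topology X d r) D" if "D \<subseteq> S" for D
      unfolding closedin_rips_topology_iff
    proof (intro conjI allI impI)
      show "D \<subseteq> rips_carrier X d r" using that S KR by auto
      fix \<sigma> assume "rips_simplex X d r \<sigma>"
      then have "finite (Pow \<sigma>)" by (auto simp: rips_simplex_def)
      moreover have "supp ` (D \<inter> closed_simplex \<sigma>) \<subseteq> Pow \<sigma>" by (auto simp: closed_simplex_def)
      ultimately have "finite (supp ` (D \<inter> closed_simplex \<sigma>))" by (rule finite_subset[rotated])
      moreover have "inj_on supp (D \<inter> closed_simplex \<sigma>)" by (rule inj_on_subset[OF S(2)]) (use that in auto)
      ultimately have "finite (D \<inter> closed_simplex \<sigma>)" using finite_image_iff by blast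
      then have "closedin (subtopology (powertop_real UNIV) (closed_simplex \<sigma>)) (D \<inter> closed_simplex \<sigma>)"
        by (intro closedin_Hausdorff_finite Hausdorff_space_subtopology Hausdorff_space_powertop_real) auto
      then show "closedin (top_of_set (closed_simplex \<sigma>)) (D \<inter> closed_simplex \<sigma>)"
        by (simp add: euclidean_product_topology)
    qed
    from compactin_imp_Bolzano_Weierstrass[OF K, of S] infS S obtain z where
      "z \<in> K" and z: "z \<in> (rips_topology X d r) derived_set_of S" by blast
    have "openin (rips_topology X d r) (topspace (rips_topology X d r) - (S - {z}))"
      using cl[of "S - {z}"] by (intro openin_diff openin_topspace) auto
    moreover have "z \<in> topspace (rips_topology X d r) - (S - {z})"
      using z by (auto simp: in_derived_set_of)
    ultimately obtain y where "y \<noteq> z" "y \<in> S" "y \<in> topspace (rips_topology X d r) - (S - {z})"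
      using z unfolding in_derived_set_of by meson
    then show False by blast
  qed
  moreover have "finite (supp f)" if "f \<in> K" for f
    using that KR rips_carrier_supp(1) unfolding rips_simplex_def by blast
  ultimately show ?thesis by (intro finite_Union) auto
qed

section \<open>Short loops\<close>

abbreviation loop_homotopic :: "'a topology \<Rightarrow> (real \<Rightarrow> 'a) \<Rightarrow> (real \<Rightarrow> 'a) \<Rightarrow> bool" where
  "loop_homotopic T p q \<equiv> homotopic_with (\<lambda>h. h 0 = h 1) (top_of_set {0..1}) T p q"

lemma closedin_eq_zero:
  assumes "continuous_map Z euclideanreal F"
  shows "closedin Z {z \<in> topspace Z. F z = 0}"
  using closedin_continuous_map_preimage[OF assms, of "{0}"] by simp

context Metric_space
begin

lemma continuous_map_fst_comp:
  "continuous_map T Y f \<Longrightarrow> continuous_map (prod_topology T Z) Y (\<lambda>p. f (fst p))"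
  using continuous_map_compose[OF continuous_map_fst] by (simp add: o_def)

lemma continuous_map_snd_comp:
  "continuous_map Z Y f \<Longrightarrow> continuous_map (prod_topology T Z) Y (\<lambda>p. f (snd p))"
  using continuous_map_compose[OF continuous_map_snd] by (simp add: o_def)

lemma path_length_le_real:
  assumes "path_length d g < ereal K"
  obtains L where "L < K" "\<And>n t. t 0 = 0 \<Longrightarrow> t n = 1 \<Longrightarrow> (\<And>i. i < n \<Longrightarrow> t i \<le> t (Suc i)) \<Longrightarrow>
     (\<Sum>i<n. d (g (t i)) (g (t (Suc i)))) \<le> L"
proof -
  have le: "ereal (\<Sum>i<n. d (g (t i)) (g (t (Suc i)))) \<le> path_length d g"
    if "t 0 = 0" "t n = 1" "\<And>i. i < n \<Longrightarrow> t i \<le> t (Suc i)" for n t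
    unfolding path_length_def by (rule SUP_upper2[of "(n,t)"]) (use that in auto)
  \<comment> \<open>The one-step partition bounds the supremum from below by a real number and so
    excludes minus infinity.\<close>
  have "ereal (\<Sum>i<1. d (g (real i)) (g (real (Suc i)))) \<le> path_length d g" by (rule le) auto
  then have "ereal (d (g 0) (g 1)) \<le> path_length d g" by simp
  then have "0 \<le> path_length d g" using nonneg[of "g 0" "g 1"] order_trans[of 0 "ereal (d (g 0) (g 1))"] by auto
  then obtain L where L: "path_length d g = ereal L" using assms by (cases "path_length d g") auto
  show ?thesis by (rule that[of L]) (use L le assms in auto)
qed

lemma pathin_uniformly_continuous:
  assumes g: "pathin mtopology g" and "0 < e"
  obtains n :: nat where "0 < n"
    "\<And>s t. s \<in> {0..1} \<Longrightarrow> t \<in> {0..1} \<Longrightarrow> \<bar>s - t\<bar> \<le> 1 / n \<Longrightarrow> d (g s) (g t) < e"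
proof -
  let ?I = "top_of_set {0..1::real}"
  have g: "continuous_map ?I mtopology g" using g by (simp add: pathin_def)
  have gM: "g t \<in> M" if "t \<in> {0..1}" for t using continuous_map_image_subset_topspace[OF g] that by auto
  have "continuous_map (prod_topology ?I ?I) euclideanreal (\<lambda>p. d (g (fst p)) (g (snd p)))"
    by (intro continuous_map_d continuous_map_fst_comp continuous_map_snd_comp g)
  then have "continuous_on ({0..1} \<times> {0..1}) (\<lambda>p. d (g (fst p)) (g (snd p)))"
    by (simp flip: subtopology_Times)
  then have "uniformly_continuous_on ({0..1} \<times> {0..1}) (\<lambda>p. d (g (fst p)) (g (snd p)))"
    by (intro compact_uniformly_continuous compact_Times) auto
  then obtain \<delta> where \<delta>: "\<delta> > 0" and uc: "\<forall>p\<in>{0..1} \<times> {0..1}. \<forall>q\<in>{0..1} \<times> {0..1}. dist q p < \<delta> \<longrightarrow>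
      dist (d (g (fst q)) (g (snd q))) (d (g (fst p)) (g (snd p))) < e"
    unfolding uniformly_continuous_on_def using assms(2) by meson
  obtain n :: nat where n: "0 < n" "1 / n < \<delta>" using nat_approx_posE[OF \<delta>] by (metis of_nat_Suc zero_less_Suc)
  show ?thesis
  proof (rule that[OF n(1)])
    fix s t :: real assume st: "s \<in> {0..1}" "t \<in> {0..1}" "\<bar>s - t\<bar> \<le> 1 / n"
    have "dist (s,t) (t,t) < \<delta>" using st n by (simp add: dist_prod_def dist_real_def)
    then have "dist (d (g s) (g t)) (d (g t) (g t)) < e" using uc st by force
    then show "d (g s) (g t) < e" using gM st by (simp add: dist_real_def)
  qed
qed

text \<open>The cut points are nodes of a fine partition at which the partial sums pass \<open>L/3\<close>
and \<open>2L/3\<close>.\<close>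
lemma loop_three_arcs:
  assumes g: "pathin mtopology g" and len: "path_length d g < ereal (3 * r)" and r: "0 < r"
  obtains a b where "0 \<le> a" "a \<le> b" "b \<le> 1"
    "\<And>u. u \<in> {0..a} \<Longrightarrow> d (g 0) (g u) + d (g u) (g a) < r"
    "\<And>u. u \<in> {a..b} \<Longrightarrow> d (g a) (g u) + d (g u) (g b) < r"
    "\<And>u. u \<in> {b..1} \<Longrightarrow> d (g b) (g u) + d (g u) (g 1) < r"
proof -
  obtain L0 where L0: "L0 < 3 * r" and sum0: "\<And>n t. t 0 = 0 \<Longrightarrow> t n = 1 \<Longrightarrow> (\<And>i. i < n \<Longrightarrow> t i \<le> t (Suc i)) \<Longrightarrow>
     (\<Sum>i<n. d (g (t i)) (g (t (Suc i)))) \<le> L0" using path_length_le_real[OF len] by auto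
  define L where "L = max L0 0"
  have L: "L < 3 * r" "0 \<le> L" using L0 r by (auto simp: L_def)
  have sum: "(\<Sum>i<n. d (g (t i)) (g (t (Suc i)))) \<le> L"
    if "t 0 = 0" "t n = 1" "\<And>i. i < n \<Longrightarrow> t i \<le> t (Suc i)" for n t
    using sum0[OF that] by (simp add: L_def)
  have gM: "g t \<in> M" if "t \<in> {0..1}" for t
    using g that continuous_map_image_subset_topspace unfolding pathin_def by fastforce
  \<comment> \<open>Thus \<open>r - L / 3 = 4 * \<eta>\<close>. One \<open>\<eta>\<close> is lost
    because cuts are made at nodes only, and two more around the parameter \<open>u\<close> of an
    arc, which need not be a node.\<close>
  define \<eta> where "\<eta> = (3 * r - L) / 12"
  have \<eta>: "0 < \<eta>" "L / 3 + 3 * \<eta> < r" using L by (auto simp: \<eta>_def field_simps)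
  obtain n :: nat where n: "0 < n" and uc: "\<And>s t. s \<in> {0..1} \<Longrightarrow> t \<in> {0..1} \<Longrightarrow> \<bar>s - t\<bar> \<le> 1 / n \<Longrightarrow> d (g s) (g t) < \<eta>"
    using pathin_uniformly_continuous[OF g \<eta>(1)] by metis
  define c where "c = (\<lambda>i::nat. d (g (i / n)) (g (Suc i / n)))"
  define S where "S = (\<lambda>k. \<Sum>i<k. c i)"
  have node: "real i / n \<in> {0..1}" if "i \<le> n" for i using that n by (auto simp: field_simps)
  have c0: "0 \<le> c i" for i by (simp add: c_def)
  have c\<eta>: "c i < \<eta>" if "i < n" for i
    unfolding c_def by (rule uc) (use that n node[of i] node[of "Suc i"] in \<open>auto simp: field_simps\<close>)
  have Sn: "S n \<le> L" using sum[of "\<lambda>i. i / n" n] n by (simp add: S_def c_def divide_right_mono)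
  have Smono: "S i \<le> S j" if "i \<le> j" for i j
    unfolding S_def using that c0 by (intro sum_mono2) auto
  have Sdiff: "d (g (i / n)) (g (j / n)) \<le> S j - S i" if "i \<le> j" "j \<le> n" for i j
    using that
  proof (induction j rule: dec_induct)
    case base then show ?case using gM[OF node[of i]] by simp
  next
    case (step k)
    have "d (g (i / n)) (g (Suc k / n)) \<le> d (g (i / n)) (g (k / n)) + c k"
      unfolding c_def using step by (intro triangle gM node) auto
    then show ?case using step by (simp add: S_def)
  qed
  have arc: "d (g (i / n)) (g u) + d (g u) (g (j / n)) < r"
    if ij: "i \<le> j" "j \<le> n" "S j - S i \<le> L / 3 + \<eta>" and u: "u \<in> {i / n..j / n}" for i j u
  proof -
    have "0 \<le> real i / n" by simp
    then have u1: "u \<in> {0..1}" using u node[of j] ij by (auto simp del: divide_nonneg_nonneg)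
    \<comment> \<open>The subinterval containing \<open>u\<close>. The minimum matters for
      \<open>u = j / n\<close>, where the floor would select the interval after the arc.\<close>
    define k where "k = min (nat \<lfloor>u * n\<rfloor>) (j - 1)"
    show ?thesis
    proof (cases "i = j")
      case True
      then have "u = i / n" using u by auto
      then show ?thesis using True gM[OF u1] r by simp
    next
      case False
      have un: "i \<le> u * n" "u * n \<le> j" using u n by (auto simp: field_simps)
      have k: "i \<le> k" "k < j" unfolding k_def using False ij un by (auto simp: le_nat_floor)
      have ku: "k / n \<le> u" "u \<le> Suc k / n"
      proof -
        have "real k \<le> u * n" unfolding k_def using un by (auto simp: min_def) linarith+
        then show "k / n \<le> u" using n by (simp add: field_simps)
        have "u * n \<le> Suc k"
        proof (cases "nat \<lfloor>u * n\<rfloor> \<le> j - 1")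
          case True then show ?thesis unfolding k_def by (simp add: min_def) linarith
        next
          case F: False then show ?thesis unfolding k_def using un False ij by (simp add: min_def)
        qed
        then show "u \<le> Suc k / n" using n by (simp add: field_simps)
      qed
      have kn: "k / n \<in> {0..1}" "Suc k / n \<in> {0..1}" using node[of k] node[of "Suc k"] k ij by auto
      have w: "Suc k / n = k / n + 1 / n" by (simp add: add_divide_distrib)
      have 1: "d (g (k / n)) (g u) < \<eta>" "d (g u) (g (Suc k / n)) < \<eta>"
        using ku w by (intro uc u1 kn; simp)+
      have "d (g (i / n)) (g u) \<le> d (g (i / n)) (g (k / n)) + d (g (k / n)) (g u)"
        by (intro triangle gM kn u1 node) (use ij in auto)
      moreover have "d (g u) (g (j / n)) \<le> d (g u) (g (Suc k / n)) + d (g (Suc k / n)) (g (j / n))"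
        by (intro triangle gM kn u1 node) (use ij in auto)
      moreover have "d (g (i / n)) (g (k / n)) \<le> S k - S i" "d (g (Suc k / n)) (g (j / n)) \<le> S j - S (Suc k)"
        using Sdiff[of i k] Sdiff[of "Suc k" j] k ij by auto
      moreover have "S k \<le> S (Suc k)" by (rule Smono) simp
      ultimately show ?thesis using 1 ij(3) \<eta> by linarith
    qed
  qed
  \<comment> \<open>The last node whose partial sum does not exceed \<open>b\<close> misses
    \<open>b\<close> by less than \<open>\<eta>\<close>, because the next summand is smaller than
    that. The final node has no next summand, hence the proviso \<open>k < n\<close>.\<close>
  have cut: "\<exists>k\<le>n. S k \<le> b \<and> (k < n \<longrightarrow> b - \<eta> < S k)" if "0 \<le> b" for b
  proof -
    let ?K = "{k. k \<le> n \<and> S k \<le> b}"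
    have K: "finite ?K" "0 \<in> ?K" using that by (auto simp: S_def)
    define k where "k = Max ?K"
    have k: "k \<in> ?K" unfolding k_def using Max_in[OF K(1)] K(2) by blast
    have "b - \<eta> < S k" if "k < n"
    proof (rule ccontr)
      assume "\<not> b - \<eta> < S k"
      then have "Suc k \<in> ?K" using c\<eta>[OF that] that by (simp add: S_def)
      then have "Suc k \<le> k" unfolding k_def using Max_ge[OF K(1)] by blast
      then show False by simp
    qed
    then show ?thesis using k by auto
  qed
  obtain k1 where k1: "k1 \<le> n" "S k1 \<le> L / 3" "k1 < n \<Longrightarrow> L / 3 - \<eta> < S k1" using cut[of "L/3"] L by auto
  obtain k2' where k2': "k2' \<le> n" "S k2' \<le> 2 * L / 3" "k2' < n \<Longrightarrow> 2 * L / 3 - \<eta> < S k2'" using cut[of "2*L/3"] L by auto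
  define k2 where "k2 = max k1 k2'"
  have k2: "k1 \<le> k2" "k2 \<le> n" "S k2 \<le> 2 * L / 3" "k2 < n \<Longrightarrow> 2 * L / 3 - \<eta> < S k2"
    using k1 k2' L Smono[of k2' k1] by (auto simp: k2_def max_def)
  have S0: "S 0 = 0" by (simp add: S_def)
  have s1: "S k1 - S 0 \<le> L / 3 + \<eta>" using k1 \<eta> S0 by simp
  have s2: "S k2 - S k1 \<le> L / 3 + \<eta>"
  proof (cases "k1 < n")
    case True then show ?thesis using k1 k2 by auto
  next
    case False then have "k2 = k1" using k1 k2 by auto
    then show ?thesis using L \<eta> by simp
  qed
  have s3: "S n - S k2 \<le> L / 3 + \<eta>"
  proof (cases "k2 < n")
    case True then show ?thesis using k2 Sn by auto
  next
    case False then have "k2 = n" using k2 by auto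
    then show ?thesis using L \<eta> by simp
  qed
  show ?thesis
  proof (rule that[of "k1 / n" "k2 / n"])
    show "0 \<le> real k1 / n" "real k1 / n \<le> k2 / n" "real k2 / n \<le> 1"
      using k1 k2 n by (auto simp: divide_right_mono)
  qed (use arc[OF _ _ s1] arc[OF _ _ s2] arc[OF _ _ s3] k1 k2 n in auto)
qed

end

section \<open>Homotopies along geodesics\<close>

context compact_geodesic
begin

definition geodesic_point :: "'a \<Rightarrow> 'a \<Rightarrow> real \<Rightarrow> 'a" where
  "geodesic_point x y t = (SOME m. m \<in> X \<and> d x m = t * d x y \<and> d m y = (1 - t) * d x y)"

lemma geodesic_point:
  assumes "x \<in> X" "y \<in> X" "t \<in> {0..1}"
  shows "geodesic_point x y t \<in> X" "d x (geodesic_point x y t) = t * d x y"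
    "d (geodesic_point x y t) y = (1 - t) * d x y"
    "d x (geodesic_point x y t) + d (geodesic_point x y t) y = d x y"
proof -
  have "t * d x y \<le> 1 * d x y" using assms by (intro mult_right_mono) auto
  then have "\<exists>m\<in>X. d x m = t * d x y \<and> d m y = d x y - t * d x y"
    using between[of x y "t * d x y"] assms by auto
  then have "\<exists>m. m \<in> X \<and> d x m = t * d x y \<and> d m y = (1 - t) * d x y"
    by (auto simp: algebra_simps)
  from someI_ex[OF this] show "geodesic_point x y t \<in> X" "d x (geodesic_point x y t) = t * d x y"
    "d (geodesic_point x y t) y = (1 - t) * d x y" unfolding geodesic_point_def by auto
  then show "d x (geodesic_point x y t) + d (geodesic_point x y t) y = d x y" by (simp add: algebra_simps)
qed

lemma geodesic_point_0: "x \<in> X \<Longrightarrow> y \<in> X \<Longrightarrow> geodesic_point x y 0 = x"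
  using geodesic_point(1,2)[of x y 0] by simp

lemma geodesic_point_1: "x \<in> X \<Longrightarrow> y \<in> X \<Longrightarrow> geodesic_point x y 1 = y"
  using geodesic_point(1,3)[of x y 1] by simp

lemma geodesic_point_unique:
  assumes "tripod r" "x \<in> X" "y \<in> X" "t \<in> {0..1}" "d x y < r"
    and "m \<in> X" "d x m = t * d x y" "d m y = (1 - t) * d x y"
  shows "m = geodesic_point x y t"
proof (rule tripod_unique[OF assms(1-3,6) _ assms(5)])
  show "d x m + d m y = d x y" using assms(7,8) by (simp add: algebra_simps)
qed (use geodesic_point[OF assms(2-4)] assms(7) in auto)

text \<open>The value is the only common solution of two equations between continuous functions, so
  the graph is closed although \<open>geodesic_point\<close> is defined by choice.\<close>

lemma continuous_map_geodesic_point: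
  assumes tri: "tripod r"
    and f: "continuous_map T mtopology f" and g: "continuous_map T mtopology g"
    and h: "continuous_map T euclideanreal h"
    and less: "\<And>t. t \<in> topspace T \<Longrightarrow> d (f t) (g t) < r" and h01: "\<And>t. t \<in> topspace T \<Longrightarrow> h t \<in> {0..1}"
  shows "continuous_map T mtopology (\<lambda>t. geodesic_point (f t) (g t) (h t))"
proof (rule continuous_map_of_closed_graph[OF compact])
  have fX: "f t \<in> X" "g t \<in> X" if "t \<in> topspace T" for t
    using continuous_map_image_subset_topspace[OF f] continuous_map_image_subset_topspace[OF g] that by auto
  show "(\<lambda>t. geodesic_point (f t) (g t) (h t)) \<in> topspace T \<rightarrow> topspace mtopology"
    using geodesic_point(1) fX h01 by auto
  let ?Z = "prod_topology T mtopology"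
  let ?F = "\<lambda>p. d (f (fst p)) (snd p) - h (fst p) * d (f (fst p)) (g (fst p))"
  let ?G = "\<lambda>p. d (snd p) (g (fst p)) - (1 - h (fst p)) * d (f (fst p)) (g (fst p))"
  have "continuous_map ?Z euclideanreal ?F" "continuous_map ?Z euclideanreal ?G"
    by (intro continuous_map_diff continuous_map_real_mult continuous_map_d continuous_map_fst_comp f g h
        continuous_map_snd continuous_map_canonical_const)+
  then have "closedin ?Z ({p \<in> topspace ?Z. ?F p = 0} \<inter> {p \<in> topspace ?Z. ?G p = 0})"
    by (intro closedin_Int closedin_eq_zero)
  moreover have "{p \<in> topspace ?Z. ?F p = 0} \<inter> {p \<in> topspace ?Z. ?G p = 0} =
      {(t, m). t \<in> topspace T \<and> m = geodesic_point (f t) (g t) (h t)}"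
    using geodesic_point[OF fX h01] geodesic_point_unique[OF tri fX h01 less] by auto
  ultimately show "closedin ?Z {(t, m). t \<in> topspace T \<and> m = geodesic_point (f t) (g t) (h t)}" by simp
qed

text \<open>Close maps are joined along the unique geodesics between their values. Outside
  \<open>topspace T\<close> the homotopy need not agree with \<open>f\<close> and \<open>g\<close>,
  so \<open>PP\<close> requires \<open>P\<close> to depend only on the values inside.\<close>

lemma homotopic_with_close:
  assumes tri: "tripod r"
    and f: "continuous_map T mtopology f" and g: "continuous_map T mtopology g"
    and less: "\<And>t. t \<in> topspace T \<Longrightarrow> d (f t) (g t) < r"
    and P: "\<And>s. s \<in> {0..1} \<Longrightarrow> P (\<lambda>t. geodesic_point (f t) (g t) s)"
    and PP: "\<And>u v. (\<And>t. t \<in> topspace T \<Longrightarrow> u t = v t) \<Longrightarrow> P u = P v"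
  shows "homotopic_with P T mtopology f g"
proof (subst homotopic_with[OF PP], assumption, intro exI conjI ballI)
  let ?H = "\<lambda>(s,t). geodesic_point (f t) (g t) s"
  have fX: "f t \<in> X" "g t \<in> X" if "t \<in> topspace T" for t
    using continuous_map_image_subset_topspace[OF f] continuous_map_image_subset_topspace[OF g] that by auto
  have "continuous_map (prod_topology (top_of_set {0..1::real}) T) mtopology
      (\<lambda>p. geodesic_point (f (snd p)) (g (snd p)) (fst p))"
    by (rule continuous_map_geodesic_point[OF tri])
      (use less in \<open>auto intro!: continuous_map_snd_comp f g continuous_map_into_fulltopology[OF continuous_map_fst]\<close>)
  then show "continuous_map (prod_topology (top_of_set {0..1::real}) T) mtopology ?H"
    by (simp add: case_prod_unfold)
  show "?H (0,t) = f t" "?H (1,t) = g t" if "t \<in> topspace T" for t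
    using geodesic_point_0 geodesic_point_1 fX[OF that] by auto
  show "P (\<lambda>t. ?H (s,t))" if "s \<in> {0..1}" for s using P[OF that] by simp
qed

lemma loop_homotopic_close:
  assumes "tripod r" "pathin mtopology f" "pathin mtopology g" "f 0 = f 1" "g 0 = g 1"
    and "\<And>t. t \<in> {0..1} \<Longrightarrow> d (f t) (g t) < r"
  shows "loop_homotopic mtopology f g"
  by (rule homotopic_with_close[OF assms(1)]) (use assms(2-6) in \<open>auto simp: pathin_def\<close>)

text \<open>The arcs next to the base point \<open>x\<close> stay within \<open>r\<close> of it, but
  the arc from \<open>y\<close> to \<open>z\<close> may leave that range. A first homotopy replaces
  it by a geodesic, which stays within \<open>r\<close> of \<open>x\<close> by the tripod condition;
  a second one contracts everything to \<open>x\<close>.\<close>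

lemma short_loop_contractible:
  assumes tri: "tripod r" and r: "0 < r" and g: "pathin mtopology g" and loop: "g 0 = g 1"
    and len: "path_length d g < ereal (3 * r)"
  shows "\<exists>a. loop_homotopic mtopology g (\<lambda>_. a)"
proof -
  obtain a b where ab: "0 \<le> a" "a \<le> b" "b \<le> 1"
    and arc1: "\<And>u. u \<in> {0..a} \<Longrightarrow> d (g 0) (g u) + d (g u) (g a) < r"
    and arc2: "\<And>u. u \<in> {a..b} \<Longrightarrow> d (g a) (g u) + d (g u) (g b) < r"
    and arc3: "\<And>u. u \<in> {b..1} \<Longrightarrow> d (g b) (g u) + d (g u) (g 1) < r"
    using loop_three_arcs[OF g len r] by metis
  have gc: "continuous_map (top_of_set {0..1}) mtopology g" using g by (simp add: pathin_def)
  have gX: "g t \<in> X" if "t \<in> {0..1}" for t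
    using continuous_map_image_subset_topspace[OF gc] that by auto
  define x where "x = g 0"
  define y where "y = g a"
  define z where "z = g b"
  have xyz: "x \<in> X" "y \<in> X" "z \<in> X" using gX ab by (auto simp: x_def y_def z_def)
  have xy: "d x y < r" using arc1[of 0] ab gX[of 0] by (simp add: x_def y_def)
  have yz: "d y z < r" using arc2[of a] ab gX[of a] by (simp add: y_def z_def)
  have xz: "d x z < r" using arc3[of b] ab gX[of b] loop commute[of "g b" "g 1"] by (simp add: x_def z_def)
  \<comment> \<open>For \<open>a = b\<close> the division yields 0, so \<open>w\<close> vanishes and
    \<open>\<pi>\<close> is constantly \<open>y\<close>, which then equals \<open>z\<close>.
    Clipping in \<open>w\<close> defines \<open>\<pi>\<close> on the whole interval, so that
    continuity of \<open>g'\<close> is a matter of gluing.\<close>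
  define c where "c = 1 / (b - a)"
  define w where "w = (\<lambda>t. max 0 (min 1 ((t - a) * c)))"
  define \<pi> where "\<pi> = (\<lambda>t. geodesic_point y z (w t))"
  define g' where "g' = (\<lambda>t. if t \<le> a then g t else if b \<le> t then g t else \<pi> t)"
  have w01: "w t \<in> {0..1}" for t by (simp add: w_def)
  have \<pi>X: "\<pi> t \<in> X" and \<pi>d: "d y (\<pi> t) + d (\<pi> t) z = d y z" for t
    unfolding \<pi>_def using geodesic_point[OF xyz(2,3) w01] by auto
  have wc: "continuous_map (top_of_set {0..1}) euclideanreal w"
    unfolding w_def by (auto intro!: continuous_intros)
  have \<pi>c: "continuous_map (top_of_set {0..1}) mtopology \<pi>"
    unfolding \<pi>_def by (rule continuous_map_geodesic_point[OF tri _ _ wc]) (use xyz yz w01 in auto)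
  have \<pi>a: "\<pi> a = y" by (simp add: \<pi>_def w_def geodesic_point_0 xyz)
  have \<pi>b: "\<pi> b = z"
  proof (cases "a = b")
    case True then show ?thesis using \<pi>a by (simp add: y_def z_def)
  next
    case False then show ?thesis by (simp add: \<pi>_def w_def c_def geodesic_point_1 xyz)
  qed
  have "continuous_map (top_of_set {0..1}) mtopology (\<lambda>t. if b \<le> t then g t else \<pi> t)"
    by (rule continuous_map_cases_le)
      (use \<pi>b in \<open>auto simp: z_def intro!: continuous_map_from_subtopology gc \<pi>c\<close>)
  from continuous_map_from_subtopology[OF this]
  have g'c: "continuous_map (top_of_set {0..1}) mtopology g'"
    unfolding g'_def by (rule continuous_map_cases_le[rotated 3])
      (use \<pi>a \<pi>b ab in \<open>auto simp: y_def z_def intro!: continuous_map_from_subtopology[OF gc]\<close>)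
  have g'0: "g' 0 = x" using ab by (simp add: g'_def x_def)
  have g'1: "g' 1 = x" using ab loop by (simp add: g'_def x_def)
  have "d (g t) (g' t) < r" if t: "t \<in> {0..1}" for t
  proof (cases "t \<le> a \<or> b \<le> t")
    case True then show ?thesis using gX[OF t] r by (auto simp: g'_def)
  next
    case False
    then have a: "d y (g t) + d (g t) z < r" using arc2[of t] by (simp add: y_def z_def)
    have "d (g t) (\<pi> t) < r"
      by (rule tripod_dist_less[OF tri xyz(2,3) gX[OF t] \<pi>X yz _ _ \<pi>d])
        (use a commute[of y "g t"] nonneg[of y "g t"] nonneg[of "g t" z] in linarith)+
    then show ?thesis using False by (simp add: g'_def)
  qed
  then have 1: "loop_homotopic mtopology g g'"
    using g'c g'0 g'1 by (intro loop_homotopic_close[OF tri g]) (auto simp: pathin_def loop)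
  have "d (g' t) x < r" if t: "t \<in> {0..1}" for t
  proof (cases "t \<le> a \<or> b \<le> t")
    case True
    then show ?thesis
    proof
      assume "t \<le> a"
      then have "d (g 0) (g t) + d (g t) (g a) < r" using arc1[of t] t by simp
      then have "d (g t) (g 0) < r" using nonneg[of "g t" "g a"] commute[of "g 0" "g t"] by linarith
      then show ?thesis using \<open>t \<le> a\<close> by (simp add: g'_def x_def)
    next
      assume "b \<le> t"
      then have "d (g b) (g t) + d (g t) (g 1) < r" using arc3[of t] t by simp
      then have "d (g t) (g 0) < r" using nonneg[of "g b" "g t"] arg_cong[OF loop, of "d (g t)"] by linarith
      then show ?thesis using \<open>b \<le> t\<close> by (simp add: g'_def x_def)
    qed
  next
    case False
    have "d x (\<pi> t) < r"
      by (rule tripod_dist_less[OF tri xyz(2,3,1) \<pi>X yz xy xz \<pi>d])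
    then show ?thesis using False commute[of x "\<pi> t"] by (simp add: g'_def)
  qed
  then have 2: "loop_homotopic mtopology g' (\<lambda>_. x)"
    using g'c g'0 g'1 xyz by (intro loop_homotopic_close[OF tri]) (auto simp: pathin_def)
  show ?thesis using homotopic_with_trans[OF 1 2] by blast
qed

end

section \<open>The homotopy equivalence\<close>

lemma continuous_on_Max_image:
  fixes h :: "'i \<Rightarrow> 'b::topological_space \<Rightarrow> real"
  assumes "finite I" "I \<noteq> {}" "\<And>i. i \<in> I \<Longrightarrow> continuous_on S (h i)"
  shows "continuous_on S (\<lambda>f. Max ((\<lambda>i. h i f) ` I))"
  using assms
proof (induction I rule: finite_ne_induct)
  case (insert i I)
  then have "continuous_on S (\<lambda>f. max (h i f) (Max ((\<lambda>i. h i f) ` I)))"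
    by (intro continuous_on_max) auto
  then show ?case using insert by simp
qed auto

section \<open>Weighted centres under the tripod condition\<close>

context Metric_space
begin

text \<open>\<open>m\<close> is the centre of the smallest ball around the points \<open>x \<in> \<sigma>\<close>, each moved
away by an extra distance \<open>w x\<close>; \<open>weighted_diameter\<close> is twice its radius.\<close>

definition weighted_diameter :: "'a set \<Rightarrow> ('a \<Rightarrow> real) \<Rightarrow> real" where
  "weighted_diameter \<sigma> w = Max ((\<lambda>(x, y). d x y + w x + w y) ` (\<sigma> \<times> \<sigma>))"

definition weighted_centre :: "'a set \<Rightarrow> ('a \<Rightarrow> real) \<Rightarrow> 'a \<Rightarrow> bool" where
  "weighted_centre \<sigma> w m \<longleftrightarrow> m \<in> M \<and> (\<exists>x\<in>\<sigma>. \<exists>y\<in>\<sigma>. d x y + w x + w y = weighted_diameter \<sigma> w \<and>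
     2 * d x m = weighted_diameter \<sigma> w - 2 * w x \<and> 2 * d m y = weighted_diameter \<sigma> w - 2 * w y)"

lemma weighted_diameter_ge:
  assumes "finite \<sigma>" "x \<in> \<sigma>" "y \<in> \<sigma>"
  shows "d x y + w x + w y \<le> weighted_diameter \<sigma> w"
  unfolding weighted_diameter_def using assms by (intro Max_ge) (auto intro!: image_eqI[of _ _ "(x,y)"])

lemma weighted_diameter_attained:
  assumes "finite \<sigma>" "\<sigma> \<noteq> {}"
  obtains x y where "x \<in> \<sigma>" "y \<in> \<sigma>" "d x y + w x + w y = weighted_diameter \<sigma> w"
proof -
  have "weighted_diameter \<sigma> w \<in> (\<lambda>(x, y). d x y + w x + w y) ` (\<sigma> \<times> \<sigma>)"
    unfolding weighted_diameter_def using assms by (intro Max_in) auto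
  then show ?thesis using that by auto
qed

text \<open>\<open>m\<close> lies between two points that realise the weighted diameter. By the
  tripod condition one of them lies behind \<open>m\<close> as seen from \<open>p\<close>, and both
  are on the boundary of the ball. Distance bounds, radius and uniqueness all follow from
  this.\<close>

lemma weighted_centre_branch:
  assumes tri: "tripod r" and \<sigma>: "rips_simplex M d r \<sigma>" and m: "weighted_centre \<sigma> w m"
    and p: "p \<in> M" "\<And>x. x \<in> \<sigma> \<Longrightarrow> d p x < r"
  obtains x where "x \<in> \<sigma>" "2 * d m x = weighted_diameter \<sigma> w - 2 * w x" "d p x = d p m + d m x"
proof -
  obtain x y where xy: "x \<in> \<sigma>" "y \<in> \<sigma>" "d x y + w x + w y = weighted_diameter \<sigma> w"
     "2 * d x m = weighted_diameter \<sigma> w - 2 * w x" "2 * d m y = weighted_diameter \<sigma> w - 2 * w y"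
     and mM: "m \<in> M"
    using m unfolding weighted_centre_def by blast
  have xyM: "x \<in> M" "y \<in> M" "d x y < r" using xy \<sigma> unfolding rips_simplex_def by auto
  have "d x m + d m y = d x y" using xy by linarith
  then show ?thesis
  proof (rule tripodD[OF tri xyM(1,2) p(1) mM xyM(3) p(2)[OF xy(1)] p(2)[OF xy(2)]])
    assume "d p x = d p m + d m x"
    then show ?thesis using that[OF xy(1)] xy(4) commute[of m x] by auto
  next
    assume "d p y = d p m + d m y"
    then show ?thesis using that[OF xy(2) xy(5)] by auto
  qed
qed

lemma weighted_centre_dist_less:
  assumes "tripod r" "rips_simplex M d r \<sigma>" "weighted_centre \<sigma> w m" "p \<in> M" "\<And>x. x \<in> \<sigma> \<Longrightarrow> d p x < r"
  shows "d p m < r"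
proof -
  obtain x where "x \<in> \<sigma>" "d p x = d p m + d m x" using weighted_centre_branch[OF assms] by metis
  then show ?thesis using assms(5)[of x] nonneg[of m x] by linarith
qed

text \<open>Viewed from \<open>z\<close> itself some boundary point \<open>x\<close> lies behind
  \<open>m\<close>. If \<open>z\<close> were outside the ball, the pair \<open>z\<close>,
  \<open>x\<close> would exceed the weighted diameter.\<close>

lemma weighted_centre_radius:
  assumes "tripod r" "rips_simplex M d r \<sigma>" "weighted_centre \<sigma> w m" "z \<in> \<sigma>"
  shows "2 * d z m + 2 * w z \<le> weighted_diameter \<sigma> w"
proof -
  have z: "z \<in> M" "\<And>x. x \<in> \<sigma> \<Longrightarrow> d z x < r" "finite \<sigma>" using assms(2,4) by (auto simp: rips_simplex_def)
  obtain x where x: "x \<in> \<sigma>" "2 * d m x = weighted_diameter \<sigma> w - 2 * w x" "d z x = d z m + d m x"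
    using weighted_centre_branch[OF assms(1-3) z(1,2)] by metis
  show ?thesis using weighted_diameter_ge[OF z(3) assms(4) x(1), of w] x by linarith
qed

text \<open>From \<open>m'\<close> some boundary point \<open>x\<close> of the ball around
  \<open>m\<close> lies behind \<open>m\<close>. The ball around \<open>m'\<close> has the same
  radius and contains \<open>x\<close>, which leaves no room for a positive
  \<open>d m' m\<close>.\<close>

lemma weighted_centre_unique:
  assumes "tripod r" "rips_simplex M d r \<sigma>" "weighted_centre \<sigma> w m" "weighted_centre \<sigma> w m'"
  shows "m = m'"
proof -
  have M: "m \<in> M" "m' \<in> M" using assms unfolding weighted_centre_def by auto
  have "d x m' < r" if x: "x \<in> \<sigma>" for x
    by (rule weighted_centre_dist_less[OF assms(1,2,4)]) (use x assms(2) in \<open>auto simp: rips_simplex_def\<close>)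
  then have "d m' x < r" if "x \<in> \<sigma>" for x using that commute[of m' x] by simp
  then obtain x where x: "x \<in> \<sigma>" "2 * d m x = weighted_diameter \<sigma> w - 2 * w x" "d m' x = d m' m + d m x"
    using weighted_centre_branch[OF assms(1-3) M(2)] by metis
  have "d m' m \<le> 0"
    using weighted_centre_radius[OF assms(1,2,4) x(1)] x commute[of m' x] by linarith
  then show ?thesis using M zero[OF M(2,1)] nonneg[of m' m] by auto
qed

text \<open>A point of weight 0 in a pair can be replaced by \<open>x0\<close>, whose weight
  \<open>r\<close> exceeds every distance in \<open>\<sigma>\<close>; so the diameter is already
  attained on \<open>\<tau>\<close>. This makes the centre agree on faces, where coordinates
  vanish.\<close>

lemma weighted_centre_superset:
  assumes \<sigma>: "rips_simplex M d r \<sigma>" and \<tau>: "\<tau> \<subseteq> \<sigma>" and w: "\<And>x. x \<in> \<sigma> - \<tau> \<Longrightarrow> w x = 0"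
    and x0: "x0 \<in> \<tau>" "w x0 = r" and m: "weighted_centre \<tau> w m"
  shows "weighted_centre \<sigma> w m"
proof -
  have fin: "finite \<sigma>" "finite \<tau>" using \<sigma> \<tau> by (auto simp: rips_simplex_def intro: finite_subset)
  have lt: "d x y < r" if "x \<in> \<sigma>" "y \<in> \<sigma>" for x y using \<sigma> that by (auto simp: rips_simplex_def)
  have "weighted_diameter \<sigma> w = weighted_diameter \<tau> w"
  proof (rule antisym)
    obtain x y where xy: "x \<in> \<sigma>" "y \<in> \<sigma>" "d x y + w x + w y = weighted_diameter \<sigma> w"
      using weighted_diameter_attained[OF fin(1)] x0(1) \<tau> by (metis empty_iff subset_empty)
    define x' where "x' = (if x \<in> \<tau> then x else x0)"
    define y' where "y' = (if y \<in> \<tau> then y else x0)"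
    have "d x y + w x + w y \<le> d x' y' + w x' + w y'"
    proof -
      have 0: "x \<notin> \<tau> \<Longrightarrow> w x = 0" "y \<notin> \<tau> \<Longrightarrow> w y = 0" using w xy by auto
      note 1 = lt[OF xy(1,2)] x0(2) nonneg[of x0 y] nonneg[of x x0] nonneg[of x0 x0] nonneg[of x y]
      show ?thesis
      proof (cases "x \<in> \<tau>")
        case True
        show ?thesis
        proof (cases "y \<in> \<tau>")
          case False
          then show ?thesis unfolding x'_def y'_def if_P[OF True] if_not_P[OF False] using 0 1 by linarith
        qed (simp add: x'_def y'_def True)
      next
        case x: False
        show ?thesis
        proof (cases "y \<in> \<tau>")
          case True
          then show ?thesis unfolding x'_def y'_def if_P[OF True] if_not_P[OF x] using 0(1)[OF x] 1 by linarith
        next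
          case y: False
          then show ?thesis unfolding x'_def y'_def if_not_P[OF x] if_not_P[OF y] using 0(1)[OF x] 0(2)[OF y] 1 by linarith
        qed
      qed
    qed
    also have "\<dots> \<le> weighted_diameter \<tau> w"
      by (rule weighted_diameter_ge[OF fin(2)]) (use x0 in \<open>auto simp: x'_def y'_def\<close>)
    finally show "weighted_diameter \<sigma> w \<le> weighted_diameter \<tau> w" using xy by simp
    obtain x y where xy: "x \<in> \<tau>" "y \<in> \<tau>" "d x y + w x + w y = weighted_diameter \<tau> w"
      using weighted_diameter_attained[OF fin(2)] x0(1) by (metis empty_iff)
    have "d x y + w x + w y \<le> weighted_diameter \<sigma> w"
      using xy \<tau> by (intro weighted_diameter_ge[OF fin(1)]) auto
    then show "weighted_diameter \<tau> w \<le> weighted_diameter \<sigma> w" using xy by simp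
  qed
  then show ?thesis using m \<tau> unfolding weighted_centre_def by auto
qed

end

text \<open>Division by the maximum gives some vertex exactly the weight \<open>r\<close>, as
  \<open>weighted_centre_superset\<close> demands. The coordinates themselves, scaled by
  \<open>r\<close>, could all be too small for that.\<close>

definition rips_weight :: "real \<Rightarrow> ('a \<Rightarrow> real) \<Rightarrow> 'a \<Rightarrow> real" where
  "rips_weight r f x = r * f x / Max (f ` supp f)"

text \<open>The support jumps when a point reaches a face, but the maximum may be taken over the
  fixed set \<open>\<sigma>\<close> instead; in that form it is seen to be continuous and
  positive.\<close>

lemma closed_simplex_Max:
  assumes "f \<in> closed_simplex \<sigma>" "finite \<sigma>"
  shows "Max (f ` supp f) = Max (f ` \<sigma>)" "0 < Max (f ` \<sigma>)"
    "\<exists>x\<in>supp f. f x = Max (f ` supp f)" "\<And>x. f x \<le> Max (f ` \<sigma>)"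
proof -
  have f: "\<And>x. 0 \<le> f x" "supp f \<subseteq> \<sigma>" "sum f \<sigma> = 1" using assms unfolding closed_simplex_def by auto
  have fin: "finite (supp f)" using f(2) assms(2) by (rule finite_subset)
  obtain a where a: "a \<in> \<sigma>" "f a \<noteq> 0" using f(3) by (metis sum.neutral zero_neq_one)
  have pos: "0 < f a" using f(1)[of a] a by simp
  show p: "0 < Max (f ` \<sigma>)" using a assms(2) pos by (subst Max_gr_iff) auto
  have "Max (f ` \<sigma>) \<in> f ` \<sigma>" using a assms(2) by (intro Max_in) auto
  then obtain b where b: "b \<in> \<sigma>" "f b = Max (f ` \<sigma>)" by auto
  have bs: "b \<in> supp f" using b p by auto
  show eq: "Max (f ` supp f) = Max (f ` \<sigma>)"
  proof (rule antisym)
    show "Max (f ` supp f) \<le> Max (f ` \<sigma>)"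
      using assms(2) f(2) bs by (intro Max_mono) auto
    show "Max (f ` \<sigma>) \<le> Max (f ` supp f)" using b bs fin by (metis Max_ge finite_imageI imageI)
  qed
  show "\<exists>x\<in>supp f. f x = Max (f ` supp f)" using b(2) bs eq by (intro bexI[of _ b]) auto
  show "f x \<le> Max (f ` \<sigma>)" for x
  proof (cases "x \<in> \<sigma>")
    case False
    then have "f x = 0" using f(2) by auto
    then show ?thesis using p by simp
  qed (use assms(2) in auto)
qed

lemma rips_weight_bounds:
  assumes "f \<in> closed_simplex \<sigma>" "finite \<sigma>" "0 < r"
  shows "0 \<le> rips_weight r f x" "rips_weight r f x \<le> r" "rips_weight r f x = 0 \<longleftrightarrow> f x = 0"
    "\<exists>x\<in>supp f. rips_weight r f x = r"
proof -
  note M = closed_simplex_Max[OF assms(1,2)]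
  have f: "0 \<le> f x" using assms unfolding closed_simplex_def by auto
  show "0 \<le> rips_weight r f x" "rips_weight r f x \<le> r" "rips_weight r f x = 0 \<longleftrightarrow> f x = 0"
    unfolding rips_weight_def M(1) using assms(3) M(2) f M(4)[of x] by (auto simp: field_simps)
  show "\<exists>x\<in>supp f. rips_weight r f x = r"
  proof -
    obtain x where "x \<in> supp f" "f x = Max (f ` supp f)" using M(3) by blast
    then show ?thesis using M(1,2) unfolding rips_weight_def by (intro bexI[of _ x]) auto
  qed
qed

lemma continuous_on_rips_weight:
  assumes "finite \<sigma>" "\<sigma> \<noteq> {}"
  shows "continuous_on (closed_simplex \<sigma>) (\<lambda>f. rips_weight r f x)"
proof -
  have "continuous_on (closed_simplex \<sigma>) (\<lambda>f. r * f x / Max ((\<lambda>y. f y) ` \<sigma>))"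
    using closed_simplex_Max(2)[OF _ assms(1)]
    by (intro continuous_intros continuous_on_coordinate continuous_on_Max_image assms) force
  then show ?thesis
    by (rule continuous_on_eq) (simp add: rips_weight_def closed_simplex_Max(1)[OF _ assms(1)])
qed

text \<open>The vertices that are kept lie within \<open>3 * r / 4\<close> of \<open>rips_centre r f\<close>, which leaves room
for moving to a point of the complex within \<open>r / 4\<close> of the centre.\<close>
definition rips_truncate :: "('a \<Rightarrow> real) \<Rightarrow> 'a \<Rightarrow> real" where
  "rips_truncate f x = max 0 (rips_weight 1 f x - 3 / 4) / (\<Sum>y\<in>supp f. max 0 (rips_weight 1 f y - 3 / 4))"

lemma rips_truncate:
  assumes f: "f \<in> closed_simplex \<sigma>" and \<sigma>: "finite \<sigma>"
  shows "rips_truncate f \<in> closed_simplex \<sigma>" "supp (rips_truncate f) \<subseteq> {x \<in> supp f. 3 / 4 < rips_weight 1 f x}"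
    "0 < (\<Sum>y\<in>\<sigma>. max 0 (rips_weight 1 f y - 3 / 4))"
    "(\<Sum>y\<in>supp f. max 0 (rips_weight 1 f y - 3 / 4)) = (\<Sum>y\<in>\<sigma>. max 0 (rips_weight 1 f y - 3 / 4))"
proof -
  let ?h = "\<lambda>y. max 0 (rips_weight 1 f y - 3 / 4)"
  have sf: "supp f \<subseteq> \<sigma>" using f by (auto simp: closed_simplex_def)
  note w = rips_weight_bounds[OF f \<sigma> zero_less_one]
  show eq: "sum ?h (supp f) = sum ?h \<sigma>"
    using \<sigma> sf by (intro sum.mono_neutral_left) (auto simp: rips_weight_def)
  obtain x0 where x0: "x0 \<in> supp f" "rips_weight 1 f x0 = 1" using w(4) by auto
  have "?h x0 \<le> sum ?h \<sigma>" using x0 sf \<sigma> by (intro member_le_sum) auto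
  then show pos: "0 < sum ?h \<sigma>" using x0 by simp
  show supp: "supp (rips_truncate f) \<subseteq> {x \<in> supp f. 3 / 4 < rips_weight 1 f x}"
    by (auto simp: rips_truncate_def max_def rips_weight_def split: if_splits)
  have "sum (rips_truncate f) \<sigma> = sum ?h \<sigma> / sum ?h \<sigma>"
    unfolding rips_truncate_def eq by (rule sum_divide_distrib[symmetric])
  then have "sum (rips_truncate f) \<sigma> = 1" using pos by simp
  moreover have "0 \<le> rips_truncate f x" for x using eq pos by (simp add: rips_truncate_def)
  ultimately show "rips_truncate f \<in> closed_simplex \<sigma>" using supp sf unfolding closed_simplex_def by auto
qed

lemma continuous_on_rips_truncate:
  assumes "finite \<sigma>" "\<sigma> \<noteq> {}"
  shows "continuous_on (closed_simplex \<sigma>) (\<lambda>f. rips_truncate f x)"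
proof -
  have "continuous_on (closed_simplex \<sigma>) (\<lambda>f. max 0 (rips_weight 1 f x - 3 / 4) / (\<Sum>y\<in>\<sigma>. max 0 (rips_weight 1 f y - 3 / 4)))"
    using rips_truncate(3)[OF _ assms(1)]
    by (intro continuous_intros continuous_on_rips_weight assms) force
  then show ?thesis
    by (rule continuous_on_eq) (simp add: rips_truncate_def rips_truncate(4)[OF _ assms(1)])
qed

section \<open>The two maps between the space and the complex\<close>

context Metric_space
begin

definition rips_centre :: "real \<Rightarrow> ('a \<Rightarrow> real) \<Rightarrow> 'a" where
  "rips_centre r f = (SOME m. weighted_centre (supp f) (rips_weight r f) m)"

text \<open>A substitute for the inclusion of the vertices, which is not continuous for the weak topology.\<close>
definition rips_approx :: "real \<Rightarrow> real \<Rightarrow> ('a \<Rightarrow> 'a \<Rightarrow> real) \<Rightarrow> bool" where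
  "rips_approx r e \<psi> \<longleftrightarrow> (\<exists>N. finite N \<and> N \<subseteq> M \<and>
     (\<forall>p\<in>M. \<psi> p \<in> rips_carrier M d r \<and> supp (\<psi> p) \<subseteq> {a\<in>N. d p a < e}) \<and>
     (\<forall>a. continuous_map mtopology euclideanreal (\<lambda>p. \<psi> p a)))"

lemma rips_approxD:
  assumes "rips_approx r e \<psi>" "p \<in> M"
  shows "\<psi> p \<in> rips_carrier M d r" "\<And>a. a \<in> supp (\<psi> p) \<Longrightarrow> d p a < e" "supp (\<psi> p) \<subseteq> M"
proof -
  obtain N where N: "N \<subseteq> M" "\<psi> p \<in> rips_carrier M d r" "supp (\<psi> p) \<subseteq> {a\<in>N. d p a < e}"
    using assms unfolding rips_approx_def by meson
  show "\<psi> p \<in> rips_carrier M d r" by (rule N(2))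
  show "\<And>a. a \<in> supp (\<psi> p) \<Longrightarrow> d p a < e" "supp (\<psi> p) \<subseteq> M" using N(1,3) by blast+
qed

lemma rips_approx_coordinate:
  "rips_approx r e \<psi> \<Longrightarrow> continuous_map mtopology euclideanreal (\<lambda>p. \<psi> p a)"
  unfolding rips_approx_def by (elim exE conjE) (rule spec)

lemma rips_approx_finite:
  assumes "rips_approx r e \<psi>" shows "finite (\<Union>p\<in>M. supp (\<psi> p))"
proof -
  obtain N where "finite N" "\<forall>p\<in>M. supp (\<psi> p) \<subseteq> {a\<in>N. d p a < e}"
    using assms unfolding rips_approx_def by meson
  then show ?thesis by (rule_tac finite_subset[of _ N]) auto
qed

lemma rips_approx_continuous_map:
  assumes "rips_approx r e \<psi>" shows "continuous_map mtopology (rips_topology M d r) \<psi>"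
  by (rule continuous_map_into_rips[OF rips_approx_finite[OF assms]])
    (auto simp: rips_approxD(1)[OF assms] rips_approx_coordinate[OF assms])

end

context compact_geodesic
begin

text \<open>A partition of unity made of normalised tents of radius \<open>e\<close> around a finite
  net. Net points close to the same \<open>p\<close> are less than \<open>2 * e\<close> apart, so
  they span a simplex.\<close>

lemma rips_approx_exists:
  assumes e: "0 < e" "2 * e \<le> r"
  shows "\<exists>\<psi>. rips_approx r e \<psi>"
proof -
  obtain N where N: "finite N" "N \<subseteq> X" "\<And>x. x \<in> X \<Longrightarrow> \<exists>a\<in>N. d x a < e" using finite_net[OF e(1)] by metis
  define b where "b = (\<lambda>p a. if a \<in> N then max 0 (e - d p a) else 0)"
  define \<psi> where "\<psi> = (\<lambda>p a. b p a / (\<Sum>c\<in>N. b p c))"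
  have b0: "0 \<le> b p a" for p a by (simp add: b_def)
  have pos: "0 < (\<Sum>c\<in>N. b p c)" if p: "p \<in> X" for p
  proof -
    obtain a where a: "a \<in> N" "d p a < e" using N(3)[OF p] by auto
    then have "b p a \<le> (\<Sum>c\<in>N. b p c)" using b0 N by (intro member_le_sum) auto
    then show ?thesis using a by (simp add: b_def)
  qed
  have supp: "supp (\<psi> p) \<subseteq> {a\<in>N. d p a < e}" if "p \<in> X" for p
    by (auto simp: \<psi>_def b_def max_def split: if_splits)
  have "\<psi> p \<in> rips_carrier X d r" if p: "p \<in> X" for p
  proof -
    let ?S = "{a\<in>N. d p a < e}"
    have "d x y < r" if "x \<in> ?S" "y \<in> ?S" for x y
      using that triangle''[of x p y] p N e by (auto simp: subset_iff)
    moreover have "?S \<noteq> {}" using N(3)[OF p] by auto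
    ultimately have simp: "rips_simplex X d r ?S" using N unfolding rips_simplex_def by auto
    have "sum (\<psi> p) ?S = sum (\<psi> p) N" using supp[OF p] N by (intro sum.mono_neutral_left) auto
    also have "\<dots> = 1" using pos[OF p] by (simp add: \<psi>_def flip: sum_divide_distrib)
    finally have "\<psi> p \<in> closed_simplex ?S"
      using supp[OF p] pos[OF p] b0 unfolding closed_simplex_def by (auto simp: \<psi>_def)
    then show ?thesis using closed_simplex_subset_rips_carrier[OF simp] by auto
  qed
  moreover have "continuous_map mtopology euclideanreal (\<lambda>p. \<psi> p a)" for a
  proof -
    have "continuous_map mtopology euclideanreal (\<lambda>p. b p a)" for a
    proof (cases "a \<in> N")
      case True
      then have "continuous_map mtopology mtopology (\<lambda>p. a)" using N by auto
      then show ?thesis using True unfolding b_def by (auto intro!: continuous_intros)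
    qed (simp add: b_def)
    then show ?thesis unfolding \<psi>_def
      by (intro continuous_map_real_divide continuous_map_sum) (use pos N in \<open>auto simp: less_le\<close>)
  qed
  ultimately have "rips_approx r e \<psi>"
    unfolding rips_approx_def by (intro exI[of _ N] conjI ballI allI N supp)
  then show ?thesis by blast
qed

lemma weighted_centre_exists:
  assumes "rips_simplex X d r \<sigma>" shows "\<exists>m. weighted_centre \<sigma> w m"
proof -
  have \<sigma>: "finite \<sigma>" "\<sigma> \<noteq> {}" "\<sigma> \<subseteq> X" using assms by (auto simp: rips_simplex_def)
  obtain x y where xy: "x \<in> \<sigma>" "y \<in> \<sigma>" "d x y + w x + w y = weighted_diameter \<sigma> w"
    using weighted_diameter_attained[OF \<sigma>(1,2)] by metis
  have X: "x \<in> X" "y \<in> X" using xy \<sigma> by auto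
  \<comment> \<open>The pairs \<open>x\<close>, \<open>x\<close> and \<open>y\<close>,
    \<open>y\<close> also count for the diameter. Hence the distance wanted from \<open>x\<close>,
    half the diameter minus \<open>w x\<close>, lies between 0 and \<open>d x y\<close>.\<close>
  have "2 * w x \<le> weighted_diameter \<sigma> w" "2 * w y \<le> weighted_diameter \<sigma> w"
    using weighted_diameter_ge[OF \<sigma>(1) xy(1,1), of w] weighted_diameter_ge[OF \<sigma>(1) xy(2,2), of w] X by auto
  then obtain m where "m \<in> X" "d x m = weighted_diameter \<sigma> w / 2 - w x" "d m y = d x y - (weighted_diameter \<sigma> w / 2 - w x)"
    using between[OF X, of "weighted_diameter \<sigma> w / 2 - w x"] xy by auto
  then have "weighted_centre \<sigma> w m" unfolding weighted_centre_def using xy by (intro conjI bexI[of _ x] bexI[of _ y]) auto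
  then show ?thesis by blast
qed

lemma rips_centre:
  assumes "rips_simplex X d r \<sigma>" "f \<in> closed_simplex \<sigma>" "0 < r"
  shows "weighted_centre \<sigma> (rips_weight r f) (rips_centre r f)"
proof -
  have fin: "finite \<sigma>" using assms by (simp add: rips_simplex_def)
  have sf: "supp f \<subseteq> \<sigma>" using assms(2) by (auto simp: closed_simplex_def)
  obtain x0 where x0: "x0 \<in> supp f" "rips_weight r f x0 = r" using rips_weight_bounds(4)[OF assms(2) fin assms(3)] by auto
  have "rips_simplex X d r (supp f)" using rips_simplex_subset[OF assms(1) sf] x0 by auto
  from weighted_centre_exists[OF this]
  have c: "weighted_centre (supp f) (rips_weight r f) (rips_centre r f)"
    unfolding rips_centre_def by (rule someI_ex)
  show ?thesis
    by (rule weighted_centre_superset[OF assms(1) sf _ x0(1) _ c]) (use x0(2) in \<open>auto simp: rips_weight_def\<close>)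
qed

text \<open>For each pair of vertices the conditions on a centre are three equations between
  continuous functions, \<open>E\<close> and twice \<open>F\<close>. By uniqueness the graph is the
  finite union of their solution sets, hence closed.\<close>

lemma continuous_map_rips_centre_simplex:
  assumes tri: "tripod r" and r: "0 < r" and \<sigma>: "rips_simplex X d r \<sigma>"
  shows "continuous_map (top_of_set (closed_simplex \<sigma>)) mtopology (rips_centre r)"
proof (rule continuous_map_of_closed_graph[OF compact])
  let ?T = "top_of_set (closed_simplex \<sigma>)"
  let ?Z = "prod_topology ?T mtopology"
  have fin: "finite \<sigma>" "\<sigma> \<noteq> {}" "\<sigma> \<subseteq> X" using \<sigma> by (auto simp: rips_simplex_def)
  show "rips_centre r \<in> topspace ?T \<rightarrow> topspace mtopology"
    using rips_centre[OF \<sigma> _ r] by (auto simp: weighted_centre_def)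
  define R where "R = (\<lambda>f. weighted_diameter \<sigma> (rips_weight r f))"
  define E where "E = (\<lambda>x y (p :: ('a \<Rightarrow> real) \<times> 'a). d x y + rips_weight r (fst p) x + rips_weight r (fst p) y - R (fst p))"
  define F where "F = (\<lambda>x p. 2 * d x (snd p) - (R (fst p) - 2 * rips_weight r (fst p) x))"
  have wc: "continuous_map ?Z euclideanreal (\<lambda>p. rips_weight r (fst p) x)" for x
    by (rule continuous_map_fst_comp) (simp add: continuous_on_rips_weight fin)
  have "continuous_on (closed_simplex \<sigma>) R"
    unfolding R_def weighted_diameter_def case_prod_unfold
    by (intro continuous_on_Max_image continuous_intros continuous_on_rips_weight) (use fin in auto)
  then have Rc: "continuous_map ?Z euclideanreal (\<lambda>p. R (fst p))"
    by (intro continuous_map_fst_comp) simp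
  have Ec: "continuous_map ?Z euclideanreal (E x y)" for x y
    unfolding E_def by (intro continuous_map_add continuous_map_diff wc Rc) simp
  have Fc: "continuous_map ?Z euclideanreal (F x)" if "x \<in> \<sigma>" for x
    unfolding F_def
    by (intro continuous_map_diff continuous_map_real_mult_left wc Rc continuous_map_d continuous_map_snd)
      (use that fin in auto)
  have iff: "m = rips_centre r f \<longleftrightarrow> m \<in> X \<and> weighted_centre \<sigma> (rips_weight r f) m"
    if "f \<in> closed_simplex \<sigma>" for f m
  proof -
    note c = rips_centre[OF \<sigma> that r]
    have "rips_centre r f \<in> X" using c by (simp add: weighted_centre_def)
    then show ?thesis using c weighted_centre_unique[OF tri \<sigma> _ c] by blast
  qed
  have "{(f, m). f \<in> closed_simplex \<sigma> \<and> m = rips_centre r f} =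
     {p \<in> topspace ?Z. weighted_centre \<sigma> (rips_weight r (fst p)) (snd p)}"
    by (rule set_eqI) (simp add: case_prod_unfold mem_Times_iff iff cong: conj_cong)
  also have "\<dots> = (\<Union>x\<in>\<sigma>. \<Union>y\<in>\<sigma>. {p \<in> topspace ?Z. E x y p = 0} \<inter>
      ({p \<in> topspace ?Z. F x p = 0} \<inter> {p \<in> topspace ?Z. F y p = 0}))"
    unfolding weighted_centre_def E_def F_def R_def
    by (rule set_eqI) (simp add: commute[of "snd _"] mem_Times_iff; blast)
  finally have eq: "{(f, m). f \<in> closed_simplex \<sigma> \<and> m = rips_centre r f} = \<dots>" .
  have "closedin ?Z ({p \<in> topspace ?Z. E x y p = 0} \<inter>
      ({p \<in> topspace ?Z. F x p = 0} \<inter> {p \<in> topspace ?Z. F y p = 0}))" if "x \<in> \<sigma>" "y \<in> \<sigma>" for x y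
    by (intro closedin_Int closedin_eq_zero Ec Fc that)
  then have "closedin ?Z (\<Union>y\<in>\<sigma>. {p \<in> topspace ?Z. E x y p = 0} \<inter>
      ({p \<in> topspace ?Z. F x p = 0} \<inter> {p \<in> topspace ?Z. F y p = 0}))" if "x \<in> \<sigma>" for x
    using that by (intro closedin_Union finite_imageI fin(1)) (elim imageE, hypsubst)
  then show "closedin ?Z {(f, m). f \<in> topspace ?T \<and> m = rips_centre r f}"
    unfolding topspace_euclidean_subtopology eq
    by (intro closedin_Union finite_imageI fin(1)) (elim imageE, hypsubst)
qed

text \<open>Vertices of \<open>f\<close> are only known to be closer than \<open>r\<close> to the
  centre, and the vertices of \<open>\<psi>\<close> near the centre may be too far from them to span
  a simplex. Hence the detour through \<open>rips_truncate\<close>, which drops the vertices of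
  small weight.\<close>

lemma rips_homotopy_equivalent_if_tripod:
  assumes tri: "tripod r" and r: "0 < r"
  shows "rips_topology X d r homotopy_equivalent_space mtopology"
proof -
  let ?R = "rips_topology X d r"
  obtain \<psi> where \<psi>: "rips_approx r (r / 4) \<psi>" using rips_approx_exists[of "r/4" r] r by auto
  let ?\<phi> = "rips_centre r"
  have \<phi>c: "continuous_map ?R mtopology ?\<phi>"
    by (intro continuous_map_from_rips continuous_map_rips_centre_simplex tri r)
  have \<phi>X: "?\<phi> f \<in> X" if "f \<in> rips_carrier X d r" for f
    using continuous_map_image_subset_topspace[OF \<phi>c] that by auto
  note \<psi>c = rips_approx_continuous_map[OF \<psi>]
  have fins: "finite \<sigma>" "\<sigma> \<noteq> {}" if "rips_simplex X d r \<sigma>" for \<sigma> using that by (auto simp: rips_simplex_def)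
  have tr: "rips_truncate f \<in> rips_carrier X d r"
    "supp (rips_truncate f) \<subseteq> {x \<in> supp f. 3 / 4 < rips_weight 1 f x}" if "f \<in> rips_carrier X d r" for f
    using rips_truncate[OF rips_carrier_supp(2)[OF that] fins(1)[OF rips_carrier_supp(1)[OF that]]]
      closed_simplex_subset_rips_carrier[OF rips_carrier_supp(1)[OF that]] by auto
  have ssub: "supp f \<subseteq> \<sigma>" "f \<in> rips_carrier X d r" if "rips_simplex X d r \<sigma>" "f \<in> closed_simplex \<sigma>" for f \<sigma>
    using that(2) closed_simplex_subset_rips_carrier[OF that(1)] by (auto simp: closed_simplex_def)
  have 1: "homotopic_with (\<lambda>_. True) ?R ?R id rips_truncate"
  proof (rule homotopic_with_segment_rips)
    fix f assume f: "f \<in> rips_carrier X d r"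
    then show "id f \<in> rips_carrier X d r" "rips_truncate f \<in> rips_carrier X d r" using tr by auto
    have "supp (id f) \<union> supp (rips_truncate f) = supp f" using tr(2)[OF f] by auto
    then show "rips_simplex X d r (supp (id f) \<union> supp (rips_truncate f))" using rips_carrier_supp(1)[OF f] by simp
  next
    fix \<sigma> a assume \<sigma>: "rips_simplex X d r \<sigma>"
    show "\<exists>A. finite A \<and> (\<forall>f\<in>closed_simplex \<sigma>. supp (id f) \<union> supp (rips_truncate f) \<subseteq> A)"
      using fins(1)[OF \<sigma>] ssub[OF \<sigma>] tr(2) by (intro exI[of _ \<sigma>]) fastforce
    show "continuous_on (closed_simplex \<sigma>) (\<lambda>f. id f a)" by (simp add: continuous_on_coordinate)
    show "continuous_on (closed_simplex \<sigma>) (\<lambda>f. rips_truncate f a)"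
      by (rule continuous_on_rips_truncate[OF fins[OF \<sigma>]])
  qed
  have 2: "homotopic_with (\<lambda>_. True) ?R ?R rips_truncate (\<psi> \<circ> ?\<phi>)"
  proof (rule homotopic_with_segment_rips)
    fix f assume f: "f \<in> rips_carrier X d r"
    show ff: "rips_truncate f \<in> rips_carrier X d r" "(\<psi> \<circ> ?\<phi>) f \<in> rips_carrier X d r"
      using tr(1)[OF f] rips_approxD[OF \<psi> \<phi>X[OF f]] by auto
    have simp: "rips_simplex X d r (supp f)" using rips_carrier_supp[OF f] by auto
    then have fin: "finite (supp f)" and sX: "supp f \<subseteq> X"
      and lt: "\<And>x y. x \<in> supp f \<Longrightarrow> y \<in> supp f \<Longrightarrow> d x y < r" by (auto simp: rips_simplex_def)
    note wb = rips_weight_bounds[OF rips_carrier_supp(2)[OF f] fin]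
    note wc = rips_centre[OF simp rips_carrier_supp(2)[OF f] r]
    \<comment> \<open>A distance below \<open>r\<close> plus two weights of at most
      \<open>r\<close>. With a weight above \<open>3 * r / 4\<close> this puts a vertex within
      \<open>3 * r / 2 - 3 * r / 4\<close> of the centre.\<close>
    have D: "weighted_diameter (supp f) (rips_weight r f) < 3 * r"
    proof -
      obtain x y where "x \<in> supp f" "y \<in> supp f"
        "d x y + rips_weight r f x + rips_weight r f y = weighted_diameter (supp f) (rips_weight r f)"
        using weighted_diameter_attained[OF fin] simp unfolding rips_simplex_def by metis
      then show ?thesis using lt[of x y] wb(2)[OF r, of x] wb(2)[OF r, of y] by linarith
    qed
    have near: "d z (?\<phi> f) < 3 * r / 4" "z \<in> supp f" if "z \<in> supp (rips_truncate f)" for z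
    proof -
      show z: "z \<in> supp f" using tr(2)[OF f] that by auto
      have "3 / 4 < rips_weight 1 f z" using tr(2)[OF f] that by auto
      then have "r * (3 / 4) < r * rips_weight 1 f z" using r by (rule mult_strict_left_mono)
      then have "3 * r / 4 < rips_weight r f z" by (simp add: rips_weight_def)
      then show "d z (?\<phi> f) < 3 * r / 4"
        using weighted_centre_radius[OF tri simp wc z] D by linarith
    qed
    have near2: "d (?\<phi> f) z < r / 4" "z \<in> X" if "z \<in> supp ((\<psi> \<circ> ?\<phi>) f)" for z
      using rips_approxD[OF \<psi> \<phi>X[OF f]] that by auto
    have "d u v < r" if "u \<in> supp (rips_truncate f) \<union> supp ((\<psi> \<circ> ?\<phi>) f)"
      "v \<in> supp (rips_truncate f) \<union> supp ((\<psi> \<circ> ?\<phi>) f)" for u v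
    proof -
      have UV: "u \<in> X" "v \<in> X" using that near(2) near2(2) sX by blast+
      have l: "d u (?\<phi> f) < r / 4 \<or> u \<in> supp (rips_truncate f)" "d v (?\<phi> f) < r / 4 \<or> v \<in> supp (rips_truncate f)"
        using that near2(1) commute by auto
      have le: "d u v \<le> d u (?\<phi> f) + d v (?\<phi> f)" using triangle'[OF UV(1) \<phi>X[OF f] UV(2)] .
      show ?thesis
      proof (cases "u \<in> supp (rips_truncate f) \<and> v \<in> supp (rips_truncate f)")
        case True then show ?thesis using lt near(2) by blast
      next
        case False
        then show ?thesis using l le near(1)[of u] near(1)[of v] r by linarith
      qed
    qed
    then show "rips_simplex X d r (supp (rips_truncate f) \<union> supp ((\<psi> \<circ> ?\<phi>) f))"
      using rips_carrier_supp(1)[OF ff(1)] rips_carrier_supp(1)[OF ff(2)] unfolding rips_simplex_def by auto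
  next
    fix \<sigma> a assume \<sigma>: "rips_simplex X d r \<sigma>"
    show "\<exists>A. finite A \<and> (\<forall>f\<in>closed_simplex \<sigma>. supp (rips_truncate f) \<union> supp ((\<psi> \<circ> ?\<phi>) f) \<subseteq> A)"
    proof (intro exI[of _ "\<sigma> \<union> (\<Union>p\<in>X. supp (\<psi> p))"] conjI ballI)
      fix f assume f: "f \<in> closed_simplex \<sigma>"
      show "supp (rips_truncate f) \<union> supp ((\<psi> \<circ> ?\<phi>) f) \<subseteq> \<sigma> \<union> (\<Union>p\<in>X. supp (\<psi> p))"
        using ssub[OF \<sigma> f] tr(2)[of f] \<phi>X[of f] by auto
    qed (use fins(1)[OF \<sigma>] rips_approx_finite[OF \<psi>] in auto)
    show "continuous_on (closed_simplex \<sigma>) (\<lambda>f. rips_truncate f a)"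
      by (rule continuous_on_rips_truncate[OF fins[OF \<sigma>]])
    show "continuous_on (closed_simplex \<sigma>) (\<lambda>f. (\<psi> \<circ> ?\<phi>) f a)"
      using continuous_map_compose[OF continuous_map_rips_centre_simplex[OF tri r \<sigma>] rips_approx_coordinate[OF \<psi>, of a]]
      by (simp add: o_def)
  qed
  \<comment> \<open>All vertices of \<open>\<psi> p\<close> are within \<open>r\<close> of
    \<open>p\<close>, so by \<open>weighted_centre_dist_less\<close> their centre is too.\<close>
  have 3: "homotopic_with (\<lambda>_. True) mtopology mtopology id (?\<phi> \<circ> \<psi>)"
  proof (rule homotopic_with_close[OF tri])
    show "continuous_map mtopology mtopology (?\<phi> \<circ> \<psi>)" by (rule continuous_map_compose[OF \<psi>c \<phi>c])
    fix p assume "p \<in> topspace mtopology"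
    then have p: "p \<in> X" by simp
    note \<psi>p = rips_approxD[OF \<psi> p]
    have "d p (?\<phi> (\<psi> p)) < r"
      by (rule weighted_centre_dist_less[OF tri rips_carrier_supp(1)[OF \<psi>p(1)]
            rips_centre[OF rips_carrier_supp(1)[OF \<psi>p(1)] rips_carrier_supp(2)[OF \<psi>p(1)] r] p])
        (use \<psi>p(2) r in force)
    then show "d (id p) ((?\<phi> \<circ> \<psi>) p) < r" by simp
  qed auto
  show ?thesis
    unfolding homotopy_equivalent_space_def
    using \<phi>c \<psi>c homotopic_with_symD[OF homotopic_with_trans[OF 1 2]] homotopic_with_symD[OF 3] by blast
qed

end

section \<open>Metric graphs\<close>

definition path_join :: "(real \<Rightarrow> 'a) \<Rightarrow> (real \<Rightarrow> 'a) \<Rightarrow> real \<Rightarrow> 'a" where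
  "path_join p q = (\<lambda>t. if t \<le> 1/2 then p (2 * t) else q (2 * t - 1))"

lemma path_join_ends: "path_join p q 0 = p 0" "path_join p q 1 = q 1"
  by (auto simp: path_join_def)

lemma comp_path_join: "h \<circ> path_join p q = path_join (h \<circ> p) (h \<circ> q)"
  by (auto simp: path_join_def)

lemma path_join_eq_joinpaths: "path_join p q = p +++ q"
  by (simp add: path_join_def joinpaths_def)

lemma pathin_path_join:
  assumes p: "pathin Y p" and q: "pathin Y q" and "p 1 = q 0"
  shows "pathin Y (path_join p q)"
  unfolding pathin_def path_join_def
proof (rule continuous_map_cases_le)
  let ?I = "top_of_set {0..1::real}"
  have "continuous_map (subtopology ?I {x \<in> topspace ?I. x \<le> 1/2}) ?I (\<lambda>x. 2 * x)"
    "continuous_map (subtopology ?I {x \<in> topspace ?I. 1/2 \<le> x}) ?I (\<lambda>x. 2 * x - 1)"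
    by (auto simp: continuous_map_in_subtopology subtopology_subtopology intro!: continuous_intros)
  then show "continuous_map (subtopology ?I {x \<in> topspace ?I. x \<le> 1/2}) Y (\<lambda>x. p (2 * x))"
    "continuous_map (subtopology ?I {x \<in> topspace ?I. 1/2 \<le> x}) Y (\<lambda>x. q (2 * x - 1))"
    using continuous_map_compose p q unfolding pathin_def o_def by blast+
  fix t :: real assume "t = 1/2"
  then have t: "2 * t = 1" by simp
  show "p (2 * t) = q (2 * t - 1)" unfolding t using assms(3) by simp
qed auto

lemma dist_cis_le: "dist (cis a) (cis b) \<le> \<bar>a - b\<bar>"
proof -
  have "(dist (cis a) (cis b))\<^sup>2 = (cos a - cos b)\<^sup>2 + (sin a - sin b)\<^sup>2"
    by (simp add: dist_norm cmod_def)
  also have "\<dots> = ((sin a)\<^sup>2 + (cos a)\<^sup>2) + ((sin b)\<^sup>2 + (cos b)\<^sup>2) - 2 * (cos a * cos b + sin a * sin b)"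
    by (simp add: power2_diff algebra_simps)
  also have "\<dots> = 2 - 2 * cos (a - b)" by (simp add: cos_diff)
  also have "a - b = 2 * ((a - b) / 2)" by simp
  also have "2 - 2 * cos (2 * ((a - b) / 2)) = 4 * (sin ((a - b) / 2))\<^sup>2" by (subst cos_double_sin) simp
  also have "\<dots> = (2 * sin ((a - b) / 2))\<^sup>2" by (simp add: power2_eq_square)
  also have "\<dots> \<le> (a - b)\<^sup>2"
    using abs_sin_x_le_abs_x[of "(a - b) / 2"] by (subst abs_le_square_iff[symmetric]) (simp add: abs_mult)
  finally show ?thesis using abs_le_square_iff[of "dist (cis a) (cis b)" "a - b"] by simp
qed

lemma winding_number_cis:
  assumes "continuous_on {0..1} \<theta>"
  shows "winding_number (\<lambda>t. cis (\<theta> t)) 0 = of_real ((\<theta> 1 - \<theta> 0) / (2 * pi))"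
proof -
  have "path (\<lambda>t. \<i> * of_real (\<theta> t))" using assms by (auto simp: path_def intro!: continuous_intros)
  from winding_number_compose_exp[OF this]
  have "winding_number (\<lambda>t. cis (\<theta> t)) 0 = (\<i> * of_real (\<theta> 1) - \<i> * of_real (\<theta> 0)) / (2 * of_real pi * \<i>)"
    by (simp add: o_def cis_conv_exp pathfinish_def pathstart_def)
  also have "\<dots> = (of_real (\<theta> 1) - of_real (\<theta> 0)) / (2 * of_real pi)"
    by (simp add: divide_simps) (simp add: algebra_simps)
  finally show ?thesis by simp
qed

text \<open>A factor with a continuous closed real angle does not turn around 0; shrinking the angle
  to 0 is the homotopy.\<close>

lemma winding_number_rotate:
  assumes g: "continuous_on {0..1} g" "\<And>t. t \<in> {0..1} \<Longrightarrow> g t \<noteq> 0" "g 0 = g 1"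
    and \<psi>: "continuous_on {0..1} \<psi>" "\<psi> 0 = \<psi> 1"
  shows "winding_number (\<lambda>t. g t * cis (\<psi> t)) 0 = winding_number g 0"
proof (rule winding_number_homotopic_loops)
  have "homotopic_loops (-{0}) g (\<lambda>t. g t * cis (\<psi> t))"
    unfolding homotopic_loops
  proof (intro exI[of _ "\<lambda>(s,t). g t * cis (s * \<psi> t)"] conjI ballI)
    have "continuous_on ({0..1} \<times> {0..1::real}) (\<lambda>x. g (snd x) * exp (\<i> * of_real (fst x * \<psi> (snd x))))"
      by (intro continuous_intros continuous_on_compose2[OF g(1)] continuous_on_compose2[OF \<psi>(1)]) auto
    then show "continuous_on ({0..1} \<times> {0..1::real}) (\<lambda>(s,t). g t * cis (s * \<psi> t))"
      by (simp add: case_prod_unfold cis_conv_exp)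
  qed (use g \<psi> in \<open>auto simp: pathfinish_def pathstart_def\<close>)
  then show "homotopic_loops (-{0}) (\<lambda>t. g t * cis (\<psi> t)) g" by (rule homotopic_loops_sym)
qed

context Metric_space
begin

text \<open>The function \<open>v\<close> acts as an arc length. Upper bounds in this form add up
  under concatenation, without any refinement of partitions.\<close>

definition length_le :: "(real \<Rightarrow> 'a) \<Rightarrow> real \<Rightarrow> bool" where
  "length_le p A \<longleftrightarrow> (\<exists>v. v 0 = 0 \<and> v 1 = A \<and> (\<forall>s t. 0 \<le> s \<longrightarrow> s \<le> t \<longrightarrow> t \<le> 1 \<longrightarrow> d (p s) (p t) \<le> v t - v s))"

lemma length_le_path_length:
  assumes "length_le p A" shows "path_length d p \<le> ereal A"
  unfolding path_length_def
proof (rule SUP_least, clarsimp)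
  fix n :: nat and t :: "nat \<Rightarrow> real"
  assume t: "t 0 = 0" "t n = 1" "\<forall>i<n. t i \<le> t (Suc i)"
  obtain v where v: "v 0 = 0" "v 1 = A" "\<And>s t. 0 \<le> s \<Longrightarrow> s \<le> t \<Longrightarrow> t \<le> 1 \<Longrightarrow> d (p s) (p t) \<le> v t - v s"
    using assms unfolding length_le_def by metis
  have mono: "t i \<le> t j" if "i \<le> j" "j \<le> n" for i j
    using that
  proof (induction j rule: dec_induct)
    case (step k)
    then have "t i \<le> t k" "t k \<le> t (Suc k)" using t(3) by auto
    then show ?case by simp
  qed simp
  have t01: "0 \<le> t i" "t i \<le> 1" if "i \<le> n" for i using mono[of 0 i] mono[of i n] that t by auto
  have "(\<Sum>i<n. d (p (t i)) (p (t (Suc i)))) \<le> (\<Sum>i<n. v (t (Suc i)) - v (t i))"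
    by (intro sum_mono v t01) (use t(3) t01 in \<open>auto simp: Suc_le_eq\<close>)
  also have "\<dots> = v (t n) - v (t 0)" by (rule sum_lessThan_telescope)
  finally show "(\<Sum>i<n. d (p (t i)) (p (t (Suc i)))) \<le> A" using v t by simp
qed

lemma length_le_geodesic: "geodesic_path x y p \<Longrightarrow> length_le p (d x y)"
  unfolding length_le_def geodesic_path_def by (rule exI[of _ "\<lambda>t. t * d x y"]) (auto simp: algebra_simps)

lemma length_le_join:
  assumes "length_le p A" "length_le q B" "p 1 = q 0" "p ` {0..1} \<subseteq> M" "q ` {0..1} \<subseteq> M"
  shows "length_le (path_join p q) (A + B)"
proof -
  obtain v where v: "v 0 = 0" "v 1 = A" "\<And>s t. 0 \<le> s \<Longrightarrow> s \<le> t \<Longrightarrow> t \<le> 1 \<Longrightarrow> d (p s) (p t) \<le> v t - v s"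
    using assms(1) unfolding length_le_def by metis
  obtain w where w: "w 0 = 0" "w 1 = B" "\<And>s t. 0 \<le> s \<Longrightarrow> s \<le> t \<Longrightarrow> t \<le> 1 \<Longrightarrow> d (q s) (q t) \<le> w t - w s"
    using assms(2) unfolding length_le_def by metis
  let ?u = "\<lambda>t. if t \<le> 1/2 then v (2 * t) else A + w (2 * t - 1)"
  have "d (path_join p q s) (path_join p q t) \<le> ?u t - ?u s" if "0 \<le> s" "s \<le> t" "t \<le> 1" for s t
  proof (cases "s \<le> 1/2 \<and> 1/2 < t")
    case True
    have "d (p (2 * s)) (q (2 * t - 1)) \<le> d (p (2 * s)) (p 1) + d (q 0) (q (2 * t - 1))"
      unfolding assms(3) by (rule triangle) (use assms that True in auto)
    then show ?thesis using True v(3)[of "2 * s" 1] w(3)[of 0 "2 * t - 1"] v w that by (simp add: path_join_def)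
  next
    case False
    then show ?thesis using v(3)[of "2 * s" "2 * t"] w(3)[of "2 * s - 1" "2 * t - 1"] that
      by (auto simp: path_join_def)
  qed
  then show ?thesis unfolding length_le_def using v w by (intro exI[of _ ?u]) auto
qed

lemma continuous_map_Lipschitz:
  fixes F :: "'a \<Rightarrow> 'b::metric_space"
  assumes "\<And>x y. x \<in> M \<Longrightarrow> y \<in> M \<Longrightarrow> dist (F x) (F y) \<le> K * d x y"
  shows "continuous_map mtopology euclidean F"
proof -
  have "\<exists>\<delta>>0. \<forall>y. y \<in> M \<and> d x y < \<delta> \<longrightarrow> dist (F x) (F y) < e" if "x \<in> M" "0 < e" for x e
  proof (intro exI[of _ "e / (\<bar>K\<bar> + 1)"] conjI allI impI)
    fix y assume y: "y \<in> M \<and> d x y < e / (\<bar>K\<bar> + 1)"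
    have "dist (F x) (F y) \<le> K * d x y" using assms that y by auto
    also have "\<dots> \<le> (\<bar>K\<bar> + 1) * d x y" by (intro mult_right_mono) auto
    also have "\<dots> < e" using y by (simp add: field_simps)
    finally show "dist (F x) (F y) < e" .
  qed (use that in \<open>auto intro!: divide_pos_pos\<close>)
  then show ?thesis
    using metric_continuous_map[OF Met_TC.Metric_space_axioms, of F] by auto
qed

end

section \<open>Metric graphs as compact geodesic spaces\<close>

locale finite_metric_graph = Metric_space X d for X :: "'a set" and d +
  fixes V :: "'a set" and E :: "nat set" and L :: "nat \<Rightarrow> real" and \<gamma> :: "nat \<Rightarrow> real \<Rightarrow> 'a"
  assumes finV: "finite V" and finE: "finite E" and VX: "V \<subseteq> X"
    and L_pos: "\<And>e. e \<in> E \<Longrightarrow> 0 < L e"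
    and X_eq: "X = V \<union> (\<Union>e\<in>E. \<gamma> e ` {0..L e})"
    and ends: "\<And>e. e \<in> E \<Longrightarrow> \<gamma> e 0 \<in> V" "\<And>e. e \<in> E \<Longrightarrow> \<gamma> e (L e) \<in> V"
    and inj: "\<And>e. e \<in> E \<Longrightarrow> inj_on (\<gamma> e) {0<..<L e}"
    and open_V: "\<And>e. e \<in> E \<Longrightarrow> \<gamma> e ` {0<..<L e} \<inter> V = {}"
    and open_disj: "\<And>e e'. e \<in> E \<Longrightarrow> e' \<in> E \<Longrightarrow> e \<noteq> e' \<Longrightarrow> \<gamma> e ` {0<..<L e} \<inter> \<gamma> e' ` {0<..<L e'} = {}"
    and costs_nonempty: "\<And>x y. x \<in> X \<Longrightarrow> y \<in> X \<Longrightarrow> graph_chain_costs E L \<gamma> x y \<noteq> {}"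
    and d_eq: "\<And>x y. x \<in> X \<Longrightarrow> y \<in> X \<Longrightarrow> d x y = Inf (graph_chain_costs E L \<gamma> x y)"

lemma metric_graph_imp_finite_metric_graph:
  assumes "metric_graph X d" obtains V E L \<gamma> where "finite_metric_graph X d V E L \<gamma>"
proof -
  have "\<exists>V E L \<gamma>. finite_metric_graph X d V E L \<gamma>"
    using assms unfolding metric_graph_def
  proof (elim conjE exE)
    fix V E L \<gamma>
    assume M: "Metric_space X d"
      and H: "finite V" "finite E" "V \<subseteq> X" "\<forall>e\<in>E. 0 < L e" "X = V \<union> (\<Union>e\<in>E. \<gamma> e ` {0..L e})"
        "\<forall>e\<in>E. \<gamma> e 0 \<in> V \<and> \<gamma> e (L e) \<in> V \<and> inj_on (\<gamma> e) {0<..<L e} \<and> \<gamma> e ` {0<..<L e} \<inter> V = {}"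
        "\<forall>e\<in>E. \<forall>e'\<in>E. e \<noteq> e' \<longrightarrow> \<gamma> e ` {0<..<L e} \<inter> \<gamma> e' ` {0<..<L e'} = {}"
        "\<forall>x\<in>X. \<forall>y\<in>X. graph_chain_costs E L \<gamma> x y \<noteq> {} \<and> d x y = Inf (graph_chain_costs E L \<gamma> x y)"
    have "finite_metric_graph_axioms X d V E L \<gamma>"
      by (rule finite_metric_graph_axioms.intro; (rule H(1,2,3,5) | use H(4,6-8) in simp))
    then show ?thesis using finite_metric_graph.intro[OF M] by blast
  qed
  then show ?thesis using that by blast
qed

abbreviation chain_cost :: "(nat \<times> real \<times> real) list \<Rightarrow> real" where
  "chain_cost cs \<equiv> \<Sum>(e, s, t)\<leftarrow>cs. \<bar>s - t\<bar>"

lemma graph_chain_Nil [simp]: "graph_chain E L \<gamma> x y [] \<longleftrightarrow> x = y"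
  by (simp add: graph_chain_def)

lemma graph_chain_Cons:
  "graph_chain E L \<gamma> x y ((e, s, t) # cs) \<longleftrightarrow>
     e \<in> E \<and> s \<in> {0..L e} \<and> t \<in> {0..L e} \<and> \<gamma> e s = x \<and> graph_chain E L \<gamma> (\<gamma> e t) y cs"
proof (cases cs)
  case (Cons c cs')
  then show ?thesis unfolding graph_chain_def by (auto simp: All_less_Suc2)
qed (auto simp: graph_chain_def)

context finite_metric_graph
begin

lemma \<gamma>_in: "e \<in> E \<Longrightarrow> t \<in> {0..L e} \<Longrightarrow> \<gamma> e t \<in> X"
  using X_eq by blast

lemma chain_dist_le:
  assumes "x \<in> X" "y \<in> X" "graph_chain E L \<gamma> x y cs"
  shows "d x y \<le> chain_cost cs"
proof -
  have "bdd_below (graph_chain_costs E L \<gamma> x y)"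
    by (rule bdd_belowI[of _ 0]) (auto simp: graph_chain_costs_def intro!: sum_list_nonneg)
  moreover have "chain_cost cs \<in> graph_chain_costs E L \<gamma> x y"
    using assms(3) unfolding graph_chain_costs_def by blast
  ultimately show ?thesis unfolding d_eq[OF assms(1,2)] by (rule cInf_lower[rotated])
qed

lemma \<gamma>_dist_le:
  assumes "e \<in> E" "s \<in> {0..L e}" "t \<in> {0..L e}" shows "d (\<gamma> e s) (\<gamma> e t) \<le> \<bar>s - t\<bar>"
  using chain_dist_le[of "\<gamma> e s" "\<gamma> e t" "[(e,s,t)]"] assms \<gamma>_in by (simp add: graph_chain_Cons)

lemma near_optimal_chain:
  assumes "x \<in> X" "y \<in> X" "0 < \<epsilon>"
  obtains cs where "graph_chain E L \<gamma> x y cs" "chain_cost cs < d x y + \<epsilon>"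
proof -
  have "Inf (graph_chain_costs E L \<gamma> x y) < d x y + \<epsilon>" using d_eq assms by simp
  then obtain c where "c \<in> graph_chain_costs E L \<gamma> x y" "c < d x y + \<epsilon>"
    using cInf_lessD[OF costs_nonempty[OF assms(1,2)]] by blast
  then show ?thesis using that unfolding graph_chain_costs_def by blast
qed

text \<open>The metric is an infimum of chain costs, so an estimate on single edges adds up along
  near-optimal chains. All functions on X are shown to be continuous in this way, without a
  description of neighbourhoods of vertices.\<close>

lemma edgewise_Lipschitz:
  fixes F :: "'a \<Rightarrow> 'b::metric_space"
  assumes F: "\<And>e s t. e \<in> E \<Longrightarrow> s \<in> {0..L e} \<Longrightarrow> t \<in> {0..L e} \<Longrightarrow> dist (F (\<gamma> e s)) (F (\<gamma> e t)) \<le> K * \<bar>s - t\<bar>"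
    and K: "0 < K" and xy: "x \<in> X" "y \<in> X"
  shows "dist (F x) (F y) \<le> K * d x y"
proof -
  have chain: "dist (F u) (F y) \<le> K * chain_cost cs" if "graph_chain E L \<gamma> u y cs" for u cs
    using that
  proof (induction cs arbitrary: u)
    case (Cons c cs)
    obtain e s t where c: "c = (e,s,t)" by (metis prod_cases3)
    have *: "e \<in> E" "s \<in> {0..L e}" "t \<in> {0..L e}" "\<gamma> e s = u" "graph_chain E L \<gamma> (\<gamma> e t) y cs"
      using Cons.prems unfolding c graph_chain_Cons by auto
    have "dist (F u) (F y) \<le> dist (F u) (F (\<gamma> e t)) + dist (F (\<gamma> e t)) (F y)" by (rule dist_triangle)
    then show ?case using F[OF *(1-3)] Cons.IH[OF *(5)] *(4) unfolding c by (simp add: algebra_simps)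
  qed simp
  show ?thesis
  proof (rule field_le_epsilon)
    fix \<epsilon> :: real assume "0 < \<epsilon>"
    then obtain cs where cs: "graph_chain E L \<gamma> x y cs" "chain_cost cs < d x y + \<epsilon> / K"
      using near_optimal_chain[OF xy, of "\<epsilon> / K"] K by auto
    have "dist (F x) (F y) \<le> K * (d x y + \<epsilon> / K)"
      using chain[OF cs(1)] mult_left_mono[OF less_imp_le[OF cs(2)], of K] K by linarith
    then show "dist (F x) (F y) \<le> K * d x y + \<epsilon>" using K by (simp add: algebra_simps)
  qed
qed

lemma compact_mtopology: "compact_space mtopology"
proof -
  have "compactin mtopology (\<gamma> e ` {0..L e})" if "e \<in> E" for e
  proof (rule image_compactin)
    show "compactin (top_of_set {0..L e}) {0..L e}" by (simp add: compactin_subtopology)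
    show "continuous_map (top_of_set {0..L e}) mtopology (\<gamma> e)"
      by (rule continuous_map_Lipschitz_real[where K=1]) (use that \<gamma>_in \<gamma>_dist_le in auto)
  qed
  then have "compactin mtopology (\<Union>e\<in>E. \<gamma> e ` {0..L e})"
    using finE by (intro compactin_Union) auto
  moreover have "compactin mtopology V" using finV VX by (intro finite_imp_compactin) auto
  ultimately have "compactin mtopology X" using compactin_Un[of mtopology V] X_eq by auto
  then show ?thesis by (simp add: compact_space_def)
qed

lemma chain_split:
  assumes "graph_chain E L \<gamma> x y cs" "x \<in> X" "y \<in> X" "0 \<le> \<tau>" "\<tau> \<le> chain_cost cs"
  shows "\<exists>m\<in>X. d x m \<le> \<tau> \<and> d m y \<le> chain_cost cs - \<tau>"
  using assms
proof (induction cs arbitrary: x \<tau>)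
  case (Cons c cs)
  obtain e s t where c: "c = (e,s,t)" by (metis prod_cases3)
  have *: "e \<in> E" "s \<in> {0..L e}" "t \<in> {0..L e}" "\<gamma> e s = x" "graph_chain E L \<gamma> (\<gamma> e t) y cs"
    using Cons.prems(1) unfolding c graph_chain_Cons by auto
  have tX: "\<gamma> e t \<in> X" using * \<gamma>_in by auto
  let ?S = "chain_cost cs"
  show ?case
  proof (cases "\<tau> \<le> \<bar>s - t\<bar>")
    case True
    define u where "u = (if s \<le> t then s + \<tau> else s - \<tau>)"
    have u: "u \<in> {0..L e}" "\<bar>s - u\<bar> = \<tau>" "\<bar>u - t\<bar> = \<bar>s - t\<bar> - \<tau>"
      using True Cons.prems *(2,3) by (auto simp: u_def)
    have "d x (\<gamma> e u) \<le> \<tau>" using \<gamma>_dist_le[OF *(1,2) u(1)] *(4) u by simp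
    moreover have "d (\<gamma> e u) y \<le> d (\<gamma> e u) (\<gamma> e t) + d (\<gamma> e t) y"
      using u * tX \<gamma>_in Cons.prems by (intro triangle) auto
    moreover have "d (\<gamma> e t) y \<le> ?S" using chain_dist_le[OF tX Cons.prems(3) *(5)] .
    ultimately show ?thesis using \<gamma>_dist_le[OF *(1) u(1) *(3)] u \<gamma>_in[OF *(1) u(1)]
      by (intro bexI[of _ "\<gamma> e u"]) (auto simp: c)
  next
    case False
    then obtain m where m: "m \<in> X" "d (\<gamma> e t) m \<le> \<tau> - \<bar>s - t\<bar>" "d m y \<le> ?S - (\<tau> - \<bar>s - t\<bar>)"
      using Cons.IH[OF *(5) tX Cons.prems(3), of "\<tau> - \<bar>s - t\<bar>"] Cons.prems(5) by (auto simp: c)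
    have "d x m \<le> d x (\<gamma> e t) + d (\<gamma> e t) m" using m tX Cons.prems by (intro triangle) auto
    then show ?thesis using m \<gamma>_dist_le[OF *(1-3)] *(4) by (intro bexI[of _ m]) (auto simp: c)
  qed
next
  case Nil
  then show ?case by (intro bexI[of _ y]) auto
qed

text \<open>It is not known that some chain attains the infimum. Cutting near-optimal chains gives
  points that satisfy both bounds up to any positive error; on a compact space the worse error has a
  minimum, which is therefore at most 0. The triangle inequality turns both bounds into
  equations.\<close>

lemma between_exists:
  assumes xy: "x \<in> X" "y \<in> X" and t: "0 \<le> t" "t \<le> d x y"
  shows "\<exists>m\<in>X. d x m = t \<and> d m y = d x y - t"
proof -
  define f where "f = (\<lambda>m. max (d x m - t) (d m y - (d x y - t)))"
  have "continuous_map mtopology euclideanreal f"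
    unfolding f_def by (intro continuous_map_real_max continuous_map_diff continuous_map_d) (use xy in auto)
  then have "compactin euclideanreal (f ` X)"
    using compact_mtopology image_compactin unfolding compact_space_def topspace_mtopology by blast
  then have "compact (f ` X)" by simp
  then obtain m where m: "m \<in> X" "\<And>z. z \<in> X \<Longrightarrow> f m \<le> f z"
    using compact_attains_inf[of "f ` X"] xy by auto
  have "f m \<le> \<epsilon>" if \<epsilon>: "0 < \<epsilon>" for \<epsilon>
  proof -
    obtain cs where cs: "graph_chain E L \<gamma> x y cs" "chain_cost cs < d x y + \<epsilon>"
      using near_optimal_chain[OF xy \<epsilon>] by blast
    have "t \<le> chain_cost cs" using chain_dist_le[OF xy cs(1)] t by linarith
    from chain_split[OF cs(1) xy t(1) this] obtain z where
      z: "z \<in> X" "d x z \<le> t" "d z y \<le> chain_cost cs - t" by blast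
    have "f z \<le> \<epsilon>" unfolding f_def using z cs(2) \<epsilon> by auto
    then show ?thesis using m(2)[OF z(1)] by simp
  qed
  then have "f m \<le> 0" using field_le_epsilon[of "f m" 0] by simp
  then have "d x m \<le> t" "d m y \<le> d x y - t" unfolding f_def by auto
  then have "d x m = t" "d m y = d x y - t" using triangle[OF xy(1) m(1) xy(2)] by linarith+
  then show ?thesis using m(1) by blast
qed

sublocale compact_geodesic X d
  by unfold_locales (rule compact_mtopology, rule between_exists)

section \<open>Functions supported on one edge\<close>

definition edge_fun :: "nat \<Rightarrow> 'b \<Rightarrow> (real \<Rightarrow> 'b) \<Rightarrow> 'a \<Rightarrow> 'b" where
  "edge_fun e c \<phi> q = (if q \<in> \<gamma> e ` {0<..<L e} then \<phi> (the_inv_into {0<..<L e} (\<gamma> e) q) else c)"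

lemma edge_fun_\<gamma>:
  assumes "e \<in> E" "\<phi> 0 = c" "\<phi> (L e) = c" "t \<in> {0..L e}"
  shows "edge_fun e c \<phi> (\<gamma> e t) = \<phi> t"
proof (cases "t \<in> {0<..<L e}")
  case True
  then show ?thesis unfolding edge_fun_def using the_inv_into_f_f[OF inj[OF assms(1)] True] by auto
next
  case False
  then have "t = 0 \<or> t = L e" using assms(4) by auto
  then have "\<gamma> e t \<in> V" "\<phi> t = c" using ends[OF assms(1)] assms by auto
  then show ?thesis using open_V[OF assms(1)] unfolding edge_fun_def by auto
qed

lemma edge_fun_outside: "q \<notin> \<gamma> e ` {0<..<L e} \<Longrightarrow> edge_fun e c \<phi> q = c"
  by (simp add: edge_fun_def)

lemma edge_fun_other:
  assumes "e \<in> E" "e' \<in> E" "e \<noteq> e'" "t \<in> {0..L e'}"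
  shows "edge_fun e c \<phi> (\<gamma> e' t) = c"
proof (rule edge_fun_outside)
  show "\<gamma> e' t \<notin> \<gamma> e ` {0<..<L e}"
  proof (cases "t \<in> {0<..<L e'}")
    case True
    then have "\<gamma> e' t \<in> \<gamma> e' ` {0<..<L e'}" by blast
    then show ?thesis using open_disj[OF assms(1,2,3)] by blast
  next
    case False
    then have "t = 0 \<or> t = L e'" using assms(4) by auto
    then have "\<gamma> e' t \<in> V" using ends[OF assms(2)] by auto
    then show ?thesis using open_V[OF assms(1)] by auto
  qed
qed

text \<open>With \<open>\<phi>\<close> equal to \<open>c\<close> at both ends,
  \<open>edge_fun\<close> factors through the collapse of the complement of the open edge to a
  point. On the other edges it is constant, so only \<open>\<phi>\<close> contributes to the
  estimate.\<close>

lemma edge_fun_Lipschitz: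
  fixes \<phi> :: "real \<Rightarrow> 'b::metric_space"
  assumes e: "e \<in> E" "\<phi> 0 = c" "\<phi> (L e) = c" and K: "0 < K"
    and \<phi>: "\<And>s t. s \<in> {0..L e} \<Longrightarrow> t \<in> {0..L e} \<Longrightarrow> dist (\<phi> s) (\<phi> t) \<le> K * \<bar>s - t\<bar>"
    and xy: "x \<in> X" "y \<in> X"
  shows "dist (edge_fun e c \<phi> x) (edge_fun e c \<phi> y) \<le> K * d x y"
proof (rule edgewise_Lipschitz[OF _ K xy])
  fix e' s t assume st: "e' \<in> E" "s \<in> {0..L e'}" "t \<in> {0..L e'}"
  show "dist (edge_fun e c \<phi> (\<gamma> e' s)) (edge_fun e c \<phi> (\<gamma> e' t)) \<le> K * \<bar>s - t\<bar>"
  proof (cases "e = e'")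
    case True then show ?thesis using edge_fun_\<gamma>[of e \<phi> c, OF e] st \<phi> by auto
  next
    case False then show ?thesis using edge_fun_other[OF e(1) st(1) False, of _ c \<phi>] st K by auto
  qed
qed

text \<open>The tent \<open>min \<eta> \<bar>t - t0\<bar>\<close>, continued by
  \<open>\<eta>\<close> off the edge, is 1-Lipschitz on X and vanishes at
  \<open>\<gamma> e t0\<close>. So a point closer than \<open>\<eta>\<close> lies on the open edge,
  and no detour is shorter than the way along the edge.\<close>

lemma edge_ball:
  assumes e: "e \<in> E" and t0: "0 < \<eta>" "\<eta> \<le> t0" "\<eta> \<le> L e - t0" and q: "q \<in> X" "d q (\<gamma> e t0) < \<eta>"
  obtains t where "t \<in> {0<..<L e}" "q = \<gamma> e t" "\<bar>t - t0\<bar> = d q (\<gamma> e t0)"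
proof -
  define \<phi> where "\<phi> = (\<lambda>t. min \<eta> \<bar>t - t0\<bar>)"
  have \<phi>: "\<phi> 0 = \<eta>" "\<phi> (L e) = \<eta>" using t0 by (auto simp: \<phi>_def)
  have t01: "t0 \<in> {0..L e}" using t0 by auto
  have "dist (edge_fun e \<eta> \<phi> q) (edge_fun e \<eta> \<phi> (\<gamma> e t0)) \<le> 1 * d q (\<gamma> e t0)"
    by (rule edge_fun_Lipschitz[OF e \<phi> _ _ q(1) \<gamma>_in[OF e t01]]) (auto simp: \<phi>_def dist_real_def)
  moreover have "edge_fun e \<eta> \<phi> (\<gamma> e t0) = 0" using edge_fun_\<gamma>[of e \<phi> \<eta>, OF e \<phi> t01] t0 by (simp add: \<phi>_def)
  ultimately have le: "edge_fun e \<eta> \<phi> q \<le> d q (\<gamma> e t0)" by (simp add: dist_real_def)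
  then have "edge_fun e \<eta> \<phi> q \<noteq> \<eta>" using q by auto
  then have "q \<in> \<gamma> e ` {0<..<L e}" using edge_fun_outside[of q e \<eta> \<phi>] by blast
  then obtain t where t: "t \<in> {0<..<L e}" "q = \<gamma> e t" by auto
  have "edge_fun e \<eta> \<phi> q = \<phi> t" using edge_fun_\<gamma>[of e \<phi> \<eta>, OF e \<phi>] t by auto
  then have "\<bar>t - t0\<bar> \<le> d q (\<gamma> e t0)" using le q unfolding \<phi>_def by auto
  moreover have "d q (\<gamma> e t0) \<le> \<bar>t - t0\<bar>" using \<gamma>_dist_le[OF e _ t01] t by auto
  ultimately show ?thesis using that t by auto
qed

end

section \<open>Triangles that are not tripods\<close>

lemma ereal_le_third_iff: "ereal r \<le> S / 3 \<longleftrightarrow> ereal (3 * r) \<le> S"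
  by (cases S) (auto simp: field_simps)

context finite_metric_graph
begin

definition edge_wrap :: "nat \<Rightarrow> 'a \<Rightarrow> complex" where
  "edge_wrap e = edge_fun e (-1) (\<lambda>t. cis (pi * (2 * t / L e - 1)))"

lemma cis_edge_fun:
  assumes e: "e \<in> E" and \<phi>: "\<phi> 0 = - pi" "\<phi> (L e) = pi" and K: "0 < K"
    and lip: "\<And>s t. s \<in> {0..L e} \<Longrightarrow> t \<in> {0..L e} \<Longrightarrow> \<bar>\<phi> s - \<phi> t\<bar> \<le> K * \<bar>s - t\<bar>"
  shows "x \<in> X \<Longrightarrow> y \<in> X \<Longrightarrow> dist (edge_fun e (-1) (\<lambda>t. cis (\<phi> t)) x) (edge_fun e (-1) (\<lambda>t. cis (\<phi> t)) y) \<le> K * d x y"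
    "continuous_map mtopology euclidean (edge_fun e (-1) (\<lambda>t. cis (\<phi> t)))"
    "norm (edge_fun e (-1) (\<lambda>t. cis (\<phi> t)) q) = 1"
proof -
  have ends: "cis (\<phi> 0) = -1" "cis (\<phi> (L e)) = -1" using \<phi> by (simp_all add: cis_conv_exp[of "- pi"] exp_minus)
  show *: "dist (edge_fun e (-1) (\<lambda>t. cis (\<phi> t)) x) (edge_fun e (-1) (\<lambda>t. cis (\<phi> t)) y) \<le> K * d x y"
    if "x \<in> X" "y \<in> X" for x y
    by (rule edge_fun_Lipschitz[OF e ends K _ that]) (use dist_cis_le lip order_trans in blast)
  then show "continuous_map mtopology euclidean (edge_fun e (-1) (\<lambda>t. cis (\<phi> t)))"
    by (rule continuous_map_Lipschitz)
  show "norm (edge_fun e (-1) (\<lambda>t. cis (\<phi> t)) q) = 1" by (simp add: edge_fun_def)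
qed

lemma edge_wrap:
  assumes "e \<in> E"
  shows "x \<in> X \<Longrightarrow> y \<in> X \<Longrightarrow> dist (edge_wrap e x) (edge_wrap e y) \<le> 2 * pi / L e * d x y"
    "continuous_map mtopology euclidean (edge_wrap e)" "norm (edge_wrap e q) = 1"
proof -
  have Le: "0 < L e" using L_pos[OF assms] .
  have "\<bar>pi * (2 * s / L e - 1) - pi * (2 * t / L e - 1)\<bar> \<le> 2 * pi / L e * \<bar>s - t\<bar>" for s t
  proof -
    have "pi * (2 * s / L e - 1) - pi * (2 * t / L e - 1) = 2 * pi / L e * (s - t)"
      using Le by (simp add: field_simps)
    then show ?thesis using Le by (simp add: abs_mult)
  qed
  note * = cis_edge_fun[OF assms, of "\<lambda>t. pi * (2 * t / L e - 1)", OF _ _ _ this]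
  show "x \<in> X \<Longrightarrow> y \<in> X \<Longrightarrow> dist (edge_wrap e x) (edge_wrap e y) \<le> 2 * pi / L e * d x y"
    "continuous_map mtopology euclidean (edge_wrap e)" "norm (edge_wrap e q) = 1"
    unfolding edge_wrap_def using * Le by auto
qed

lemma path_comp:
  assumes "continuous_map mtopology euclidean h" "pathin mtopology p"
  shows "path (h \<circ> p)"
  using pathin_compose[OF assms(2,1)] by (simp add: pathin_def path_def)

lemma winding_number_path_join:
  assumes h: "continuous_map mtopology euclidean h" "\<And>q. h q \<noteq> 0"
    and "pathin mtopology p" "pathin mtopology q" "p 1 = q 0"
  shows "winding_number (h \<circ> path_join p q) 0 = winding_number (h \<circ> p) 0 + winding_number (h \<circ> q) 0"
  unfolding comp_path_join path_join_eq_joinpaths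
  by (rule winding_number_join)
    (use assms path_comp[OF h(1)] in \<open>auto simp: path_image_def pathfinish_def pathstart_def\<close>)

text \<open>Outside a small neighbourhood of the crossing point, \<open>edge_wrap e\<close> can be deformed to
the constant \<open>-1\<close>; along the triangle the deformed map then turns exactly once.\<close>
lemma crossing_winding_number:
  assumes e: "e \<in> E" and t0: "t0 \<in> {0<..<L e}" and u: "u \<in> {0<..<1}"
    and p: "geodesic_path x y p" and q: "geodesic_path y z q" and q': "geodesic_path z x q'"
    and pu: "p u = \<gamma> e t0"
    and sx: "d z x < d z (p u) + d (p u) x" and sy: "d z y < d z (p u) + d (p u) y"
  shows "winding_number (edge_wrap e \<circ> path_join (path_join p q) q') 0 \<in> {1, -1}"
proof -
  have ends: "p 0 = x" "p 1 = y" "q 0 = y" "q 1 = z" "q' 0 = z" "q' 1 = x"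
    using p q q' unfolding geodesic_path_def by auto
  note pin = geodesic_path_pathin[OF p] geodesic_path_pathin[OF q] geodesic_path_pathin[OF q']
  have pX: "p s \<in> X" "q s \<in> X" "q' s \<in> X" if "s \<in> {0..1}" for s
    using p q q' that unfolding geodesic_path_def by auto
  have xyz: "x \<in> X" "y \<in> X" "z \<in> X" using pX[of 0] pX[of 1] ends by auto
  define m where "m = p u"
  have u01: "u \<in> {0..1}" and mX: "m \<in> X" using u pX by (auto simp: m_def)
  define D where "D = d x y"
  have iso: "d (p s) (p t) = \<bar>s - t\<bar> * D" if "s \<in> {0..1}" "t \<in> {0..1}" for s t
    using p that unfolding geodesic_path_def D_def by blast
  have dxm: "d x m = u * D" unfolding m_def D_def using geodesic_path_dist(1)[OF p u01] .
  have Dpos: "0 < D"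
  proof (rule ccontr)
    assume "\<not> 0 < D"
    then have "d x m = 0" using dxm nonneg[of x y] by (simp add: D_def)
    then have "x = m" using xyz mX by simp
    then show False using sx mX by (simp add: m_def)
  qed
  \<comment> \<open>The first two terms keep the ball around \<open>m\<close> inside the edge, the
    next two make its trace on \<open>p\<close> end before \<open>x\<close> and \<open>y\<close>.
    The last two are half the excesses in the strict triangle inequalities and keep the other two
    sides out of the ball.\<close>
  define \<eta> where "\<eta> = min (min t0 (L e - t0)) (min (min (u * D) ((1 - u) * D))
     (min ((d z m + d m x - d z x) / 2) ((d z m + d m y - d z y) / 2)))"
  have \<eta>: "0 < \<eta>" unfolding \<eta>_def using t0 u Dpos sx sy by (auto simp: m_def)
  have \<eta>t: "\<eta> \<le> t0" "\<eta> \<le> L e - t0" and \<eta>D: "\<eta> \<le> u * D" "\<eta> \<le> (1 - u) * D"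
    unfolding \<eta>_def by auto
  have "\<eta> \<le> (d z m + d m x - d z x) / 2" "\<eta> \<le> (d z m + d m y - d z y) / 2"
    unfolding \<eta>_def by linarith+
  then have \<eta>s: "2 * \<eta> \<le> d z m + d m x - d z x" "2 * \<eta> \<le> d z m + d m y - d z y"
    by (simp_all add: field_simps)
  \<comment> \<open>A point \<open>w\<close> between \<open>z\<close> and \<open>v\<close> gives
    \<open>d z m + d m v\<close> at most \<open>d z v + 2 * d w m\<close>, through two triangle
    inequalities.\<close>
  have off: "\<eta> \<le> d w m" if w: "w \<in> X" "d z w + d w v = d z v" "2 * \<eta> \<le> d z m + d m v - d z v" "v \<in> X" for w v
    using triangle[OF xyz(3) w(1) mX] triangle[OF mX w(1) w(4)] w commute[of w m] by linarith
  have pos: "\<exists>t. t \<in> {0<..<L e} \<and> p s = \<gamma> e t \<and> \<bar>t - t0\<bar> = \<bar>s - u\<bar> * D"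
    if "s \<in> {0..1}" "\<bar>s - u\<bar> * D < \<eta>" for s
  proof -
    have "d (p s) (\<gamma> e t0) = \<bar>s - u\<bar> * D" using iso[OF that(1) u01] pu by simp
    then show ?thesis using edge_ball[OF e \<eta> \<eta>t pX(1)[OF that(1)]] that(2) by metis
  qed
  define \<tau> where "\<tau> = (\<lambda>s. SOME t. t \<in> {0<..<L e} \<and> p s = \<gamma> e t \<and> \<bar>t - t0\<bar> = \<bar>s - u\<bar> * D)"
  have \<tau>: "\<tau> s \<in> {0<..<L e}" "p s = \<gamma> e (\<tau> s)" "\<bar>\<tau> s - t0\<bar> = \<bar>s - u\<bar> * D"
    if "s \<in> {0..1}" "\<bar>s - u\<bar> * D < \<eta>" for s
    using someI_ex[OF pos[OF that]] unfolding \<tau>_def by blast+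
  have le: "\<bar>s - t\<bar> * D \<le> \<bar>\<tau> s - \<tau> t\<bar>"
    if "s \<in> {0..1}" "\<bar>s - u\<bar> * D < \<eta>" "t \<in> {0..1}" "\<bar>t - u\<bar> * D < \<eta>" for s t
  proof -
    have "d (\<gamma> e (\<tau> s)) (\<gamma> e (\<tau> t)) \<le> \<bar>\<tau> s - \<tau> t\<bar>"
      using \<tau>(1)[OF that(1,2)] \<tau>(1)[OF that(3,4)] by (intro \<gamma>_dist_le[OF e]) auto
    then show ?thesis using \<tau>(2)[OF that(1,2)] \<tau>(2)[OF that(3,4)] iso[OF that(1,3)] by simp
  qed
  define k where "k = \<eta> / (2 * D)"
  define s1 where "s1 = u + k"
  define s2 where "s2 = u - k"
  have k: "k \<le> u" "k \<le> 1 - u" "0 < k"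
    using \<eta>D \<eta> Dpos by (auto simp: k_def field_simps)
  have kD: "k * D = \<eta> / 2" using Dpos by (simp add: k_def)
  have s1: "s1 \<in> {0..1}" "(s1 - u) * D = \<eta> / 2" "\<bar>s1 - u\<bar> * D < \<eta>" using k kD \<eta> u by (auto simp: s1_def)
  have s2: "s2 \<in> {0..1}" "(s2 - u) * D = - \<eta> / 2" "\<bar>s2 - u\<bar> * D < \<eta>" using k kD \<eta> u by (auto simp: s2_def)
  \<comment> \<open>The direction in which \<open>p\<close> runs through the edge. A priori
    \<open>\<tau> s\<close> is known only up to reflection in \<open>t0\<close>. By
    \<open>le\<close> the values at \<open>s1\<close> and \<open>s2\<close> lie on opposite sides of
    \<open>t0\<close>, and comparison with both of them decides the side for every other
    \<open>s\<close>.\<close>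
  define \<epsilon> :: real where "\<epsilon> = (if t0 < \<tau> s1 then 1 else -1)"
  have \<epsilon>: "\<epsilon> = 1 \<or> \<epsilon> = -1" by (simp add: \<epsilon>_def)
  have abs: "\<bar>s - t\<bar> * D = \<bar>(s - u) * D - (t - u) * D\<bar>" "\<bar>s - u\<bar> * D = \<bar>(s - u) * D\<bar>" for s t
    using Dpos by (simp_all add: abs_mult flip: left_diff_distrib)
  define g where "g = \<eta> / 2"
  have g: "0 < g" "\<eta> = g + g" using \<eta> by (simp_all add: g_def)
  have t1: "\<tau> s1 - t0 = \<epsilon> * g"
    using \<tau>(3)[OF s1(1,3)] s1(2) g unfolding abs(2) \<epsilon>_def by (auto split: if_splits)
  have t2: "\<tau> s2 - t0 = - (\<epsilon> * g)"
  proof -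
    have "\<bar>\<tau> s2 - t0\<bar> = g" using \<tau>(3)[OF s2(1,3)] s2(2) g unfolding abs(2) by simp
    moreover have "g + g \<le> \<bar>\<tau> s1 - \<tau> s2\<bar>"
      using le[OF s1(1,3) s2(1,3)] s1(2) s2(2) g unfolding abs(1) by simp
    ultimately show ?thesis using t1 g(1) \<epsilon> by (elim disjE; simp; linarith)
  qed
  have \<tau>eq: "\<tau> s - t0 = \<epsilon> * ((s - u) * D)" if s: "s \<in> {0..1}" "\<bar>s - u\<bar> * D < \<eta>" for s
  proof -
    define v where "v = (s - u) * D"
    have "\<bar>\<tau> s - t0\<bar> = \<bar>v\<bar>" using \<tau>(3)[OF s] unfolding abs(2) v_def .
    moreover have "\<bar>v - g\<bar> \<le> \<bar>\<tau> s - \<tau> s1\<bar>" "\<bar>v + g\<bar> \<le> \<bar>\<tau> s - \<tau> s2\<bar>"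
      using le[OF s s1(1,3)] le[OF s s2(1,3)] s1(2) s2(2) unfolding abs(1) v_def g_def by simp_all
    ultimately have "\<tau> s - t0 = \<epsilon> * v" using t1 t2 g(1) \<epsilon> by (elim disjE; simp; linarith)
    then show ?thesis by (simp add: v_def)
  qed
  define clip :: "real \<Rightarrow> real" where "clip = (\<lambda>a. max (-1) (min 1 a))"
  have clip_lip: "\<bar>clip a - clip b\<bar> \<le> \<bar>a - b\<bar>" for a b by (auto simp: clip_def)
  \<comment> \<open>This angle makes its whole turn within \<open>\<eta>\<close> of
    \<open>t0\<close>. The resulting \<open>h1\<close> is therefore constant on the two sides that
    avoid the ball, and on \<open>p\<close> it has an explicit angle
    \<open>\<theta>\<close>.\<close>
  define \<phi> where "\<phi> = (\<lambda>t. pi * clip ((t - t0) / \<eta>))"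
  define h1 where "h1 = edge_fun e (-1) (\<lambda>t. cis (\<phi> t))"
  have \<phi>0: "\<phi> 0 = - pi"
  proof -
    have "- t0 / \<eta> \<le> -1" using \<eta> \<eta>t by (simp add: field_simps)
    then show ?thesis by (simp add: \<phi>_def clip_def)
  qed
  have \<phi>L: "\<phi> (L e) = pi"
  proof -
    have "1 \<le> (L e - t0) / \<eta>" using \<eta> \<eta>t by (simp add: field_simps)
    then show ?thesis by (simp add: \<phi>_def clip_def)
  qed
  have \<phi>lip: "\<bar>\<phi> s - \<phi> t\<bar> \<le> pi / \<eta> * \<bar>s - t\<bar>" for s t
  proof -
    have "\<bar>\<phi> s - \<phi> t\<bar> = pi * \<bar>clip ((s - t0) / \<eta>) - clip ((t - t0) / \<eta>)\<bar>"
      unfolding \<phi>_def by (simp add: abs_mult flip: right_diff_distrib)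
    also have "\<dots> \<le> pi * \<bar>(s - t0) / \<eta> - (t - t0) / \<eta>\<bar>" by (intro mult_left_mono clip_lip) auto
    also have "\<dots> = pi / \<eta> * \<bar>s - t\<bar>" using \<eta> by (simp flip: diff_divide_distrib)
    finally show ?thesis .
  qed
  have Kpos: "0 < pi / \<eta>" using \<eta> by simp
  note h1 = cis_edge_fun[of e \<phi> "pi / \<eta>", OF e \<phi>0 \<phi>L Kpos \<phi>lip, folded h1_def]
  have h1_ne: "h1 w \<noteq> 0" for w using h1(3)[of w] by force
  have cpi: "cis (\<epsilon> * pi) = -1" "cis (- (\<epsilon> * pi)) = -1" "cis (- pi) = -1"
    using \<epsilon> by (auto simp: cis_conv_exp[of "- pi"] exp_minus)
  have far: "h1 w = -1" if w: "w \<in> X" "\<eta> \<le> d w m" for w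
  proof (cases "w \<in> \<gamma> e ` {0<..<L e}")
    case False then show ?thesis unfolding h1_def by (rule edge_fun_outside)
  next
    case True
    then obtain t where t: "t \<in> {0<..<L e}" "w = \<gamma> e t" by auto
    have "\<eta> \<le> \<bar>t - t0\<bar>" using \<gamma>_dist_le[OF e, of t t0] t t0 w pu by (auto simp: m_def)
    then have "(t - t0) / \<eta> \<le> -1 \<or> 1 \<le> (t - t0) / \<eta>" using \<eta> by (auto simp: field_simps)
    then have "\<phi> t = pi \<or> \<phi> t = - pi" by (auto simp: \<phi>_def clip_def)
    moreover have "h1 w = cis (\<phi> t)"
      unfolding h1_def t(2) by (rule edge_fun_\<gamma>[OF e]) (use \<phi>0 \<phi>L cpi t in auto)
    ultimately show ?thesis using cpi by auto
  qed
  define \<theta> where "\<theta> = (\<lambda>s. \<epsilon> * pi * clip ((s - u) * D / \<eta>))"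
  have h1p: "h1 (p s) = cis (\<theta> s)" if s: "s \<in> {0..1}" for s
  proof (cases "\<bar>s - u\<bar> * D < \<eta>")
    case True
    have "h1 (p s) = cis (\<phi> (\<tau> s))"
      unfolding h1_def \<tau>(2)[OF s True] by (rule edge_fun_\<gamma>[OF e]) (use \<phi>0 \<phi>L cpi \<tau>(1)[OF s True] in auto)
    also have "\<phi> (\<tau> s) = \<theta> s"
      unfolding \<phi>_def \<theta>_def \<tau>eq[OF s True] using \<epsilon> by (auto simp: clip_def)
    finally show ?thesis .
  next
    case False
    then have "\<eta> \<le> \<bar>(s - u) * D\<bar>" unfolding abs(2) by simp
    then have "(s - u) * D / \<eta> \<le> -1 \<or> 1 \<le> (s - u) * D / \<eta>" using \<eta> by (auto simp: field_simps)
    then have "\<theta> s = \<epsilon> * pi \<or> \<theta> s = - (\<epsilon> * pi)" by (auto simp: \<theta>_def clip_def)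
    moreover have "h1 (p s) = -1" using far[OF pX(1)[OF s]] iso[OF s u01] False by (simp add: m_def)
    ultimately show ?thesis using cpi by auto
  qed
  have "winding_number (h1 \<circ> p) 0 = winding_number (\<lambda>s. cis (\<theta> s)) 0"
    by (rule winding_number_cong) (use h1p in auto)
  also have "\<dots> = of_real ((\<theta> 1 - \<theta> 0) / (2 * pi))"
    by (rule winding_number_cis) (use \<eta> in \<open>auto simp: \<theta>_def clip_def intro!: continuous_intros\<close>)
  also have "\<theta> 1 = \<epsilon> * pi"
  proof -
    have "1 \<le> (1 - u) * D / \<eta>" using \<eta> \<eta>D by (simp add: field_simps)
    then show ?thesis by (simp add: \<theta>_def clip_def)
  qed
  also have "\<theta> 0 = - (\<epsilon> * pi)"
  proof -
    have "(0 - u) * D / \<eta> \<le> -1" using \<eta> \<eta>D by (simp add: field_simps)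
    then show ?thesis by (simp add: \<theta>_def clip_def)
  qed
  finally have wp: "winding_number (h1 \<circ> p) 0 = of_real \<epsilon>" by (simp add: o_def field_simps)
  have "h1 (q s) = -1" if s: "s \<in> {0..1}" for s
    using geodesic_path_dist[OF q s] commute[of y] commute[of "q s" z] commute[of y z] \<eta>s xyz pX(2)[OF s]
    by (intro far off[of _ y]) (auto simp: add.commute)
  then have wq: "winding_number (h1 \<circ> q) 0 = 0"
    using winding_number_cong[of "h1 \<circ> q" "\<lambda>_. -1" 0] by (simp add: winding_number_zero_const)
  have "h1 (q' s) = -1" if s: "s \<in> {0..1}" for s
    using geodesic_path_dist[OF q' s] \<eta>s xyz pX(3)[OF s] by (intro far off[of _ x]) auto
  then have wq': "winding_number (h1 \<circ> q') 0 = 0"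
    using winding_number_cong[of "h1 \<circ> q'" "\<lambda>_. -1" 0] by (simp add: winding_number_zero_const)
  let ?T = "path_join (path_join p q) q'"
  have pq: "pathin mtopology (path_join p q)" by (rule pathin_path_join) (use pin ends in auto)
  have T: "pathin mtopology ?T" by (rule pathin_path_join[OF pq]) (use pin ends in \<open>auto simp: path_join_ends\<close>)
  have w1: "winding_number (h1 \<circ> ?T) 0 = of_real \<epsilon>"
    using winding_number_path_join[OF h1(2) h1_ne pq pin(3)] winding_number_path_join[OF h1(2) h1_ne pin(1,2)]
    by (simp add: path_join_ends ends wp wq wq')
  \<comment> \<open>The two angles agree at both ends of the edge, so their difference extends by 0
    to a real function on X. It is a lift of the quotient of \<open>edge_wrap e\<close> and
    \<open>h1\<close>, which therefore have the same winding number.\<close>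
  define \<rho> where "\<rho> = (\<lambda>t. pi * (2 * t / L e - 1) - \<phi> t)"
  define \<psi> where "\<psi> = edge_fun e 0 \<rho>"
  have Le: "0 < L e" using L_pos[OF e] .
  have wrap: "edge_wrap e w = h1 w * cis (\<psi> w)" for w
    unfolding edge_wrap_def h1_def \<psi>_def \<rho>_def edge_fun_def by (simp add: cis_mult)
  have "dist (\<psi> v) (\<psi> w) \<le> (2 * pi / L e + pi / \<eta>) * d v w" if "v \<in> X" "w \<in> X" for v w
    unfolding \<psi>_def
  proof (rule edge_fun_Lipschitz[OF e _ _ _ _ that])
    fix s t
    have "\<rho> s - \<rho> t = 2 * pi / L e * (s - t) - (\<phi> s - \<phi> t)" using Le by (simp add: \<rho>_def field_simps)
    then have "\<bar>\<rho> s - \<rho> t\<bar> \<le> \<bar>2 * pi / L e * (s - t)\<bar> + \<bar>\<phi> s - \<phi> t\<bar>" by linarith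
    also have "\<dots> \<le> (2 * pi / L e + pi / \<eta>) * \<bar>s - t\<bar>"
      using \<phi>lip[of s t] Le by (simp add: abs_mult distrib_right)
    finally show "dist (\<rho> s) (\<rho> t) \<le> (2 * pi / L e + pi / \<eta>) * \<bar>s - t\<bar>" by (simp add: dist_real_def)
  qed (use \<phi>0 \<phi>L Le \<eta> in \<open>auto simp: \<rho>_def intro!: add_pos_pos\<close>)
  then have \<psi>c: "continuous_map mtopology euclideanreal \<psi>" by (rule continuous_map_Lipschitz)
  have "continuous_on {0..1} (\<psi> \<circ> ?T)" using pathin_compose[OF T \<psi>c] by (simp add: pathin_def)
  moreover have "continuous_on {0..1} (h1 \<circ> ?T)" using pathin_compose[OF T h1(2)] by (simp add: pathin_def)
  ultimately have "winding_number (\<lambda>t. (h1 \<circ> ?T) t * cis ((\<psi> \<circ> ?T) t)) 0 = winding_number (h1 \<circ> ?T) 0"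
    by (intro winding_number_rotate) (auto simp: h1_ne path_join_ends ends)
  moreover have "edge_wrap e \<circ> ?T = (\<lambda>t. (h1 \<circ> ?T) t * cis ((\<psi> \<circ> ?T) t))"
    by (simp add: fun_eq_iff wrap)
  ultimately show ?thesis using w1 \<epsilon> by auto
qed

text \<open>The point \<open>m\<close> may be a vertex of the graph, where no edge is crossed. Since
  the inequalities are strict, it can be moved slightly along \<open>p\<close> into the interior of
  an edge.\<close>

lemma crossing_triangle:
  assumes X: "x \<in> X" "y \<in> X" "z \<in> X" "m \<in> X" and m: "d x m + d m y = d x y"
    and ne: "d z x \<noteq> d z m + d m x" "d z y \<noteq> d z m + d m y"
  obtains e p q q' where "e \<in> E" "geodesic_path x y p" "geodesic_path y z q" "geodesic_path z x q'"
    "winding_number (edge_wrap e \<circ> path_join (path_join p q) q') 0 \<in> {1, -1}"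
proof -
  have sx: "d z x < d z m + d m x" and sy: "d z y < d z m + d m y"
    using triangle[OF X(3,4,1)] triangle[OF X(3,4,2)] ne by auto
  have mx: "m \<noteq> x" "m \<noteq> y" using sx sy X by auto
  obtain p where p: "geodesic_path x y p" and pm: "p (d x m / d x y) = m"
    using geodesic_path_through[OF X(1,2,4) m mx(1)] by blast
  obtain q where q: "geodesic_path y z q" using geodesic_path_exists[OF X(2,3)] by blast
  obtain q' where q': "geodesic_path z x q'" using geodesic_path_exists[OF X(3,1)] by blast
  define D where "D = d x y"
  define u0 where "u0 = d x m / D"
  have pos: "0 < d x m" "0 < d m y" using mx X by auto
  then have D: "0 < D" "d x m < D" using m by (auto simp: D_def)
  have u0: "u0 \<in> {0<..<1}" using pos D by (auto simp: u0_def field_simps)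
  have iso: "d (p s) (p t) = \<bar>s - t\<bar> * D" if "s \<in> {0..1}" "t \<in> {0..1}" for s t
    using p that unfolding geodesic_path_def D_def by blast
  have pX: "p s \<in> X" if "s \<in> {0..1}" for s using p that unfolding geodesic_path_def by auto
  \<comment> \<open>Moving by less than \<open>\<delta> * D\<close> lowers each excess by less than
    \<open>2 * (\<delta> * D)\<close>, hence the last two terms; the first two keep the new
    parameter inside the unit interval.\<close>
  define \<delta> where "\<delta> = min (min u0 (1 - u0)) (min ((d z m + d m x - d z x) / (2 * D)) ((d z m + d m y - d z y) / (2 * D)))"
  have \<delta>: "0 < \<delta>" unfolding \<delta>_def using u0 sx sy D by auto
  have \<delta>u: "\<delta> \<le> u0" "\<delta> \<le> 1 - u0" unfolding \<delta>_def by auto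
  have \<delta>D: "2 * (\<delta> * D) \<le> d z m + d m x - d z x" "2 * (\<delta> * D) \<le> d z m + d m y - d z y"
  proof -
    have "\<delta> \<le> (d z m + d m x - d z x) / (2 * D)" "\<delta> \<le> (d z m + d m y - d z y) / (2 * D)"
      unfolding \<delta>_def by auto
    then show "2 * (\<delta> * D) \<le> d z m + d m x - d z x" "2 * (\<delta> * D) \<le> d z m + d m y - d z y"
      using D by (auto simp: field_simps)
  qed
  have injp: "inj_on p {0..1}"
  proof (rule inj_onI)
    fix s t assume st: "s \<in> {0..1}" "t \<in> {0..1}" "p s = p t"
    then have "\<bar>s - t\<bar> * D = 0" using iso[OF st(1,2)] pX[OF st(2)] by simp
    then show "s = t" using D by simp
  qed
  \<comment> \<open>A geodesic of positive length is injective, so it meets the finite vertex set at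
    finitely many parameters.\<close>
  have "finite ({0..1} \<inter> p -` V)"
    using finite_vimage_IntI[OF finV injp] by (simp add: Int_commute)
  then have "{u0<..<u0 + \<delta>} - ({0..1} \<inter> p -` V) \<noteq> {}"
    using infinite_Ioo[of u0 "u0 + \<delta>"] \<delta> by (metis Diff_eq_empty_iff finite_subset less_add_same_cancel1)
  then obtain u where "u \<in> {u0<..<u0 + \<delta>} - ({0..1} \<inter> p -` V)" by blast
  then have u: "u0 < u" "u < u0 + \<delta>" "u \<notin> {0..1} \<inter> p -` V" by auto
  have u01: "u \<in> {0..1}" "u \<in> {0<..<1}" using u u0 \<delta>u by auto
  have "p u \<notin> V" using u u01 by auto
  then obtain e t0 where e: "e \<in> E" "t0 \<in> {0..L e}" "p u = \<gamma> e t0" using pX[OF u01(1)] X_eq by blast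
  have "t0 \<noteq> 0" "t0 \<noteq> L e" using \<open>p u \<notin> V\<close> e ends[OF e(1)] by auto
  then have t0: "t0 \<in> {0<..<L e}" using e by auto
  have "d (p u) m = \<bar>u - u0\<bar> * D" using iso[OF u01(1), of u0] u0 pm by (simp add: u0_def D_def)
  also have "\<dots> < \<delta> * D" using u D by (intro mult_strict_right_mono) auto
  finally have lt: "d (p u) m < \<delta> * D" .
  have "d z m \<le> d z (p u) + d (p u) m" "d m x \<le> d m (p u) + d (p u) x" "d m y \<le> d m (p u) + d (p u) y"
    by (intro triangle X pX u01)+
  then have "d z x < d z (p u) + d (p u) x" "d z y < d z (p u) + d (p u) y"
    using lt \<delta>D commute[of m "p u"] by linarith+
  from crossing_winding_number[OF e(1) t0 u01(2) p q q' e(3) this] show ?thesis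
    using that e(1) p q q' by blast
qed

lemma not_tripod_crossing:
  assumes "\<not> tripod r"
  obtains e x y z p q q' where "e \<in> E" "x \<in> X" "y \<in> X" "z \<in> X" "d x y < r" "d y z < r" "d z x < r"
    "geodesic_path x y p" "geodesic_path y z q" "geodesic_path z x q'"
    "winding_number (edge_wrap e \<circ> path_join (path_join p q) q') 0 \<in> {1, -1}"
proof -
  obtain x y z m where X: "x \<in> X" "y \<in> X" "z \<in> X" "m \<in> X" and lt: "d x y < r" "d y z < r" "d z x < r"
    and m: "d x m + d m y = d x y" and ne: "d z x \<noteq> d z m + d m x" "d z y \<noteq> d z m + d m y"
    using assms unfolding tripod_def by blast
  show ?thesis
    by (rule crossing_triangle[OF X m ne], rule that) (use X lt in blast)+
qed

lemma winding_number_edge_wrap_homotopic: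
  assumes e: "e \<in> E" and hom: "loop_homotopic mtopology p q"
  shows "winding_number (edge_wrap e \<circ> p) 0 = winding_number (edge_wrap e \<circ> q) 0"
proof (rule winding_number_homotopic_loops)
  have ne: "edge_wrap e w \<noteq> 0" for w using edge_wrap(3)[OF e, of w] by force
  have "continuous_map mtopology (top_of_set (-{0})) (edge_wrap e)"
    using edge_wrap(2)[OF e] ne by (auto simp: continuous_map_in_subtopology)
  from homotopic_with_compose_continuous_map_left[OF hom this]
  show "homotopic_loops (-{0}) (edge_wrap e \<circ> p) (edge_wrap e \<circ> q)"
    unfolding homotopic_loops_def pathfinish_def pathstart_def by simp
qed

lemma triangle_path:
  assumes "geodesic_path x y p" "geodesic_path y z q" "geodesic_path z x q'"
  shows "pathin mtopology (path_join (path_join p q) q')"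
    "path_join (path_join p q) q' 0 = path_join (path_join p q) q' 1"
    "path_length d (path_join (path_join p q) q') \<le> ereal (d x y + d y z + d z x)"
proof -
  have ends: "p 0 = x" "p 1 = y" "q 0 = y" "q 1 = z" "q' 0 = z" "q' 1 = x"
    and im: "p ` {0..1} \<subseteq> X" "q ` {0..1} \<subseteq> X" "q' ` {0..1} \<subseteq> X"
    using assms unfolding geodesic_path_def by auto
  have pq: "pathin mtopology (path_join p q)"
    by (rule pathin_path_join) (use assms ends geodesic_path_pathin in auto)
  show "pathin mtopology (path_join (path_join p q) q')"
    by (rule pathin_path_join[OF pq]) (use assms ends geodesic_path_pathin in \<open>auto simp: path_join_ends\<close>)
  show "path_join (path_join p q) q' 0 = path_join (path_join p q) q' 1"
    by (simp add: path_join_ends ends)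
  have "path_join p q ` {0..1} \<subseteq> X"
    using continuous_map_image_subset_topspace[OF pq[unfolded pathin_def]] by simp
  then have "length_le (path_join (path_join p q) q') (d x y + d y z + d z x)"
    using assms im by (intro length_le_join length_le_geodesic) (auto simp: path_join_ends ends)
  then show "path_length d (path_join (path_join p q) q') \<le> ereal (d x y + d y z + d z x)"
    by (rule length_le_path_length)
qed

lemma tripod_if_le_shortest_loop:
  assumes "ereal r \<le> shortest_loop X d / 3" shows "tripod r"
proof (rule ccontr)
  assume "\<not> tripod r"
  then obtain e x y z p q q' where e: "e \<in> E" and X: "x \<in> X" "y \<in> X" "z \<in> X"
    and lt: "d x y < r" "d y z < r" "d z x < r"
    and g: "geodesic_path x y p" "geodesic_path y z q" "geodesic_path z x q'"
    and w: "winding_number (edge_wrap e \<circ> path_join (path_join p q) q') 0 \<in> {1, -1}"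
    by (rule not_tripod_crossing)
  let ?T = "path_join (path_join p q) q'"
  note T = triangle_path[OF g]
  have "noncontractible_loop X d ?T"
    unfolding noncontractible_loop_def
  proof (intro conjI notI T(2))
    show "continuous_map (top_of_set {0..1}) mtopology ?T" using T(1) by (simp add: pathin_def)
    assume "\<exists>a. loop_homotopic mtopology ?T (\<lambda>_. a)"
    then obtain a where "loop_homotopic mtopology ?T (\<lambda>_. a)" by blast
    from winding_number_edge_wrap_homotopic[OF e this]
    have "winding_number (edge_wrap e \<circ> ?T) 0 = winding_number (\<lambda>_. edge_wrap e a) 0" by (simp add: o_def)
    moreover have "edge_wrap e a \<noteq> 0" using edge_wrap(3)[OF e, of a] by force
    ultimately show False using w winding_number_zero_const[of "edge_wrap e a" 0] by auto
  qed
  then have "shortest_loop X d \<le> path_length d ?T" unfolding shortest_loop_def by (intro INF_lower) simp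
  also have "\<dots> \<le> ereal (d x y + d y z + d z x)" by (rule T(3))
  also have "\<dots> < ereal (3 * r)" using lt by simp
  finally show False using assms unfolding ereal_le_third_iff by simp
qed

lemma le_shortest_loop_if_tripod:
  assumes "tripod r" "0 < r" shows "ereal r \<le> shortest_loop X d / 3"
  unfolding ereal_le_third_iff shortest_loop_def
proof (rule INF_greatest, rule ccontr)
  fix g assume g: "g \<in> {g. noncontractible_loop X d g}" and "\<not> ereal (3 * r) \<le> path_length d g"
  then have "path_length d g < ereal (3 * r)" "pathin mtopology g" "g 0 = g 1"
    by (auto simp: noncontractible_loop_def pathin_def)
  from short_loop_contractible[OF assms this(2,3,1)] g show False
    by (simp add: noncontractible_loop_def)
qed

text \<open>At this scale \<open>edge_wrap e\<close> maps a whole triangle into a disc that avoids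
  0, so the winding number vanishes and there is no crossing. The scale so found makes loop classes
  of X accessible to finite approximation, whatever \<open>r\<close> is.\<close>

lemma tripod_small: "\<exists>\<epsilon>>0. tripod \<epsilon>"
proof -
  \<comment> \<open>A triangle stays within \<open>2 * \<epsilon>\<close> of \<open>x\<close>, and
    \<open>2 * pi / L e\<close> is a Lipschitz constant of \<open>edge_wrap e\<close>; the factor
    \<open>8 * pi\<close> bounds the image distance by \<open>1 / 2\<close>. The element 1 covers a
    graph without edges.\<close>
  define \<epsilon> where "\<epsilon> = Min (insert 1 ((\<lambda>e. L e / (8 * pi)) ` E))"
  have fin: "finite (insert 1 ((\<lambda>e. L e / (8 * pi)) ` E))" using finE by simp
  have \<epsilon>: "0 < \<epsilon>" unfolding \<epsilon>_def using L_pos fin by (subst Min_gr_iff) auto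
  have \<epsilon>L: "\<epsilon> \<le> L e / (8 * pi)" if "e \<in> E" for e unfolding \<epsilon>_def using that fin by (intro Min_le) auto
  have "tripod \<epsilon>"
  proof (rule ccontr)
    assume "\<not> tripod \<epsilon>"
    then obtain e x y z p q q' where e: "e \<in> E" and X: "x \<in> X" "y \<in> X" "z \<in> X"
      and lt: "d x y < \<epsilon>" "d y z < \<epsilon>" "d z x < \<epsilon>"
      and g: "geodesic_path x y p" "geodesic_path y z q" "geodesic_path z x q'"
      and w: "winding_number (edge_wrap e \<circ> path_join (path_join p q) q') 0 \<in> {1, -1}"
      by (rule not_tripod_crossing)
    let ?T = "path_join (path_join p q) q'"
    note T = triangle_path[OF g]
    have Le: "0 < L e" using L_pos[OF e] .
    have TX: "?T t \<in> X" if "t \<in> {0..1}" for t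
      using continuous_map_image_subset_topspace[OF T(1)[unfolded pathin_def]] that by auto
    have near: "d x (?T t) < 2 * \<epsilon>" if t: "t \<in> {0..1}" for t
    proof -
      have 1: "d x (p s) < 2 * \<epsilon>" if "s \<in> {0..1}" for s
        using geodesic_path_dist(3)[OF g(1) that] nonneg[of "p s" y] lt \<epsilon> by linarith
      have 2: "d x (q s) < 2 * \<epsilon>" if "s \<in> {0..1}" for s
        using geodesic_path_dist(3)[OF g(2) that] nonneg[of "q s" z] lt
          triangle[OF X(1,2) geodesic_path_dist(4)[OF g(2) that]] by linarith
      have 3: "d x (q' s) < 2 * \<epsilon>" if "s \<in> {0..1}" for s
        using geodesic_path_dist(3)[OF g(3) that] nonneg[of z "q' s"] commute[of x "q' s"] lt \<epsilon> by linarith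
      show ?thesis using 1 2 3 t unfolding path_join_def by auto
    qed
    have "winding_number (edge_wrap e \<circ> ?T) 0 = 0"
    proof (rule winding_number_zero_outside)
      show "path (edge_wrap e \<circ> ?T)" by (rule path_comp[OF edge_wrap(2)[OF e] T(1)])
      show "convex (ball (edge_wrap e x) 1)" by simp
      show "pathfinish (edge_wrap e \<circ> ?T) = pathstart (edge_wrap e \<circ> ?T)"
        using T(2) by (simp add: pathfinish_def pathstart_def)
      show "0 \<notin> ball (edge_wrap e x) 1" using edge_wrap(3)[OF e, of x] by simp
      show "path_image (edge_wrap e \<circ> ?T) \<subseteq> ball (edge_wrap e x) 1"
      proof (clarsimp simp: path_image_def)
        fix t :: real assume t: "0 \<le> t" "t \<le> 1"
        have "dist (edge_wrap e x) (edge_wrap e (?T t)) \<le> 2 * pi / L e * d x (?T t)"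
          by (rule edge_wrap(1)[OF e X(1) TX]) (use t in auto)
        also have "\<dots> \<le> 2 * pi / L e * (2 * \<epsilon>)"
          using near[of t] t Le by (intro mult_left_mono) auto
        also have "\<dots> \<le> 2 * pi / L e * (2 * (L e / (8 * pi)))"
          using \<epsilon>L[OF e] Le by (intro mult_left_mono) auto
        also have "\<dots> = 1 / 2" using Le by (simp add: field_simps)
        finally show "dist (edge_wrap e x) (edge_wrap e (?T t)) < 1" by simp
      qed
    qed
    then show False using w by auto
  qed
  then show ?thesis using \<epsilon> by blast
qed

end

section \<open>Loop classes\<close>

definition path_reverse :: "(real \<Rightarrow> 'a) \<Rightarrow> real \<Rightarrow> 'a" where
  "path_reverse p = (\<lambda>t. p (1 - t))"

lemma path_reverse_ends: "path_reverse p 0 = p 1" "path_reverse p 1 = p 0"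
  by (auto simp: path_reverse_def)

lemma pathin_path_reverse: "pathin T p \<Longrightarrow> pathin T (path_reverse p)"
  unfolding pathin_def path_reverse_def
  by (rule continuous_map_compose[of _ "top_of_set {0..1}" "\<lambda>t. 1 - t", unfolded o_def])
    (auto simp: continuous_map_in_subtopology intro!: continuous_intros)

text \<open>For a path-connected space these are the homomorphisms from its fundamental group to the
group with two elements, i.e. its first cohomology with mod 2 coefficients: free homotopy invariance
avoids base points, and the last clause is additivity in the form in which it is needed.\<close>
definition loop_classes :: "'a topology \<Rightarrow> ((real \<Rightarrow> 'a) \<Rightarrow> bool) set" where
  "loop_classes T = {c. (\<forall>p. c p \<longrightarrow> pathin T p \<and> p 0 = p 1) \<and>
     (\<forall>p q. loop_homotopic T p q \<longrightarrow> c p = c q) \<and>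
     (\<forall>\<alpha> \<beta> \<rho> \<omega>. pathin T \<alpha> \<longrightarrow> pathin T \<beta> \<longrightarrow> pathin T \<rho> \<longrightarrow> pathin T \<omega> \<longrightarrow>
        \<alpha> 1 = \<beta> 0 \<longrightarrow> \<beta> 1 = \<rho> 0 \<longrightarrow> \<rho> 1 = \<alpha> 0 \<longrightarrow> \<omega> 0 = \<alpha> 1 \<longrightarrow> \<omega> 1 = \<alpha> 0 \<longrightarrow>
        c (path_join (path_join \<alpha> \<beta>) \<rho>) =
          (c (path_join \<alpha> \<omega>) \<noteq> c (path_join (path_join (path_reverse \<omega>) \<beta>) \<rho>)))}"

lemma loop_classesD:
  assumes "c \<in> loop_classes T"
  shows "c p \<Longrightarrow> pathin T p \<and> p 0 = p 1" "loop_homotopic T p q \<Longrightarrow> c p = c q"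
    "\<lbrakk>pathin T \<alpha>; pathin T \<beta>; pathin T \<rho>; pathin T \<omega>; \<alpha> 1 = \<beta> 0; \<beta> 1 = \<rho> 0; \<rho> 1 = \<alpha> 0; \<omega> 0 = \<alpha> 1; \<omega> 1 = \<alpha> 0\<rbrakk>
      \<Longrightarrow> c (path_join (path_join \<alpha> \<beta>) \<rho>) =
          (c (path_join \<alpha> \<omega>) \<noteq> c (path_join (path_join (path_reverse \<omega>) \<beta>) \<rho>))"
  using assms unfolding loop_classes_def mem_Collect_eq by (elim conjE; blast)+

lemma loop_classes_const:
  assumes "c \<in> loop_classes T" shows "\<not> c (\<lambda>_. a)"
proof
  assume a: "c (\<lambda>_. a)"
  then have "pathin T (\<lambda>_. a)" using loop_classesD(1)[OF assms] by blast
  \<comment> \<open>With four constant paths additivity says that \<open>c\<close> holds exactly if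
    it differs from itself.\<close>
  then show False using loop_classesD(3)[OF assms, of "\<lambda>_. a" "\<lambda>_. a" "\<lambda>_. a" "\<lambda>_. a"] a
    by (simp add: path_join_def path_reverse_def)
qed

definition loop_pullback :: "'a topology \<Rightarrow> ('a \<Rightarrow> 'b) \<Rightarrow> ((real \<Rightarrow> 'b) \<Rightarrow> bool) \<Rightarrow> (real \<Rightarrow> 'a) \<Rightarrow> bool" where
  "loop_pullback S f c = (\<lambda>p. pathin S p \<and> p 0 = p 1 \<and> c (f \<circ> p))"

lemma loop_homotopic_comp:
  assumes "loop_homotopic S p q" "continuous_map S T f"
  shows "loop_homotopic T (f \<circ> p) (f \<circ> q)"
  by (rule homotopic_with_compose_continuous_map_left[OF assms]) simp

lemma loop_homotopic_imp_loops:
  assumes "loop_homotopic S p q" shows "pathin S p" "pathin S q" "p 0 = p 1" "q 0 = q 1"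
  using homotopic_with_imp_continuous_maps[OF assms] homotopic_with_imp_property[OF assms]
  by (auto simp: pathin_def)

lemma loop_pullback_in_loop_classes:
  assumes f: "continuous_map S T f" and c: "c \<in> loop_classes T"
  shows "loop_pullback S f c \<in> loop_classes S"
proof -
  have 1: "loop_pullback S f c p = loop_pullback S f c q" if h: "loop_homotopic S p q" for p q
    using loop_classesD(2)[OF c loop_homotopic_comp[OF h f]] loop_homotopic_imp_loops[OF h]
    by (simp add: loop_pullback_def)
  have 2: "loop_pullback S f c (path_join (path_join \<alpha> \<beta>) \<rho>) =
     (loop_pullback S f c (path_join \<alpha> \<omega>) \<noteq> loop_pullback S f c (path_join (path_join (path_reverse \<omega>) \<beta>) \<rho>))"
    if p: "pathin S \<alpha>" "pathin S \<beta>" "pathin S \<rho>" "pathin S \<omega>"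
      and e: "\<alpha> 1 = \<beta> 0" "\<beta> 1 = \<rho> 0" "\<rho> 1 = \<alpha> 0" "\<omega> 0 = \<alpha> 1" "\<omega> 1 = \<alpha> 0" for \<alpha> \<beta> \<rho> \<omega>
  proof -
    have rev: "f \<circ> path_reverse \<omega> = path_reverse (f \<circ> \<omega>)" by (auto simp: path_reverse_def)
    note pj = pathin_path_join path_join_ends pathin_path_reverse p e
    have "pathin S (path_join (path_join \<alpha> \<beta>) \<rho>)" "pathin S (path_join \<alpha> \<omega>)"
      "pathin S (path_join (path_join (path_reverse \<omega>) \<beta>) \<rho>)"
      by (simp_all add: pj path_reverse_ends)
    then show ?thesis
      using loop_classesD(3)[OF c, of "f \<circ> \<alpha>" "f \<circ> \<beta>" "f \<circ> \<rho>" "f \<circ> \<omega>"] p[THEN pathin_compose[OF _ f]] e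
      by (simp add: loop_pullback_def comp_path_join path_join_ends path_reverse_ends rev)
  qed
  show ?thesis
    unfolding loop_classes_def using 1 2 by (auto simp: loop_pullback_def)
qed

text \<open>A left homotopy inverse \<open>g\<close> of \<open>f\<close> is enough: a class is
  recovered by pulling it back along \<open>g\<close> and then along \<open>f\<close>.\<close>

lemma loop_classes_subset_pullback:
  assumes f: "continuous_map S T f" and g: "continuous_map T S g"
    and gf: "homotopic_with (\<lambda>_. True) S S (g \<circ> f) id"
  shows "loop_classes S \<subseteq> loop_pullback S f ` loop_classes T"
proof
  fix c assume c: "c \<in> loop_classes S"
  have "c p = loop_pullback S f (loop_pullback T g c) p" for p
  proof (cases "pathin S p \<and> p 0 = p 1")
    case True
    have "loop_homotopic S ((g \<circ> f) \<circ> p) (id \<circ> p)"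
      by (rule homotopic_with_compose_continuous_map_right[OF gf]) (use True in \<open>auto simp: pathin_def\<close>)
    then have "c (g \<circ> (f \<circ> p)) = c p" using loop_classesD(2)[OF c] by (simp add: comp_assoc)
    then show ?thesis using True pathin_compose[OF _ f, of p] by (simp add: loop_pullback_def)
  next
    case False
    then show ?thesis using loop_classesD(1)[OF c] by (auto simp: loop_pullback_def)
  qed
  then have "c = loop_pullback S f (loop_pullback T g c)" by blast
  then show "c \<in> loop_pullback S f ` loop_classes T"
    using loop_pullback_in_loop_classes[OF g c] by blast
qed

text \<open>The reparametrisation is joined to the identity by convex combinations, which fix both
  ends.\<close>

lemma loop_homotopic_reparam:
  assumes q: "pathin T q" "q 0 = q 1" and \<phi>: "continuous_on {0..1} \<phi>" "\<phi> ` {0..1} \<subseteq> {0..1}" "\<phi> 0 = 0" "\<phi> 1 = 1"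
  shows "loop_homotopic T (q \<circ> \<phi>) q"
proof -
  let ?I = "top_of_set {0..1::real}"
  have "homotopic_with (\<lambda>h. h 0 = 0 \<and> h 1 = 1) ?I ?I \<phi> id"
    unfolding homotopic_with_def
  proof (intro exI[of _ "\<lambda>(s,t). (1 - s) * \<phi> t + s * t"] conjI allI ballI)
    have "continuous_on ({0..1} \<times> {0..1}) (\<lambda>p. (1 - fst p) * \<phi> (snd p) + fst p * snd p)"
      by (intro continuous_intros continuous_on_compose2[OF \<phi>(1)]) auto
    moreover have "(1 - s) * \<phi> t + s * t \<in> {0..1}" if "s \<in> {0..1}" "t \<in> {0..1}" for s t
    proof -
      have "\<phi> t \<in> {0..1}" using \<phi>(2) that(2) by blast
      then show ?thesis
        using that convex_bound_le[of "\<phi> t" 1 t "1 - s" s] by auto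
    qed
    ultimately show "continuous_map (prod_topology ?I ?I) ?I (\<lambda>(s,t). (1 - s) * \<phi> t + s * t)"
      by (auto simp: continuous_map_in_subtopology case_prod_unfold simp flip: subtopology_Times)
  qed (use \<phi> in auto)
  from homotopic_with_compose_continuous_map_left[OF this, of T q "\<lambda>h. h 0 = h 1"] q
  show ?thesis by (auto simp: pathin_def)
qed

section \<open>Polygons in the space and edge paths in the complex\<close>

primrec polygon :: "(nat \<Rightarrow> real \<Rightarrow> 'a) \<Rightarrow> nat \<Rightarrow> real \<Rightarrow> 'a" where
  "polygon g 0 = g 0"
| "polygon g (Suc k) = path_join (polygon g k) (g (Suc k))"

definition vertex :: "'a \<Rightarrow> 'a \<Rightarrow> real" where
  "vertex v = (\<lambda>x. if x = v then 1 else 0)"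

lemma vertex_closed_simplex: "v \<in> \<sigma> \<Longrightarrow> finite \<sigma> \<Longrightarrow> vertex v \<in> closed_simplex \<sigma>"
  by (auto simp: vertex_def closed_simplex_def)

lemma pathin_segment_vertex:
  "pathin euclidean (\<lambda>t. segment_point t (vertex v) (vertex w))"
proof -
  have "continuous_on {0..1} (\<lambda>t. segment_point t (vertex v) (vertex w))"
    by (rule continuous_on_coordinatewise_then_product) (auto simp: segment_point_def intro!: continuous_intros)
  then show ?thesis by (simp add: pathin_def)
qed

context Metric_space
begin

text \<open>The paths in the nested joins have different speeds; \<open>\<phi>\<close> is the reparametrisation that reaches
\<open>i / n\<close> when the polygon reaches \<open>v i\<close>, and \<open>Q\<close> is the corresponding edge path of the complex.\<close>
lemma polygon_track:
  assumes g: "\<And>i. i \<le> k \<Longrightarrow> geodesic_path (v i) (v (Suc i)) (g i)" and n: "0 < (n::nat)"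
  shows "pathin mtopology (polygon g k) \<and> polygon g k 0 = v 0 \<and> polygon g k 1 = v (Suc k) \<and>
    (\<exists>\<phi> Q. pathin euclideanreal \<phi> \<and> \<phi> 0 = 0 \<and> \<phi> 1 = Suc k / n \<and>
       pathin euclidean Q \<and> Q 0 = vertex (v 0) \<and> Q 1 = vertex (v (Suc k)) \<and>
       (\<forall>t\<in>{0..1}. \<exists>i\<le>k. \<phi> t \<in> {i / n..Suc i / n} \<and> Q t \<in> closed_simplex {v i, v (Suc i)} \<and>
          d (v i) (polygon g k t) + d (polygon g k t) (v (Suc i)) = d (v i) (v (Suc i))))"
  using g
proof (induction k)
  case 0
  have g: "geodesic_path (v 0) (v (Suc 0)) (g 0)" using 0 by simp
  have "\<exists>\<phi> Q. pathin euclideanreal \<phi> \<and> \<phi> 0 = 0 \<and> \<phi> 1 = Suc 0 / n \<and>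
       pathin euclidean Q \<and> Q 0 = vertex (v 0) \<and> Q 1 = vertex (v (Suc 0)) \<and>
       (\<forall>t\<in>{0..1}. \<exists>i\<le>0. \<phi> t \<in> {i / n..Suc i / n} \<and> Q t \<in> closed_simplex {v i, v (Suc i)} \<and>
          d (v i) (g 0 t) + d (g 0 t) (v (Suc i)) = d (v i) (v (Suc i)))"
  proof (intro exI[of _ "\<lambda>t. t / n"] exI[of _ "\<lambda>t. segment_point t (vertex (v 0)) (vertex (v (Suc 0)))"] conjI ballI)
    show "pathin euclideanreal (\<lambda>t. t / n)" using n by (auto simp: pathin_def intro!: continuous_intros)
    show "pathin euclidean (\<lambda>t. segment_point t (vertex (v 0)) (vertex (v (Suc 0))))"
      by (rule pathin_segment_vertex)
  qed (use geodesic_path_dist(3)[OF g] in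
      \<open>auto simp: divide_right_mono intro!: segment_point_closed_simplex vertex_closed_simplex\<close>)
  then show ?case using geodesic_path_pathin[OF g] g by (auto simp: geodesic_path_def)
next
  case (Suc k)
  let ?W = "polygon g k"
  from Suc.IH Suc.prems obtain \<phi> Q where W: "pathin mtopology ?W" "?W 0 = v 0" "?W 1 = v (Suc k)"
    and \<phi>: "pathin euclideanreal \<phi>" "\<phi> 0 = 0" "\<phi> 1 = Suc k / n"
    and Q: "pathin euclidean Q" "Q 0 = vertex (v 0)" "Q 1 = vertex (v (Suc k))"
    and all: "\<And>t. t\<in>{0..1} \<Longrightarrow> \<exists>i\<le>k. \<phi> t \<in> {i / n..Suc i / n} \<and> Q t \<in> closed_simplex {v i, v (Suc i)} \<and>
          d (v i) (?W t) + d (?W t) (v (Suc i)) = d (v i) (v (Suc i))" by auto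
  have g: "geodesic_path (v (Suc k)) (v (Suc (Suc k))) (g (Suc k))" using Suc.prems by simp
  then have gk: "g (Suc k) 0 = v (Suc k)" "g (Suc k) 1 = v (Suc (Suc k))" by (auto simp: geodesic_path_def)
  define \<phi>2 :: "real \<Rightarrow> real" where "\<phi>2 = (\<lambda>t. (real (Suc k) + t) / n)"
  define Q2 where "Q2 = (\<lambda>t. segment_point t (vertex (v (Suc k))) (vertex (v (Suc (Suc k)))))"
  have \<phi>2: "pathin euclideanreal \<phi>2" "\<phi>2 0 = Suc k / n" "\<phi>2 1 = Suc (Suc k) / n"
    using n by (auto simp: \<phi>2_def pathin_def intro!: continuous_intros)
  have Q2: "pathin euclidean Q2" "Q2 0 = vertex (v (Suc k))" "Q2 1 = vertex (v (Suc (Suc k)))"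
    unfolding Q2_def by (auto simp: pathin_segment_vertex)
  have all2: "\<phi>2 t \<in> {Suc k / n..Suc (Suc k) / n}" "Q2 t \<in> closed_simplex {v (Suc k), v (Suc (Suc k))}"
    "d (v (Suc k)) (g (Suc k) t) + d (g (Suc k) t) (v (Suc (Suc k))) = d (v (Suc k)) (v (Suc (Suc k)))"
    if "t \<in> {0..1}" for t
    using geodesic_path_dist(3)[OF g that] that n unfolding \<phi>2_def Q2_def
    by (auto intro!: divide_right_mono segment_point_closed_simplex vertex_closed_simplex)
  show ?case
  proof (intro conjI exI[of _ "path_join \<phi> \<phi>2"] exI[of _ "path_join Q Q2"] ballI)
    show "pathin mtopology (polygon g (Suc k))"
      using pathin_path_join[OF W(1) geodesic_path_pathin[OF g]] W gk by simp
    show "pathin euclideanreal (path_join \<phi> \<phi>2)" "pathin euclidean (path_join Q Q2)"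
      using pathin_path_join[OF \<phi>(1) \<phi>2(1)] pathin_path_join[OF Q(1) Q2(1)] \<phi> \<phi>2 Q Q2 by auto
    fix t :: real assume t: "t \<in> {0..1}"
    show "\<exists>i\<le>Suc k. path_join \<phi> \<phi>2 t \<in> {i / n..Suc i / n} \<and> path_join Q Q2 t \<in> closed_simplex {v i, v (Suc i)} \<and>
          d (v i) (polygon g (Suc k) t) + d (polygon g (Suc k) t) (v (Suc i)) = d (v i) (v (Suc i))"
    proof (cases "t \<le> 1/2")
      case True
      then obtain i where "i \<le> k" "\<phi> (2 * t) \<in> {i / n..Suc i / n}" "Q (2 * t) \<in> closed_simplex {v i, v (Suc i)}"
        "d (v i) (?W (2 * t)) + d (?W (2 * t)) (v (Suc i)) = d (v i) (v (Suc i))"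
        using all[of "2 * t"] t by auto
      then show ?thesis using True by (intro exI[of _ i]) (simp add: path_join_def)
    next
      case False
      then show ?thesis using all2[of "2 * t - 1"] t
        by (intro exI[of _ "Suc k"]) (simp add: path_join_def)
    qed
  qed (use W \<phi> \<phi>2 Q Q2 gk in \<open>auto simp: path_join_ends\<close>)
qed

text \<open>The vertices of \<open>\<psi> p\<close> and \<open>\<psi>' p\<close> are less than
  \<open>e + e'\<close> apart, so the two maps are contiguous. This permits a finer mesh adapted to
  a particular polygon while \<open>\<psi>\<close> stays fixed.\<close>

lemma rips_approx_homotopic:
  assumes a: "rips_approx r e \<psi>" and b: "rips_approx r e' \<psi>'" and "e + e' \<le> r"
  shows "homotopic_with (\<lambda>_. True) mtopology (rips_topology M d r) \<psi> \<psi>'"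
proof (rule homotopic_with_segment[where A = "(\<Union>p\<in>M. supp (\<psi> p)) \<union> (\<Union>p\<in>M. supp (\<psi>' p))"])
  show "finite ((\<Union>p\<in>M. supp (\<psi> p)) \<union> (\<Union>p\<in>M. supp (\<psi>' p)))"
    using rips_approx_finite[OF a] rips_approx_finite[OF b] by (rule finite_UnI)
  fix p assume "p \<in> topspace mtopology"
  then have p: "p \<in> M" by simp
  note A = rips_approxD[OF a p] and B = rips_approxD[OF b p]
  show "\<psi> p \<in> rips_carrier M d r" "\<psi>' p \<in> rips_carrier M d r" by (rule A B)+
  show "supp (\<psi> p) \<union> supp (\<psi>' p) \<subseteq> (\<Union>p\<in>M. supp (\<psi> p)) \<union> (\<Union>p\<in>M. supp (\<psi>' p))"
    using p by (intro Un_mono UN_upper)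
  have sA: "rips_simplex M d r (supp (\<psi> p))" and sB: "rips_simplex M d r (supp (\<psi>' p))"
    using rips_carrier_supp(1)[OF A(1)] rips_carrier_supp(1)[OF B(1)] by auto
  have cross: "d u w < r" "d w u < r" if u: "u \<in> supp (\<psi> p)" and w: "w \<in> supp (\<psi>' p)" for u w
  proof -
    have "d u w \<le> d p u + d p w" using u w A(3) B(3) by (intro triangle'' p) auto
    then show "d u w < r" using A(2)[OF u] B(2)[OF w] assms(3) by linarith
    then show "d w u < r" using commute[of w u] by simp
  qed
  show "rips_simplex M d r (supp (\<psi> p) \<union> supp (\<psi>' p))"
    unfolding rips_simplex_def
  proof (intro conjI ballI)
    fix u w assume "u \<in> supp (\<psi> p) \<union> supp (\<psi>' p)" "w \<in> supp (\<psi> p) \<union> supp (\<psi>' p)"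
    then show "d u w < r" using cross sA sB unfolding rips_simplex_def by (elim UnE) blast+
  qed (use sA sB in \<open>auto simp: rips_simplex_def\<close>)
next
  fix a' show "continuous_map mtopology euclideanreal (\<lambda>p. \<psi> p a')" "continuous_map mtopology euclideanreal (\<lambda>p. \<psi>' p a')"
    by (rule rips_approx_coordinate[OF a] rips_approx_coordinate[OF b])+
qed auto

end

context Metric_space
begin

text \<open>The polygon is homotopic to the closed edge path \<open>Q\<close>: each point of an edge
\<open>[v i, v (i+1)]\<close> is at distance at most \<open>d (v i) (v (i+1)) < r\<close> from both ends, so the points
close to it span a simplex together with \<open>v i\<close> and \<open>v (i+1)\<close>.\<close>
lemma closed_polygon_homotopic:
  assumes v: "\<And>i. i \<le> Suc k \<Longrightarrow> v i \<in> M" "\<And>i. i \<le> k \<Longrightarrow> d (v i) (v (Suc i)) < r"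
    and W: "pathin mtopology W" "W 0 = W 1" and Q: "pathin euclidean Q" "Q 0 = Q 1"
    and near: "\<And>t. t \<in> {0..1} \<Longrightarrow> \<exists>i\<le>k. Q t \<in> closed_simplex {v i, v (Suc i)} \<and>
       d (v i) (W t) + d (W t) (v (Suc i)) = d (v i) (v (Suc i))"
    and \<psi>: "rips_approx r e \<psi>" and e: "0 < e" "2 * e \<le> r"
    and ex: "\<And>e'. 0 < e' \<Longrightarrow> 2 * e' \<le> r \<Longrightarrow> \<exists>\<psi>'. rips_approx r e' \<psi>'"
  shows "loop_homotopic (rips_topology M d r) Q (\<psi> \<circ> W)"
proof -
  let ?I = "top_of_set {0..1::real}" and ?R = "rips_topology M d r"
  \<comment> \<open>A point of an edge can be as far from an end as the whole edge is long, which
    leaves only \<open>r - d (v i) (v (Suc i))\<close> for the mesh. The bound by \<open>e\<close>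
    is for the comparison with \<open>\<psi>\<close>, since then
    \<open>e' + e \<le> r\<close>.\<close>
  define e' where "e' = min e (Min ((\<lambda>i. r - d (v i) (v (Suc i))) ` {..k}))"
  have e': "0 < e'" "e' \<le> e" unfolding e'_def using e v(2) by (auto simp: Min_gr_iff)
  have e'v: "d (v i) (v (Suc i)) + e' \<le> r" if "i \<le> k" for i
  proof -
    have "Min ((\<lambda>i. r - d (v i) (v (Suc i))) ` {..k}) \<le> r - d (v i) (v (Suc i))"
      using that by (intro Min_le) auto
    then show ?thesis unfolding e'_def by linarith
  qed
  obtain \<psi>' where \<psi>': "rips_approx r e' \<psi>'" using ex[of e'] e e' by auto
  have Wc: "continuous_map ?I mtopology W" using W by (simp add: pathin_def)
  have WM: "W t \<in> M" if "t \<in> {0..1}" for t using continuous_map_image_subset_topspace[OF Wc] that by auto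
  have Qc: "continuous_on {0..1} (\<lambda>t. Q t a)" for a
    using continuous_on_product_then_coordinatewise Q(1) by (auto simp: pathin_def)
  have simp: "rips_simplex M d r {v i, v (Suc i)}" if "i \<le> k" for i
    using v(1)[of i] v(1)[of "Suc i"] v(2)[OF that] that commute[of "v i" "v (Suc i)"] e
    unfolding rips_simplex_def by auto
  have 1: "loop_homotopic ?R Q (\<psi>' \<circ> W)"
  proof (rule homotopic_with_segment[where A = "v ` {..Suc k} \<union> (\<Union>p\<in>M. supp (\<psi>' p))"])
    show "finite (v ` {..Suc k} \<union> (\<Union>p\<in>M. supp (\<psi>' p)))"
      using rips_approx_finite[OF \<psi>'] by (intro finite_UnI finite_imageI finite_atMost)
    fix t assume "t \<in> topspace ?I"
    then have t: "t \<in> {0..1}" by simp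
    obtain i where i: "i \<le> k" "Q t \<in> closed_simplex {v i, v (Suc i)}"
      "d (v i) (W t) + d (W t) (v (Suc i)) = d (v i) (v (Suc i))" using near[OF t] by blast
    note P = rips_approxD[OF \<psi>' WM[OF t]]
    show Qt: "Q t \<in> rips_carrier M d r" using closed_simplex_subset_rips_carrier[OF simp[OF i(1)]] i(2) by auto
    show Pt: "(\<psi>' \<circ> W) t \<in> rips_carrier M d r" using P(1) by simp
    have sQ: "supp (Q t) \<subseteq> {v i, v (Suc i)}" using i(2) by (simp add: closed_simplex_def)
    show "supp (Q t) \<union> supp ((\<psi>' \<circ> W) t) \<subseteq> v ` {..Suc k} \<union> (\<Union>p\<in>M. supp (\<psi>' p))"
    proof (rule Un_mono)
      show "supp (Q t) \<subseteq> v ` {..Suc k}" using sQ i(1) by force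
      show "supp ((\<psi>' \<circ> W) t) \<subseteq> (\<Union>p\<in>M. supp (\<psi>' p))" using WM[OF t] by auto
    qed
    have cross: "d u w < r" "d w u < r" if u: "u \<in> supp (Q t)" and w: "w \<in> supp (\<psi>' (W t))" for u w
    proof -
      have u': "u = v i \<or> u = v (Suc i)" using u sQ by blast
      then have uM: "u \<in> M" using v(1)[of i] v(1)[of "Suc i"] i(1) by auto
      have "d u (W t) \<le> d (v i) (v (Suc i))"
        using u'
      proof
        assume u: "u = v i"
        show ?thesis unfolding u using i(3) nonneg[of "W t" "v (Suc i)"] by linarith
      next
        assume u: "u = v (Suc i)"
        show ?thesis unfolding u using i(3) nonneg[of "v i" "W t"] commute[of "v (Suc i)" "W t"] by linarith
      qed
      moreover have "d u w \<le> d u (W t) + d (W t) w" using P(3) w by (intro triangle uM WM t) auto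
      ultimately show "d u w < r" using P(2)[OF w] e'v[OF i(1)] by linarith
      then show "d w u < r" using commute[of w u] by simp
    qed
    have sA: "rips_simplex M d r (supp (Q t))" and sB: "rips_simplex M d r (supp (\<psi>' (W t)))"
      using rips_carrier_supp(1)[OF Qt] rips_carrier_supp(1)[OF P(1)] by auto
    show "rips_simplex M d r (supp (Q t) \<union> supp ((\<psi>' \<circ> W) t))"
      unfolding rips_simplex_def comp_apply
    proof (intro conjI ballI)
      fix u w assume "u \<in> supp (Q t) \<union> supp (\<psi>' (W t))" "w \<in> supp (Q t) \<union> supp (\<psi>' (W t))"
      then show "d u w < r" using cross sA sB unfolding rips_simplex_def by (elim UnE) blast+
    qed (use sA sB in \<open>auto simp: rips_simplex_def\<close>)
  next
    fix a show "continuous_map ?I euclideanreal (\<lambda>t. Q t a)" using Qc by simp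
    show "continuous_map ?I euclideanreal (\<lambda>t. (\<psi>' \<circ> W) t a)"
      using continuous_map_compose[OF Wc rips_approx_coordinate[OF \<psi>', of a]] by (simp add: o_def)
  qed (use W Q in simp)
  have "homotopic_with (\<lambda>_. True) mtopology ?R \<psi>' \<psi>"
    by (rule rips_approx_homotopic[OF \<psi>' \<psi>]) (use e e' in linarith)
  then have 2: "loop_homotopic ?R (\<psi>' \<circ> W) (\<psi> \<circ> W)"
    by (rule homotopic_with_compose_continuous_map_right[OF _ Wc]) (use W in simp)
  show ?thesis by (rule homotopic_with_trans[OF 1 2])
qed

end

lemma nodes_in_unit_interval:
  fixes x :: real
  assumes "x \<in> {real i / real n..real (Suc i) / real n}" "i \<le> n - 1" "0 < n"
  shows "x \<in> {0..1}"
proof -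
  have "real (Suc i) / n \<le> 1" "0 \<le> real i / n" using assms by (auto simp: field_simps)
  then show ?thesis using assms(1) by (meson atLeastAtMost_iff order_trans)
qed

section \<open>Approximation of loops by polygons\<close>

context compact_geodesic
begin

definition geo :: "'a \<Rightarrow> 'a \<Rightarrow> real \<Rightarrow> 'a" where
  "geo x y = (SOME p. geodesic_path x y p)"

lemma geo: "x \<in> X \<Longrightarrow> y \<in> X \<Longrightarrow> geodesic_path x y (geo x y)"
  unfolding geo_def by (rule someI_ex[OF geodesic_path_exists])

lemma geo_ends: "x \<in> X \<Longrightarrow> y \<in> X \<Longrightarrow> geo x y 0 = x" "x \<in> X \<Longrightarrow> y \<in> X \<Longrightarrow> geo x y 1 = y"
  using geo by (auto simp: geodesic_path_def)

lemma pathin_geo: "x \<in> X \<Longrightarrow> y \<in> X \<Longrightarrow> pathin mtopology (geo x y)"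
  using geodesic_path_pathin geo by blast

text \<open>With a finite net of vertices, every loop is homotopic to a closed polygon, whose class is
the sum of the classes of the triangles spanned by its edges and its initial vertex.\<close>
lemma finite_loop_classes:
  assumes tri: "tripod \<epsilon>" and \<epsilon>: "0 < \<epsilon>"
  shows "finite (loop_classes mtopology)"
proof -
  \<comment> \<open>Five errors occur: three bound an edge of the polygon, one leads from a node of
    \<open>q\<close> to its vertex, and one is the variation of \<open>q\<close> between
    nodes.\<close>
  obtain N where N: "finite N" "N \<subseteq> X" "\<And>x. x \<in> X \<Longrightarrow> \<exists>a\<in>N. d x a < \<epsilon> / 5"
    using finite_net[of "\<epsilon> / 5"] \<epsilon> by auto
  then obtain \<nu> where \<nu>: "\<And>x. x \<in> X \<Longrightarrow> \<nu> x \<in> N \<and> d x (\<nu> x) < \<epsilon> / 5" by metis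
  \<comment> \<open>The first family consists of the closed polygons with one edge, which start the
    induction. The second contains the triangles in exactly the form that the additivity clause
    produces, with the diagonal reversed.\<close>
  define \<L> where "\<L> = (\<lambda>(a,b). path_join (geo a b) (geo b a)) ` (N \<times> N) \<union>
     (\<lambda>(a,b,z). path_join (path_join (path_reverse (geo a z)) (geo a b)) (geo b z)) ` (N \<times> N \<times> N)"
  have fin: "finite \<L>" unfolding \<L>_def using N by auto
  have poly: "c (path_join (polygon (\<lambda>i. geo (v i) (v (Suc i))) k) (geo (v (Suc k)) (v 0))) =
      c' (path_join (polygon (\<lambda>i. geo (v i) (v (Suc i))) k) (geo (v (Suc k)) (v 0)))"
    if c: "c \<in> loop_classes mtopology" "c' \<in> loop_classes mtopology" and eq: "\<And>p. p \<in> \<L> \<Longrightarrow> c p = c' p"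
      and v: "\<And>i. v i \<in> N" for c c' v k
  proof (induction k)
    case 0
    have "path_join (geo (v 0) (v (Suc 0))) (geo (v (Suc 0)) (v 0)) \<in> \<L>"
      unfolding \<L>_def using v by (intro UnI1 image_eqI[of _ _ "(v 0, v (Suc 0))"]) auto
    then show ?case using eq by simp
  next
    case (Suc k)
    let ?g = "\<lambda>i. geo (v i) (v (Suc i))"
    have vX: "v i \<in> X" for i using v N by auto
    have pg: "pathin mtopology (polygon ?g k)" "polygon ?g k 0 = v 0" "polygon ?g k 1 = v (Suc k)"
      using polygon_track[of k v ?g 1] geo vX by auto
    let ?t = "path_join (path_join (path_reverse (geo (v (Suc k)) (v 0))) (geo (v (Suc k)) (v (Suc (Suc k))))) (geo (v (Suc (Suc k))) (v 0))"
    have t: "?t \<in> \<L>"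
      unfolding \<L>_def using v by (intro UnI2 image_eqI[of _ _ "(v (Suc k), v (Suc (Suc k)), v 0)"]) auto
    have step: "b (path_join (polygon ?g (Suc k)) (geo (v (Suc (Suc k))) (v 0))) =
       (b (path_join (polygon ?g k) (geo (v (Suc k)) (v 0))) \<noteq> b ?t)" if "b \<in> loop_classes mtopology" for b
      unfolding polygon.simps
      by (rule loop_classesD(3)[OF that pg(1)]) (simp_all add: pathin_geo vX geo_ends pg)
    show ?case by (simp only: step[OF c(1)] step[OF c(2)] Suc.IH eq[OF t])
  qed
  have "inj_on (\<lambda>c. {p \<in> \<L>. c p}) (loop_classes mtopology)"
  proof (rule inj_onI)
    fix c c' assume c: "c \<in> loop_classes mtopology" "c' \<in> loop_classes mtopology"
      and "{p \<in> \<L>. c p} = {p \<in> \<L>. c' p}"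
    then have eq: "\<And>p. p \<in> \<L> \<Longrightarrow> c p = c' p" by blast
    have "c q = c' q" if q: "pathin mtopology q" "q 0 = q 1" for q
    proof -
      have qX: "q t \<in> X" if "t \<in> {0..1}" for t
        using continuous_map_image_subset_topspace[OF q(1)[unfolded pathin_def]] that by auto
      obtain n :: nat where n: "0 < n" and uc: "\<And>s t. s \<in> {0..1} \<Longrightarrow> t \<in> {0..1} \<Longrightarrow> \<bar>s - t\<bar> \<le> 1 / n \<Longrightarrow> d (q s) (q t) < \<epsilon> / 5"
        using pathin_uniformly_continuous[OF q(1), of "\<epsilon> / 5"] \<epsilon> by auto
      \<comment> \<open>The minimum keeps \<open>v i\<close> in the net also beyond
        \<open>n\<close>, because \<open>poly\<close> is about sequences with all values in
        \<open>N\<close>.\<close>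
      define v where "v = (\<lambda>i. \<nu> (q (min 1 (real i / n))))"
      have node: "min 1 (real i / n) \<in> {0..1}" for i by auto
      have vN: "v i \<in> N" "v i \<in> X" for i unfolding v_def using \<nu>[OF qX[OF node]] N by auto
      have vq: "d (q (i / n)) (v i) < \<epsilon> / 5" if "i \<le> n" for i
        unfolding v_def using \<nu>[OF qX[OF node[of i]]] that n by (simp add: min_def split: if_splits)
      define k where "k = n - 1"
      have k: "Suc k = n" using n by (simp add: k_def)
      have vn: "v (Suc k) = v 0" using q(2) n by (simp add: v_def k)
      let ?g = "\<lambda>i. geo (v i) (v (Suc i))"
      let ?W = "polygon ?g k"
      have gv: "geodesic_path (v i) (v (Suc i)) (?g i)" for i by (rule geo[OF vN(2) vN(2)])
      from polygon_track[of k v ?g n, OF gv n]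
      obtain \<phi> Q where W: "pathin mtopology ?W" "?W 0 = v 0" "?W 1 = v (Suc k)"
        and \<phi>: "pathin euclideanreal \<phi>" "\<phi> 0 = 0" "\<phi> 1 = Suc k / n"
        and all: "\<forall>t\<in>{0..1}. \<exists>i\<le>k. \<phi> t \<in> {i / n..Suc i / n} \<and> Q t \<in> closed_simplex {v i, v (Suc i)} \<and>
          d (v i) (?W t) + d (?W t) (v (Suc i)) = d (v i) (v (Suc i))" by blast
      note all = bspec[OF all]
      have \<phi>1: "\<phi> 1 = 1" using \<phi> k n by simp
      have WX: "?W t \<in> X" if "t \<in> {0..1}" for t
        using continuous_map_image_subset_topspace[OF W(1)[unfolded pathin_def]] that by auto
      have \<phi>01: "\<phi> t \<in> {0..1}" if t: "t \<in> {0..1}" for t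
        using all[OF t] nodes_in_unit_interval[OF _ _ n] k by (metis diff_Suc_1)
      have near: "d (q (\<phi> t)) (?W t) < \<epsilon>" if t: "t \<in> {0..1}" for t
      proof -
        obtain i where i: "i \<le> k" "\<phi> t \<in> {i / n..Suc i / n}"
          "d (v i) (?W t) + d (?W t) (v (Suc i)) = d (v i) (v (Suc i))" using all[OF t] by blast
        have in01: "real i / n \<in> {0..1}" "real (Suc i) / n \<in> {0..1}" using i(1) k n by auto
        have w: "real (Suc i) / n = real i / n + 1 / n" by (simp add: add_divide_distrib)
        have 1: "d (q (i / n)) (v i) < \<epsilon> / 5" "d (q (Suc i / n)) (v (Suc i)) < \<epsilon> / 5" using vq[of i] vq[of "Suc i"] i(1) k by auto
        have 2: "d (q (\<phi> t)) (q (i / n)) < \<epsilon> / 5" "d (q (i / n)) (q (Suc i / n)) < \<epsilon> / 5"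
          using i(2) w by (intro uc \<phi>01 t in01; simp)+
        have "d (v i) (v (Suc i)) \<le> d (v i) (q (i / n)) + d (q (i / n)) (q (Suc i / n)) + d (q (Suc i / n)) (v (Suc i))"
          using triangle[OF vN(2)[of i] qX[OF in01(1)] vN(2)[of "Suc i"]]
            triangle[OF qX[OF in01(1)] qX[OF in01(2)] vN(2)[of "Suc i"]] by linarith
        then have 3: "d (v i) (?W t) < \<epsilon> / 5 + \<epsilon> / 5 + \<epsilon> / 5"
          using 1 2 i(3) nonneg[of "?W t" "v (Suc i)"] commute[of "v i" "q (i / n)"] by linarith
        have "d (q (\<phi> t)) (?W t) \<le> d (q (\<phi> t)) (q (i / n)) + d (q (i / n)) (v i) + d (v i) (?W t)"
          using triangle[OF qX[OF \<phi>01[OF t]] qX[OF in01(1)] WX[OF t]] triangle[OF qX[OF in01(1)] vN(2)[of i] WX[OF t]]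
          by linarith
        then show ?thesis using 1 2 3 by linarith
      qed
      \<comment> \<open>The polygons in \<open>poly\<close> end with a geodesic back to the initial
        vertex. Here it is constant, and \<open>q\<close> is made to wait at its end for the same
        time.\<close>
      let ?\<phi> = "path_join \<phi> (\<lambda>_. 1)"
      let ?T = "path_join ?W (geo (v (Suc k)) (v 0))"
      have const: "geo (v (Suc k)) (v 0) t = v 0" if t: "t \<in> {0..1}" for t
        using geodesic_path_dist(1,4)[OF geo[OF vN(2)[of "Suc k"] vN(2)[of 0]] t] vN(2)[of 0] by (simp add: vn)
      have T: "pathin mtopology ?T" "?T 0 = v 0" "?T 1 = v 0"
        using pathin_path_join[OF W(1) pathin_geo[OF vN(2)[of "Suc k"] vN(2)[of 0]]] W
        by (simp_all add: path_join_ends geo_ends vN vn)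
      have \<phi>': "continuous_on {0..1} ?\<phi>"
        using pathin_path_join[OF \<phi>(1), of "\<lambda>_. 1"] \<phi>1 by (simp add: pathin_def)
      have \<phi>'01: "?\<phi> ` {0..1} \<subseteq> {0..1}" using \<phi>01 by (auto simp: path_join_def)
      have 1: "loop_homotopic mtopology (q \<circ> ?\<phi>) q"
        by (rule loop_homotopic_reparam[OF q \<phi>' \<phi>'01]) (simp_all add: path_join_ends \<phi>)
      have 2: "loop_homotopic mtopology (q \<circ> ?\<phi>) ?T"
      proof (rule loop_homotopic_close[OF tri _ T(1)])
        show "pathin mtopology (q \<circ> ?\<phi>)" "(q \<circ> ?\<phi>) 0 = (q \<circ> ?\<phi>) 1" using loop_homotopic_imp_loops[OF 1] by auto
        fix t :: real assume t: "t \<in> {0..1}"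
        show "d ((q \<circ> ?\<phi>) t) (?T t) < \<epsilon>"
        proof (cases "t \<le> 1/2")
          case True then show ?thesis using near[of "2 * t"] t by (simp add: path_join_def)
        next
          case False
          then show ?thesis using near[of 1] const[of "2 * t - 1"] t W \<phi>1 vn by (simp add: path_join_def)
        qed
      qed (use T in simp)
      have qT: "b q = b ?T" if "b \<in> loop_classes mtopology" for b
        using loop_classesD(2)[OF that 1] loop_classesD(2)[OF that 2] by simp
      show ?thesis unfolding qT[OF c(1)] qT[OF c(2)] by (rule poly[OF c eq vN(1)])
    qed
    then show "c = c'" using loop_classesD(1)[OF c(1)] loop_classesD(1)[OF c(2)] by blast
  qed
  then show ?thesis
    by (rule inj_on_finite[where B = "Pow \<L>"]) (use fin in auto)
qed

text \<open>Simplicial approximation: at each node of a fine partition a vertex with a large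
  coordinate is chosen. Its coordinate stays positive on the adjacent subintervals, so there the
  support of \<open>\<rho>\<close> contains both chosen vertices and the edge path through them is
  contiguous to \<open>\<rho>\<close>.\<close>

lemma rips_loop_homotopic:
  assumes \<psi>: "rips_approx r e \<psi>" and e: "0 < e" "2 * e \<le> r"
    and \<rho>: "pathin (rips_topology X d r) \<rho>" "\<rho> 0 = \<rho> 1"
  obtains q where "pathin mtopology q" "q 0 = q 1" "loop_homotopic (rips_topology X d r) \<rho> (\<psi> \<circ> q)"
proof -
  let ?I = "top_of_set {0..1::real}" and ?R = "rips_topology X d r"
  have \<rho>c: "continuous_map ?I ?R \<rho>" using \<rho> by (simp add: pathin_def)
  have \<rho>R: "\<rho> t \<in> rips_carrier X d r" if "t \<in> {0..1}" for t
    using continuous_map_image_subset_topspace[OF \<rho>c] that by auto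
  have "compactin ?R (\<rho> ` {0..1})"
    by (rule image_compactin[OF _ \<rho>c]) (simp add: compactin_subtopology)
  note cpt = compactin_rips_finite_supp[OF this]
  define A where "A = (\<Union>f\<in>\<rho> ` {0..1}. supp f)"
  have A: "finite A" "\<And>t. t \<in> {0..1} \<Longrightarrow> supp (\<rho> t) \<subseteq> A"
    using cpt unfolding A_def by (assumption, intro UN_upper imageI)
  have \<rho>a: "continuous_on {0..1} (\<lambda>t. \<rho> t a)" for a
    using continuous_map_compose[OF \<rho>c continuous_map_rips_coordinate[of X d r a]] by (simp add: o_def)
  have \<rho>sum: "sum (\<rho> t) A = 1" "0 \<le> \<rho> t a" if "t \<in> {0..1}" for t a
    using rips_carrier_in_closed_simplex[OF \<rho>R[OF that] A(2)[OF that] A(1)] by (auto simp: closed_simplex_def)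
  have Ane: "A \<noteq> {}" using \<rho>sum(1)[of 0] by auto
  \<comment> \<open>The average coordinate, which at least one coordinate reaches.\<close>
  define \<delta> where "\<delta> = 1 / real (card A)"
  have \<delta>: "0 < \<delta>" using A Ane by (simp add: \<delta>_def card_gt_0_iff)
  have "\<exists>a\<in>A. \<delta> \<le> f a" if "sum f A = 1" for f :: "'a \<Rightarrow> real"
  proof (rule ccontr)
    assume "\<not> ?thesis"
    then have "sum f A < sum (\<lambda>_. \<delta>) A" using A Ane by (intro sum_strict_mono) auto
    then show False using that A Ane by (simp add: \<delta>_def)
  qed
  then obtain \<nu> where \<nu>: "\<And>f. sum f A = 1 \<Longrightarrow> \<nu> f \<in> A \<and> \<delta> \<le> f (\<nu> f)" by metis
  have "\<exists>n. (0::nat) < n \<and> (\<forall>s\<in>{0..1}. \<forall>t\<in>{0..1}. \<bar>s - t\<bar> \<le> 1 / n \<longrightarrow> \<bar>\<rho> s a - \<rho> t a\<bar> < \<delta>)" for a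
  proof -
    have "pathin Met_TC.mtopology (\<lambda>t. \<rho> t a)" using \<rho>a by (simp add: pathin_def)
    then show ?thesis
    proof (rule Met_TC.pathin_uniformly_continuous[OF _ \<delta>])
      fix n :: nat
      assume "0 < n" "\<And>s t. s \<in> {0..1} \<Longrightarrow> t \<in> {0..1} \<Longrightarrow> \<bar>s - t\<bar> \<le> 1 / n \<Longrightarrow> dist (\<rho> s a) (\<rho> t a) < \<delta>"
      then show ?thesis by (intro exI[of _ n] conjI ballI impI) (simp_all add: dist_real_def)
    qed
  qed
  then have "\<forall>a. \<exists>n. (0::nat) < n \<and> (\<forall>s\<in>{0..1}. \<forall>t\<in>{0..1}. \<bar>s - t\<bar> \<le> 1 / n \<longrightarrow> \<bar>\<rho> s a - \<rho> t a\<bar> < \<delta>)" by (rule allI)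
  from choice[OF this] obtain m where m0: "\<forall>a. (0::nat) < m a \<and>
    (\<forall>s\<in>{0..1}. \<forall>t\<in>{0..1}. \<bar>s - t\<bar> \<le> 1 / m a \<longrightarrow> \<bar>\<rho> s a - \<rho> t a\<bar> < \<delta>)" ..
  have m: "0 < m a" "\<lbrakk>s\<in>{0..1}; t\<in>{0..1}; \<bar>s - t\<bar> \<le> 1 / real (m a)\<rbrakk> \<Longrightarrow> \<bar>\<rho> s a - \<rho> t a\<bar> < \<delta>" for a s t
    using m0 by simp_all
  define n where "n = Max (m ` A)"
  have mn: "m a \<le> n" if "a \<in> A" for a unfolding n_def using that A by auto
  have n: "0 < n" using mn m(1) Ane by (metis all_not_in_conv gr0I le_zero_eq not_gr_zero)
  have uc: "\<bar>\<rho> s a - \<rho> t a\<bar> < \<delta>" if "a \<in> A" "s \<in> {0..1}" "t \<in> {0..1}" "\<bar>s - t\<bar> \<le> 1 / n" for a s t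
  proof (rule m(2)[OF that(2,3)])
    have "1 / real n \<le> 1 / real (m a)" using mn[OF that(1)] m(1)[of a] by (intro divide_left_mono) auto
    then show "\<bar>s - t\<bar> \<le> 1 / real (m a)" using that(4) by simp
  qed
  define v where "v = (\<lambda>i. \<nu> (\<rho> (min 1 (real i / n))))"
  define k where "k = n - 1"
  have k: "Suc k = n" using n by (simp add: k_def)
  have vn: "v (Suc k) = v 0" using \<rho>(2) n by (simp add: v_def k)
  have node: "min 1 (real i / n) \<in> {0..1}" for i by auto
  have v: "v i \<in> A" "\<delta> \<le> \<rho> (min 1 (real i / n)) (v i)" for i
    unfolding v_def using \<nu>[OF \<rho>sum(1)[OF node[of i]]] by auto
  have vsupp: "v i \<in> supp (\<rho> t)" "v (Suc i) \<in> supp (\<rho> t)"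
    if "i \<le> k" "t \<in> {i / n..Suc i / n}" for i t
  proof -
    have w: "real (Suc i) / n = real i / n + 1 / n" by (simp add: add_divide_distrib)
    have mi: "min 1 (real i / n) = i / n" "min 1 (real (Suc i) / n) = Suc i / n" using that(1) k n by auto
    have t: "t \<in> {0..1}" using nodes_in_unit_interval[OF that(2) _ n] that(1) by (simp add: k_def)
    have "\<bar>\<rho> (min 1 (real i / n)) (v i) - \<rho> t (v i)\<bar> < \<delta>"
      by (rule uc[OF v(1) node t]) (unfold mi, use that(2) w in \<open>auto simp del: of_nat_Suc\<close>)
    then show "v i \<in> supp (\<rho> t)" using v(2)[of i] by auto
    have "\<bar>\<rho> (min 1 (real (Suc i) / n)) (v (Suc i)) - \<rho> t (v (Suc i))\<bar> < \<delta>"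
      by (rule uc[OF v(1) node t]) (unfold mi, use that(2) w in \<open>auto simp del: of_nat_Suc\<close>)
    then show "v (Suc i) \<in> supp (\<rho> t)" using v(2)[of "Suc i"] by auto
  qed
  have vd: "v i \<in> X" "v (Suc i) \<in> X" "d (v i) (v (Suc i)) < r" if "i \<le> k" for i
  proof -
    have i: "real i / n \<in> {i / n..Suc i / n}" by (simp add: divide_right_mono)
    then have "real i / n \<in> {0..1}" by (rule nodes_in_unit_interval[OF _ _ n]) (use that in \<open>simp add: k_def\<close>)
    from rips_carrier_supp(1)[OF \<rho>R[OF this]] vsupp[OF that i]
    show "v i \<in> X" "v (Suc i) \<in> X" "d (v i) (v (Suc i)) < r" unfolding rips_simplex_def by auto
  qed
  have vX: "v i \<in> X" if "i \<le> Suc k" for i using vd(1)[of i] vd(2)[of k] that by (cases "i = Suc k") auto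
  let ?g = "\<lambda>i. geo (v i) (v (Suc i))"
  let ?W = "polygon ?g k"
  have gv: "geodesic_path (v i) (v (Suc i)) (?g i)" if "i \<le> k" for i by (rule geo[OF vd(1,2)[OF that]])
  from polygon_track[of k v ?g n, OF gv n]
  obtain \<phi> Q where W: "pathin mtopology ?W" "?W 0 = v 0" "?W 1 = v (Suc k)"
    and \<phi>: "pathin euclideanreal \<phi>" "\<phi> 0 = 0" "\<phi> 1 = Suc k / n"
    and Q: "pathin euclidean Q" "Q 0 = vertex (v 0)" "Q 1 = vertex (v (Suc k))"
    and all: "\<forall>t\<in>{0..1}. \<exists>i\<le>k. \<phi> t \<in> {i / n..Suc i / n} \<and> Q t \<in> closed_simplex {v i, v (Suc i)} \<and>
      d (v i) (?W t) + d (?W t) (v (Suc i)) = d (v i) (v (Suc i))" by blast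
  note all = bspec[OF all]
  have \<phi>1: "\<phi> 1 = 1" using \<phi> k n by simp
  have \<phi>01: "\<phi> t \<in> {0..1}" if t: "t \<in> {0..1}" for t
    using all[OF t] nodes_in_unit_interval[OF _ _ n] k by (metis diff_Suc_1)
  have 1: "loop_homotopic ?R (\<rho> \<circ> \<phi>) \<rho>"
    by (rule loop_homotopic_reparam[OF \<rho>]) (use \<phi> \<phi>1 \<phi>01 in \<open>auto simp: pathin_def\<close>)
  have 2: "loop_homotopic ?R (\<rho> \<circ> \<phi>) Q"
  proof (rule homotopic_with_segment[OF A(1)])
    fix t assume "t \<in> topspace ?I"
    then have t: "t \<in> {0..1}" by simp
    obtain i where i: "i \<le> k" "\<phi> t \<in> {i / n..Suc i / n}" "Q t \<in> closed_simplex {v i, v (Suc i)}" using all[OF t] by blast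
    show R: "(\<rho> \<circ> \<phi>) t \<in> rips_carrier X d r" using \<rho>R[OF \<phi>01[OF t]] by simp
    have S: "rips_simplex X d r (supp (\<rho> (\<phi> t)))" using rips_carrier_supp(1) R by simp
    have sub: "{v i, v (Suc i)} \<subseteq> supp (\<rho> (\<phi> t))" using vsupp[OF i(1,2)] by simp
    have fin: "finite (supp (\<rho> (\<phi> t)))" using S by (simp add: rips_simplex_def)
    show "Q t \<in> rips_carrier X d r"
      using closed_simplex_subset_rips_carrier[OF S] closed_simplex_mono[OF sub fin] i(3) by blast
    have "supp (Q t) \<subseteq> {v i, v (Suc i)}" using i(3) by (simp add: closed_simplex_def)
    then have un: "supp ((\<rho> \<circ> \<phi>) t) \<union> supp (Q t) = supp (\<rho> (\<phi> t))" using sub by auto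
    show "supp ((\<rho> \<circ> \<phi>) t) \<union> supp (Q t) \<subseteq> A" unfolding un by (rule A(2)[OF \<phi>01[OF t]])
    show "rips_simplex X d r (supp ((\<rho> \<circ> \<phi>) t) \<union> supp (Q t))" unfolding un by (rule S)
  next
    fix a
    have "continuous_on {0..1} (\<lambda>t. \<rho> (\<phi> t) a)"
      by (rule continuous_on_compose2[OF \<rho>a]) (use \<phi> \<phi>01 in \<open>auto simp: pathin_def\<close>)
    then show "continuous_map ?I euclideanreal (\<lambda>t. (\<rho> \<circ> \<phi>) t a)" by simp
    show "continuous_map ?I euclideanreal (\<lambda>t. Q t a)"
      using continuous_on_product_then_coordinatewise Q(1) by (auto simp: pathin_def)
  qed (use \<phi> \<phi>1 Q \<rho> vn in simp)
  have 3: "loop_homotopic ?R Q (\<psi> \<circ> ?W)"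
    by (rule closed_polygon_homotopic[where v = v and k = k, OF vX vd(3) W(1) _ Q(1) _ _ \<psi> e rips_approx_exists])
      (use W Q vn all in auto)
  show ?thesis
  proof (rule that)
    show "pathin mtopology ?W" "?W 0 = ?W 1" using W vn by auto
    show "loop_homotopic ?R \<rho> (\<psi> \<circ> ?W)"
      using homotopic_with_trans[OF homotopic_with_symD[OF 1] homotopic_with_trans[OF 2 3]] .
  qed
qed

text \<open>The corners span a simplex because all sides are shorter than \<open>r\<close>. The
  image of the triangle is homotopic to the boundary path of this simplex, which shrinks to a vertex
  within it.\<close>

lemma rips_triangle_trivial:
  assumes xyz: "x \<in> X" "y \<in> X" "z \<in> X" "d x y < r" "d y z < r" "d z x < r"
    and g: "geodesic_path x y p" "geodesic_path y z q" "geodesic_path z x q'"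
    and \<psi>: "rips_approx r e \<psi>" and e: "0 < e" "2 * e \<le> r"
    and C: "C \<in> loop_classes (rips_topology X d r)"
  shows "\<not> C (\<psi> \<circ> path_join (path_join p q) q')"
proof -
  let ?I = "top_of_set {0..1::real}" and ?R = "rips_topology X d r"
  \<comment> \<open>The corners in cyclic order: index 3 is \<open>x\<close> again, so that three
    edges close up.\<close>
  define v where "v = (\<lambda>i::nat. if i = 1 then y else if i = 2 then z else x)"
  define g where "g = (\<lambda>i::nat. if i = 0 then p else if i = 1 then q else q')"
  have poly: "polygon g (Suc (Suc 0)) = path_join (path_join p q) q'" by (simp add: g_def)
  have gv: "geodesic_path (v i) (v (Suc i)) (g i)" if "i \<le> Suc (Suc 0)" for i
    using that assms(7-9) by (auto simp: v_def g_def le_Suc_eq)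
  have vd: "d (v i) (v (Suc i)) < r" if "i \<le> Suc (Suc 0)" for i
    using that xyz by (auto simp: v_def le_Suc_eq)
  have vX: "v i \<in> {x, y, z}" "v i \<in> X" for i using xyz by (auto simp: v_def)
  have vn: "v (Suc (Suc (Suc 0))) = v 0" by (simp add: v_def)
  let ?W = "polygon g (Suc (Suc 0))"
  have "(0::nat) < 1" by simp
  from polygon_track[of "Suc (Suc 0)" v g, OF gv this]
  obtain Q where W: "pathin mtopology ?W" "?W 0 = v 0" "?W 1 = v (Suc (Suc (Suc 0)))"
    and Q: "pathin euclidean Q" "Q 0 = vertex (v 0)" "Q 1 = vertex (v (Suc (Suc (Suc 0))))"
    and all: "\<And>t. t\<in>{0..1} \<Longrightarrow> \<exists>i\<le>Suc (Suc 0). Q t \<in> closed_simplex {v i, v (Suc i)} \<and>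
      d (v i) (?W t) + d (?W t) (v (Suc i)) = d (v i) (v (Suc i))" by blast
  have 1: "loop_homotopic ?R Q (\<psi> \<circ> ?W)"
    by (rule closed_polygon_homotopic[where v = v and k = "Suc (Suc 0)", OF vX(2) vd W(1) _ Q(1) _ _ \<psi> e rips_approx_exists])
      (use W Q vn all in auto)
  have S: "rips_simplex X d r {x, y, z}"
    unfolding rips_simplex_def using xyz e commute[of y x] commute[of z y] commute[of x z] by auto
  have Qs: "Q t \<in> closed_simplex {x, y, z}" if t: "t \<in> {0..1}" for t
  proof -
    obtain i where i: "Q t \<in> closed_simplex {v i, v (Suc i)}" using all[OF t] by blast
    have "closed_simplex {v i, v (Suc i)} \<subseteq> closed_simplex {x, y, z}"
      by (rule closed_simplex_mono) (use vX(1) in auto)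
    then show ?thesis using i by blast
  qed
  have vs: "vertex x \<in> closed_simplex {x, y, z}" by (rule vertex_closed_simplex) auto
  have 2: "loop_homotopic ?R Q (\<lambda>_. vertex x)"
  proof (rule homotopic_with_segment[where A = "{x, y, z}"])
    fix t assume "t \<in> topspace ?I"
    then have t: "t \<in> {0..1}" by simp
    show "Q t \<in> rips_carrier X d r" "vertex x \<in> rips_carrier X d r"
      using closed_simplex_subset_rips_carrier[OF S] Qs[OF t] vs by auto
    show sub: "supp (Q t) \<union> supp (vertex x) \<subseteq> {x, y, z}" using Qs[OF t] vs by (simp add: closed_simplex_def)
    have "x \<in> supp (vertex x)" by (simp add: vertex_def)
    then show "rips_simplex X d r (supp (Q t) \<union> supp (vertex x))" by (intro rips_simplex_subset[OF S sub]) blast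
  next
    fix a show "continuous_map ?I euclideanreal (\<lambda>t. Q t a)"
      using continuous_on_product_then_coordinatewise Q(1) by (auto simp: pathin_def)
  qed (use Q vn in auto)
  have "C (\<psi> \<circ> ?W) = C (\<lambda>_. vertex x)"
    using loop_classesD(2)[OF C 1] loop_classesD(2)[OF C 2] by simp
  then show ?thesis using loop_classes_const[OF C] unfolding poly by blast
qed

end

section \<open>The class of an edge and the comparison of classes\<close>

context finite_metric_graph
begin

text \<open>The degree of the collapse onto the circle, reduced mod 2. It is nonzero on a triangle
  that crosses the edge once, in whichever direction.\<close>

definition edge_class :: "nat \<Rightarrow> (real \<Rightarrow> 'a) \<Rightarrow> bool" where
  "edge_class e p \<longleftrightarrow> pathin mtopology p \<and> p 0 = p 1 \<and>
     (\<exists>k::int. odd k \<and> winding_number (edge_wrap e \<circ> p) 0 = of_int k)"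

lemma edge_class:
  assumes e: "e \<in> E" shows "edge_class e \<in> loop_classes mtopology"
proof -
  have ne: "edge_wrap e w \<noteq> 0" for w using edge_wrap(3)[OF e, of w] by force
  note join = winding_number_path_join[OF edge_wrap(2)[OF e] ne]
  have int: "\<exists>k::int. winding_number (edge_wrap e \<circ> p) 0 = of_int k" if "pathin mtopology p" "p 0 = p 1" for p
  proof -
    have "winding_number (edge_wrap e \<circ> p) 0 \<in> \<int>"
      by (rule integer_winding_number)
        (use path_comp[OF edge_wrap(2)[OF e] that(1)] that(2) ne in \<open>auto simp: path_image_def pathfinish_def pathstart_def\<close>)
    then show ?thesis by (auto elim: Ints_cases)
  qed
  have 1: "edge_class e p = edge_class e q" if "loop_homotopic mtopology p q" for p q
    using loop_homotopic_imp_loops[OF that] winding_number_edge_wrap_homotopic[OF e that]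
    by (simp add: edge_class_def)
  have 2: "edge_class e (path_join (path_join \<alpha> \<beta>) \<rho>) =
     (edge_class e (path_join \<alpha> \<omega>) \<noteq> edge_class e (path_join (path_join (path_reverse \<omega>) \<beta>) \<rho>))"
    if p: "pathin mtopology \<alpha>" "pathin mtopology \<beta>" "pathin mtopology \<rho>" "pathin mtopology \<omega>"
      and ends: "\<alpha> 1 = \<beta> 0" "\<beta> 1 = \<rho> 0" "\<rho> 1 = \<alpha> 0" "\<omega> 0 = \<alpha> 1" "\<omega> 1 = \<alpha> 0" for \<alpha> \<beta> \<rho> \<omega>
  proof -
    let ?w = "\<lambda>p. winding_number (edge_wrap e \<circ> p) 0"
    note pj = pathin_path_join path_join_ends path_reverse_ends pathin_path_reverse p ends
    have P: "pathin mtopology (path_join (path_join \<alpha> \<beta>) \<rho>)" "pathin mtopology (path_join \<alpha> \<omega>)"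
      "pathin mtopology (path_join (path_join (path_reverse \<omega>) \<beta>) \<rho>)" by (simp_all add: pj)
    have rev: "edge_wrap e \<circ> path_reverse \<omega> = reversepath (edge_wrap e \<circ> \<omega>)"
      by (auto simp: path_reverse_def reversepath_def)
    have "?w (path_reverse \<omega>) = - ?w \<omega>"
      unfolding rev by (rule winding_number_reversepath)
        (use path_comp[OF edge_wrap(2)[OF e] p(4)] ne in \<open>auto simp: path_image_def\<close>)
    \<comment> \<open>The path \<open>\<omega>\<close> is traversed once in each direction, so its
      contributions cancel.\<close>
    then have sum: "?w (path_join (path_join \<alpha> \<beta>) \<rho>) = ?w (path_join \<alpha> \<omega>) + ?w (path_join (path_join (path_reverse \<omega>) \<beta>) \<rho>)"
      by (simp add: join pj)
    obtain i j k :: int where "?w (path_join (path_join \<alpha> \<beta>) \<rho>) = of_int i"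
      "?w (path_join \<alpha> \<omega>) = of_int j" "?w (path_join (path_join (path_reverse \<omega>) \<beta>) \<rho>) = of_int k"
      using int[OF P(1)] int[OF P(2)] int[OF P(3)] by (auto simp: path_join_ends path_reverse_ends ends)
    note ijk = this
    have "of_int i = (of_int (j + k) :: complex)" using sum unfolding ijk by simp
    then have i: "i = j + k" by (simp only: of_int_eq_iff)
    have iff: "(\<exists>m::int. odd m \<and> of_int l = (of_int m :: complex)) \<longleftrightarrow> odd l" for l by auto
    show ?thesis
      using P unfolding edge_class_def ijk iff by (simp add: path_join_ends path_reverse_ends ends i)
  qed
  show ?thesis unfolding loop_classes_def using 1 2 by (auto simp: edge_class_def)
qed

text \<open>\<open>\<Psi>\<close> is injective because every loop of the complex is homotopic to the
  image of a loop in X. The count then makes it surjective, so that \<open>edge_class e\<close> is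
  \<open>\<Psi> C\<close> for some \<open>C\<close>; but \<open>C\<close> vanishes on the image of
  the triangle, whereas \<open>edge_class e\<close> holds on the triangle.\<close>

lemma tripod_if_rips_homotopy_equivalent:
  assumes r: "0 < r" and he: "rips_topology X d r homotopy_equivalent_space mtopology"
  shows "tripod r"
proof (rule ccontr)
  assume "\<not> tripod r"
  then obtain e x y z p q q' where e: "e \<in> E" and X: "x \<in> X" "y \<in> X" "z \<in> X"
    and lt: "d x y < r" "d y z < r" "d z x < r"
    and g: "geodesic_path x y p" "geodesic_path y z q" "geodesic_path z x q'"
    and w: "winding_number (edge_wrap e \<circ> path_join (path_join p q) q') 0 \<in> {1, -1}"
    by (rule not_tripod_crossing)
  let ?T = "path_join (path_join p q) q'" and ?R = "rips_topology X d r"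
  have T: "edge_class e ?T"
  proof -
    have "\<exists>k::int. odd k \<and> winding_number (edge_wrap e \<circ> ?T) 0 = of_int k"
      using w by (elim insertE emptyE) (rule exI[of _ 1] exI[of _ "-1"]; simp)+
    then show ?thesis using triangle_path(1,2)[OF g] by (simp add: edge_class_def)
  qed
  obtain \<psi> where \<psi>: "rips_approx r (r / 2) \<psi>" using rips_approx_exists[of "r / 2" r] r by auto
  note \<psi>c = rips_approx_continuous_map[OF \<psi>]
  define \<Psi> where "\<Psi> = loop_pullback mtopology \<psi>"
  have fin: "finite (loop_classes mtopology)" using tripod_small finite_loop_classes by blast
  have \<Psi>: "\<Psi> ` loop_classes ?R \<subseteq> loop_classes mtopology"
    unfolding \<Psi>_def using loop_pullback_in_loop_classes[OF \<psi>c] by blast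
  have inj: "inj_on \<Psi> (loop_classes ?R)"
  proof (rule inj_onI)
    fix C C' assume C: "C \<in> loop_classes ?R" "C' \<in> loop_classes ?R" and eq: "\<Psi> C = \<Psi> C'"
    have "C \<rho> = C' \<rho>" if \<rho>: "pathin ?R \<rho>" "\<rho> 0 = \<rho> 1" for \<rho>
    proof -
      obtain q where q: "pathin mtopology q" "q 0 = q 1" "loop_homotopic ?R \<rho> (\<psi> \<circ> q)"
        using rips_loop_homotopic[OF \<psi> _ _ \<rho>] r by auto
      have "C (\<psi> \<circ> q) = C' (\<psi> \<circ> q)" using fun_cong[OF eq, of q] q by (simp add: \<Psi>_def loop_pullback_def)
      then show ?thesis using loop_classesD(2)[OF C(1) q(3)] loop_classesD(2)[OF C(2) q(3)] by simp
    qed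
    then show "C = C'" using loop_classesD(1)[OF C(1)] loop_classesD(1)[OF C(2)] by blast
  qed
  have finR: "finite (loop_classes ?R)" by (rule inj_on_finite[OF inj \<Psi> fin])
  obtain f g where fg: "continuous_map ?R mtopology f" "continuous_map mtopology ?R g"
    "homotopic_with (\<lambda>_. True) mtopology mtopology (f \<circ> g) id"
    using he unfolding homotopy_equivalent_space_def by blast
  \<comment> \<open>Here \<open>f\<close> is a left homotopy inverse of \<open>g\<close>, so pulling
    back along \<open>g\<close> reaches every class of X. No relation between \<open>g\<close> and
    \<open>\<psi>\<close> enters.\<close>
  have "card (loop_classes mtopology) \<le> card (loop_classes ?R)"
    using loop_classes_subset_pullback[OF fg(2,1,3)] surj_card_le[OF finR] by blast
  also have "\<dots> = card (\<Psi> ` loop_classes ?R)" by (rule card_image[OF inj, symmetric])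
  finally have "\<Psi> ` loop_classes ?R = loop_classes mtopology"
    by (rule card_seteq[OF fin \<Psi>])
  then obtain C where C: "C \<in> loop_classes ?R" "edge_class e = \<Psi> C" using edge_class[OF e] by blast
  have "C (\<psi> \<circ> ?T)" using T unfolding C(2) \<Psi>_def loop_pullback_def by blast
  then show False using rips_triangle_trivial[OF X lt g \<psi> _ _ C(1)] r by simp
qed

end

theorem mainTheorem8:
  fixes X :: "'a set" and d :: "'a \<Rightarrow> 'a \<Rightarrow> real" and r :: real
  assumes "metric_graph X d" and "0 < r"
  shows "rips_topology X d r homotopy_equivalent_space Metric_space.mtopology X d
         \<longleftrightarrow> ereal r \<le> shortest_loop X d / 3"
proof -
  obtain V E L \<gamma> where "finite_metric_graph X d V E L \<gamma>"
    using metric_graph_imp_finite_metric_graph[OF assms(1)] by blast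
  then interpret finite_metric_graph X d V E L \<gamma> .
  show ?thesis
    using tripod_if_rips_homotopy_equivalent[OF assms(2)] rips_homotopy_equivalent_if_tripod[OF _ assms(2)]
      tripod_if_le_shortest_loop le_shortest_loop_if_tripod[OF _ assms(2)] by blast
qed

end
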